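(* Assume that the terminal time $T$ satisfies $\mathbb{E}^x T<\infty$ for all $x\in\mathbb{R}^d$. Then the potential function $$u(x)=\mathbb{E}^x\int_0^\infty \ell(X_s^\sharp)\,ds=\int_0^\infty \mathbb{E}^x\big[\ell(X_s)\mathbf{1}_{\{T>s\}}\big]\,ds,\qquad x\in\mathbb{R}^d,$$ is a solution to the renewal type equation $$u(x)=h(x)+\int_{\mathbb{R}^d}u(x-z)\,\mathfrak{G}(x,dz),$$ and it admits the representation $$u(x)=\Big(h*\sum_{n=0}^\infty \mathfrak{G}^{*n}(x,\cdot)\Big)(x,x)=\int_{\mathbb{R}^d}h(x-y)\,\sum_{n=0}^\infty\mathfrak{G}^{*n}(x,dy),$$ where $\mathfrak{G}^{*0}(x,dz)=\delta_0(dz)$ and $\mathfrak{G}^{*n}(x,dz)=\int_{\mathbb{R}^d}\mathfrak{G}^{*(n-1)}(x,dy)\,\mathfrak{G}(x-y,dz-y)$ for $n\ge 1$.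
   Context: Setting. $(X_t)_{t\ge0}$ is a càdlàg strong Markov process with values in $\mathbb{R}^d$ on $(\Omega,\mathcal{F},(\mathcal{F}_t)_{t\ge0},(\mathbb{P}^x)_{x\in\mathbb{R}^d})$, with $\mathbb{P}^x(X_0=x)=1$, where $(\mathcal{F}_t)$ is a right-continuous natural filtration satisfying the usual conditions. It has the form $X_t=Y_t-Z_t$, where, for some fixed $\delta>0$: $Y$ is a càdlàg $\mathbb{R}^d$-valued strong Markov process with jumps of size strictly smaller than $\delta$ and $\mathbb{P}^x(Y_0=x)=1$; $Z_t=\sum_{k=1}^{N_t}U_k$ is a compound Poisson process independent of $Y$, where $(U_k)$ are i.i.d. with distribution $F$ on $\mathbb{R}^d$ and $|U_k|\ge\delta$, and $N$ is an independent Poisson process with intensity $\lambda>0$. We write $F$ also for the probability measure $F(A)=\mathbb{P}(U_1\in A)$. $T$ is an $(\mathcal{F}_t)$-terminal time: for every $(\mathcal{F}_t)$-stopping time $S$ one has $S+T\circ\theta_S=T$ on $\{S<T\}$, where $\theta$ denotes the shift operators. The killed process is $X^\sharp_t=X_t$ for $t<T$ and $X^\sharp_t=\partial$ for $t\ge T$, with $\partial$ a cemetery state; $Y^\sharp$ is defined analogously. $\ell:\mathbb{R}^d\to[0,\infty)$ is a bounded Borel function which is strictly positive on $\mathbb{R}^d_+=(0,\infty)^d$, extended by $\ell(\partial)=0$ (so $u(\partial)=0$). It is assumed throughout that $u$ is well defined and bounded. $\zeta\sim\mathrm{Exp}(\lambda)$ denotes the time of the first jump (of size $\ge\delta$) of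 $Z$. Define $$h(x)=\mathbb{E}^x\int_0^\zeta\ell(X_s^\sharp)\,ds=\int_0^\infty e^{-\lambda r}\,\mathbb{E}^x[\ell(Y_r)\mathbf{1}_{\{T>r\}}]\,dr,$$ and for Borel $A\subset\mathbb{R}^d$ $$\mathfrak{G}(x,A)=\mathbb{E}^x\big[F(A+Y_\zeta-x)\mathbf{1}_{\{T>\zeta\}}\big],$$ which, when $Y_s$ is not a deterministic function of $s$, can also be written as $\mathfrak{G}(x,dz)=\int_0^\infty\int_{\mathbb{R}^d}\lambda e^{-\lambda s}F(dz+w)\,\mathbb{P}^x(Y_s\in dw+x,\,T>s)\,ds$. For a function $h$ and a kernel $H(x,dy)$, the convolution is $(h*H)(z,x)=\int_{\mathbb{R}^d}h(z-y)\,H(x,dy)$.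
   Formalization: Added assumption: almost surely on {T=ζ} one has T∘θ_ζ=0 (without it the claim fails, e.g. when T is the time of the first jump of X of size ≥δ); and in 𝔊 the terminal time T is evaluated on the path of Y. *)

theory Defs
  imports "HOL-Probability.Probability"
begin

text \<open>A process indexed by \<open>[0,\<infinity>)\<close> is a map from the sample space to paths \<open>real \<Rightarrow> 'a\<close>; the
  values of a path at negative times carry no meaning and are invisible to the sigma-algebras
  below. Random times take values in \<^typ>\<open>ennreal\<close>.\<close>

definition cadlag :: "(real \<Rightarrow> 'a::topological_space) \<Rightarrow> bool" where
  "cadlag w \<longleftrightarrow> (\<forall>t\<ge>0. continuous (at_right t) w) \<and> (\<forall>t>0. \<exists>l. (w \<longlongrightarrow> l) (at_left t))"

definition path_algebra :: "real set \<Rightarrow> (real \<Rightarrow> 'a::topological_space) measure" where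
  "path_algebra I =
     vimage_algebra {w. cadlag w} (\<lambda>w. restrict w I) (Pi\<^sub>M I (\<lambda>_. borel))"

abbreviation path_space :: "(real \<Rightarrow> 'a::topological_space) measure" where
  "path_space \<equiv> path_algebra {0..}"

definition path_law ::
    "('a \<Rightarrow> 'w measure) \<Rightarrow> ('w \<Rightarrow> real \<Rightarrow> 'a) \<Rightarrow> 'a \<Rightarrow> (real \<Rightarrow> 'a::topological_space) measure" where
  "path_law P X x = distr (P x) path_space X"

definition path_shift :: "real \<Rightarrow> (real \<Rightarrow> 'a) \<Rightarrow> real \<Rightarrow> 'a" where
  "path_shift s w = (\<lambda>r. w (s + r))"

text \<open>The right-continuous natural filtration of the coordinate process, augmented by the sets
  that are null under every law in \<open>Q\<close>. The alternative \<open>s = \<infinity>\<close> is redundant for finite \<open>t\<close>; it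
  makes the sigma-algebra at \<open>t = \<infinity>\<close> the augmentation of \<open>path_space\<close>.\<close>

definition natural_filtration ::
    "(real \<Rightarrow> 'a::topological_space) measure set \<Rightarrow> ennreal \<Rightarrow> (real \<Rightarrow> 'a) measure" where
  "natural_filtration Q t = sigma {w. cadlag w}
     {A. A \<subseteq> {w. cadlag w} \<and>
         (\<forall>s. t < s \<or> s = \<infinity> \<longrightarrow>
           (\<exists>B\<in>sets (path_algebra {r. 0 \<le> r \<and> ennreal r \<le> s}). \<exists>N\<in>sets path_space.
              (\<forall>q\<in>Q. emeasure q N = 0) \<and> (A - B) \<union> (B - A) \<subseteq> N))}"

lemma filtration_natural_filtration: "filtration {w. cadlag w} (natural_filtration Q)"
proof
  show "space (natural_filtration Q i) = {w. cadlag w}" for i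
    unfolding natural_filtration_def by (rule space_measure_of) blast
  fix i j :: ennreal assume "i \<le> j"
  then have *: "j < s \<Longrightarrow> i < s" for s
    by (rule order.strict_trans1)
  show "sets (natural_filtration Q i) \<subseteq> sets (natural_filtration Q j)"
    unfolding natural_filtration_def
    by (subst (1 2) sets_measure_of, blast, blast, rule sigma_sets_mono') (use * in blast)
qed

text \<open>\<open>law x\<close> is the law on path space of the process started at \<open>x\<close>. The last clause is the
  conditional expectation of \<open>1\<^bsub>B\<^esub> \<circ> \<theta>\<^bsub>S\<^esub>\<close> given the pre-sigma-algebra of \<open>S\<close>, tested on the
  sets \<open>A\<close> of that sigma-algebra. Nonnegative integrals are used because \<open>A\<close> and \<open>S\<close> need only be
  measurable up to null sets.\<close>

definition strong_markov ::
    "(ennreal \<Rightarrow> (real \<Rightarrow> 'a::topological_space) measure) \<Rightarrow> ('a \<Rightarrow> (real \<Rightarrow> 'a) measure) \<Rightarrow> bool" where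
  "strong_markov \<FF> law \<longleftrightarrow>
     (\<forall>B\<in>sets path_space. (\<lambda>x. emeasure (law x) B) \<in> borel_measurable borel) \<and>
     (\<forall>x. AE w in law x. w 0 = x) \<and>
     (\<forall>x S. stopping_time \<FF> S \<longrightarrow>
       (\<forall>A\<in>sets (filtration.pre_sigma {w. cadlag w} \<FF> S). \<forall>B\<in>sets path_space.
         (\<integral>\<^sup>+w. indicator {w\<in>A. S w < \<infinity>} w * indicator B (path_shift (enn2real (S w)) w) \<partial>law x) =
         (\<integral>\<^sup>+w. indicator {w\<in>A. S w < \<infinity>} w * emeasure (law (w (enn2real (S w)))) B \<partial>law x)))"

definition terminal_time ::
    "(ennreal \<Rightarrow> (real \<Rightarrow> 'a::topological_space) measure) \<Rightarrow> ('a \<Rightarrow> (real \<Rightarrow> 'a) measure) \<Rightarrow>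
     ((real \<Rightarrow> 'a) \<Rightarrow> ennreal) \<Rightarrow> bool" where
  "terminal_time \<FF> law T \<longleftrightarrow> stopping_time \<FF> T \<and>
     (\<forall>S. stopping_time \<FF> S \<longrightarrow>
       (\<forall>x. AE w in law x. S w < T w \<longrightarrow> S w + T (path_shift (enn2real (S w)) w) = T w))"

definition poisson_process :: "'w measure \<Rightarrow> real \<Rightarrow> ('w \<Rightarrow> real \<Rightarrow> nat) \<Rightarrow> bool" where
  "poisson_process M rate N \<longleftrightarrow>
     N \<in> measurable M path_space \<and>
     (\<forall>\<omega>\<in>space M. N \<omega> 0 = 0 \<and> mono_on {0..} (N \<omega>)) \<and>
     (\<forall>s t. 0 \<le> s \<longrightarrow> s < t \<longrightarrow>
        distr M (count_space UNIV) (\<lambda>\<omega>. N \<omega> t - N \<omega> s) = measure_pmf (poisson_pmf (rate * (t - s)))) \<and>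
     (\<forall>n (t :: nat \<Rightarrow> real). 0 \<le> t 0 \<longrightarrow> (\<forall>i<n. t i < t (Suc i)) \<longrightarrow>
        prob_space.indep_vars M (\<lambda>_. count_space UNIV) (\<lambda>i \<omega>. N \<omega> (t (Suc i)) - N \<omega> (t i)) {..<n})"

text \<open>\<open>U\<close> is indexed from \<open>1\<close>.\<close>

definition compound_poisson_process ::
    "'w measure \<Rightarrow> real \<Rightarrow> 'a measure \<Rightarrow> ('w \<Rightarrow> real \<Rightarrow> nat) \<Rightarrow> (nat \<Rightarrow> 'w \<Rightarrow> 'a::euclidean_space) \<Rightarrow>
     ('w \<Rightarrow> real \<Rightarrow> 'a) \<Rightarrow> bool" where
  "compound_poisson_process M rate F N U Z \<longleftrightarrow>
     poisson_process M rate N \<and>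
     prob_space.indep_vars M (\<lambda>_. borel) U {1..} \<and>
     (\<forall>k\<ge>1. distr M borel (U k) = F) \<and>
     prob_space.indep_set M
       {N -` A \<inter> space M | A. A \<in> sets path_space}
       {(\<lambda>\<omega>. \<lambda>k\<in>{1..}. U k \<omega>) -` B \<inter> space M | B. B \<in> sets (Pi\<^sub>M {1..} (\<lambda>_. borel))} \<and>
     (\<forall>\<omega>\<in>space M. \<forall>t\<ge>0. Z \<omega> t = (\<Sum>k=1..N \<omega> t. U k \<omega>))"

text \<open>The first jump time of \<open>N\<close>, hence of the compound Poisson process when its jumps do not
  vanish.\<close>

definition first_jump :: "('w \<Rightarrow> real \<Rightarrow> nat) \<Rightarrow> 'w \<Rightarrow> real" where
  "first_jump N \<omega> = Inf {t. 0 \<le> t \<and> 1 \<le> N \<omega> t}"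

text \<open>\<^term>\<open>None\<close> is the cemetery state.\<close>

definition killed :: "((real \<Rightarrow> 'a) \<Rightarrow> ennreal) \<Rightarrow> (real \<Rightarrow> 'a) \<Rightarrow> real \<Rightarrow> 'a option" where
  "killed T w t = (if ennreal t < T w then Some (w t) else None)"

definition extend :: "('a \<Rightarrow> real) \<Rightarrow> 'a option \<Rightarrow> ennreal" where
  "extend l y = (case y of None \<Rightarrow> 0 | Some x \<Rightarrow> ennreal (l x))"

definition potential ::
    "('a \<Rightarrow> 'w measure) \<Rightarrow> ('w \<Rightarrow> real \<Rightarrow> 'a) \<Rightarrow> ((real \<Rightarrow> 'a) \<Rightarrow> ennreal) \<Rightarrow> ('a \<Rightarrow> real) \<Rightarrow> 'a \<Rightarrow> ennreal" where
  "potential P X T l x = (\<integral>\<^sup>+\<omega>. (\<integral>\<^sup>+s\<in>{0..}. extend l (killed T (X \<omega>) s) \<partial>lborel) \<partial>P x)"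

definition potential_to ::
    "('a \<Rightarrow> 'w measure) \<Rightarrow> ('w \<Rightarrow> real \<Rightarrow> 'a) \<Rightarrow> ((real \<Rightarrow> 'a) \<Rightarrow> ennreal) \<Rightarrow> ('a \<Rightarrow> real) \<Rightarrow>
     ('w \<Rightarrow> real) \<Rightarrow> 'a \<Rightarrow> ennreal" where
  "potential_to P X T l \<zeta> x =
     (\<integral>\<^sup>+\<omega>. (\<integral>\<^sup>+s\<in>{0..\<zeta> \<omega>}. extend l (killed T (X \<omega>) s) \<partial>lborel) \<partial>P x)"

text \<open>Here the killing time is that of the process \<open>Y\<close>, namely \<open>T\<close> evaluated on the path of \<open>Y\<close>.
  It is therefore independent of \<open>(\<zeta>, U\<^sub>1)\<close> when \<open>Y\<close> is.\<close>

definition renewal_kernel ::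
    "('a \<Rightarrow> 'w measure) \<Rightarrow> ('w \<Rightarrow> real \<Rightarrow> 'a) \<Rightarrow> ((real \<Rightarrow> 'a) \<Rightarrow> ennreal) \<Rightarrow> 'a measure \<Rightarrow>
     ('w \<Rightarrow> real) \<Rightarrow> 'a \<Rightarrow> 'a::euclidean_space measure" where
  "renewal_kernel P Y T F \<zeta> x = measure_of UNIV (sets borel)
     (\<lambda>A. \<integral>\<^sup>+\<omega>. emeasure F ((\<lambda>a. a + Y \<omega> (\<zeta> \<omega>) - x) ` A) *
               indicator {\<omega>. ennreal (\<zeta> \<omega>) < T (Y \<omega>)} \<omega> \<partial>P x)"

primrec kernel_power ::
    "('a \<Rightarrow> 'a measure) \<Rightarrow> nat \<Rightarrow> 'a \<Rightarrow> 'a::euclidean_space measure" where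
  "kernel_power G 0 = (\<lambda>x. return borel 0)"
| "kernel_power G (Suc n) = (\<lambda>x. measure_of UNIV (sets borel)
     (\<lambda>A. \<integral>\<^sup>+y. emeasure (G (x - y)) ((\<lambda>z. z - y) ` A) \<partial>kernel_power G n x))"

definition kernel_power_sum ::
    "('a \<Rightarrow> 'a measure) \<Rightarrow> 'a \<Rightarrow> 'a::euclidean_space measure" where
  "kernel_power_sum G x = measure_of UNIV (sets borel)
     (\<lambda>A. \<Sum>n. emeasure (kernel_power G n x) A)"

definition kernel_conv ::
    "('a \<Rightarrow> ennreal) \<Rightarrow> ('a \<Rightarrow> 'a measure) \<Rightarrow> 'a \<Rightarrow> 'a::euclidean_space \<Rightarrow> ennreal" where
  "kernel_conv h H z x = (\<integral>\<^sup>+y. h (z - y) \<partial>H x)"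

end

theory Submission
  imports Defs
begin

text \<open>
  The trajectory of \<open>X\<close> is split at the first jump \<open>\<zeta>\<close> of \<open>Z\<close>. Before \<open>\<zeta>\<close> it coincides with \<open>Y\<close>, at \<open>\<zeta>\<close> it
  jumps to \<open>Y\<^sub>\<zeta> - U\<^sub>1\<close>, and there it starts afresh by the strong Markov property. Hence \<open>u x\<close> is the
  contribution \<open>h x\<close> of the time before \<open>\<zeta>\<close> plus the mean of \<open>u (Y\<^sub>\<zeta> - U\<^sub>1)\<close> over the event \<open>\<zeta> < T\<close>. As \<open>Y\<close>,
  \<open>\<zeta>\<close> and \<open>U\<^sub>1\<close> are independent (\<open>compound_poisson_first_jump_law\<close>), the latter is the integral of \<open>u (x - z)\<close>
  against the renewal kernel \<open>G\<close> (\<open>pot_renewal\<close>, \<open>G_eq\<close>). Iterating the equation yields the partial sums of the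
  representation, up to a remainder bounded by \<open>sup u\<close> times the mass of the \<open>n\<close>-th power of \<open>G\<close>.

  That these masses tend to zero comes from the renewal equation with \<open>l\<close> replaced by \<open>1\<close>. Its potential is the
  finite mean of \<open>T\<close>, and its contribution before the first jump is the mean of \<open>min \<zeta> T\<close>, which equals
  \<open>1 / rate\<close> times the total mass of \<open>G x\<close> since \<open>\<zeta>\<close> is exponential and independent of \<open>Y\<close>
  (\<open>mean_time_to_jump\<close>). So the masses of the powers of \<open>G\<close> are summable (\<open>kernel_power_mass_tendsto_0\<close>).

  Three points need care. First, \<open>\<zeta>\<close> has to be a stopping time of the path of \<open>X\<close>. It is the first jump of size
  at least \<open>\<delta>\<close>, because \<open>Y\<close> has only smaller jumps and almost surely none at the independent time \<open>\<zeta>\<close>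
  (\<open>stopping_time_first_big_jump\<close>, \<open>AE_first_big_jump\<close>). Second, the killing times of \<open>X\<close> and \<open>Y\<close> need to be
  compared. They agree when truncated at \<open>\<zeta>\<close> (\<open>AE_killing_agrees\<close>), and that of \<open>Y\<close> almost surely differs from
  \<open>\<zeta>\<close>, but \<open>X\<close> may be killed by the jump itself. On that event \<open>X\<close> contributes nothing after \<open>\<zeta>\<close> whereas the
  kernel \<open>G\<close> counts \<open>Y\<close> as surviving; the hypothesis that the restarted path is then killed at once reconciles
  the two. Third, \<open>T\<close> is measurable only up to null sets, so a measurable version takes its place under integrals
  (\<open>stopping_time_measurable_version\<close>).
\<close>

section \<open>Cadlag path space\<close>

lemma space_path_algebra: "space (path_algebra I) = {w. cadlag w}"
  by (simp add: path_algebra_def)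

lemma measurable_coordinate:
  assumes "t \<in> I"
  shows "(\<lambda>w. w t) \<in> borel_measurable (path_algebra I)"
proof -
  have r: "(\<lambda>w. restrict w I) \<in> path_algebra I \<rightarrow>\<^sub>M Pi\<^sub>M I (\<lambda>_. borel :: 'a measure)"
    unfolding path_algebra_def by (rule measurable_vimage_algebra1) (auto simp: space_PiM)
  have "(\<lambda>w. restrict w I t) \<in> borel_measurable (path_algebra I :: (real \<Rightarrow> 'a) measure)"
    by (rule measurable_compose[OF r measurable_component_singleton[OF assms]])
  then show ?thesis using assms by simp
qed

lemma measurable_path_algebraI:
  fixes f :: "'w \<Rightarrow> real \<Rightarrow> 'a::topological_space"
  assumes "\<And>x. x \<in> space M \<Longrightarrow> cadlag (f x)"
    and "\<And>t. t \<in> I \<Longrightarrow> (\<lambda>x. f x t) \<in> borel_measurable M"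
  shows "f \<in> M \<rightarrow>\<^sub>M path_algebra I"
  unfolding path_algebra_def
  by (rule measurable_vimage_algebra2) (use assms in \<open>auto intro!: measurable_restrict\<close>)

text \<open>An event of \<open>path_algebra I\<close> is the preimage of an event of the product space over
  \<open>I\<close> under restriction. This is how an event before the first jump cannot tell \<open>X\<close>
  from \<open>Y\<close>.\<close>

lemma path_algebra_determined:
  assumes B: "B \<in> sets (path_algebra I)" and "cadlag w" "cadlag w'" "\<And>t. t \<in> I \<Longrightarrow> w t = w' t"
  shows "w \<in> B \<longleftrightarrow> w' \<in> B"
proof -
  have r: "restrict w I = restrict w' I" using assms(4) by (auto simp: restrict_def)
  have "sets (path_algebra I) = {(\<lambda>w. restrict w I) -` A \<inter> {w. cadlag w} |A. A \<in> sets (Pi\<^sub>M I (\<lambda>_. borel :: 'a measure))}"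
    unfolding path_algebra_def by (rule sets_vimage_algebra2) (auto simp: space_PiM)
  with B obtain A where "B = (\<lambda>w. restrict w I) -` A \<inter> {w. cadlag w}" by auto
  then show ?thesis using assms r by simp
qed

lemma cadlag_right:
  assumes "cadlag w" "0 \<le> t"
  shows "(w \<longlongrightarrow> w t) (at_right t)"
  using assms by (auto simp: cadlag_def continuous_within)

lemma cadlag_left_Lim:
  fixes w :: "real \<Rightarrow> 'a::t2_space"
  assumes "cadlag w" "0 < t"
  shows "(w \<longlongrightarrow> Lim (at_left t) w) (at_left t)"
proof -
  obtain l where l: "(w \<longlongrightarrow> l) (at_left t)" using assms by (auto simp: cadlag_def)
  moreover have "Lim (at_left t) w = l" by (rule tendsto_Lim[OF _ l]) simp
  ultimately show ?thesis by simp
qed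

lemma cadlag_path_shift:
  fixes w :: "real \<Rightarrow> 'a::topological_space"
  assumes "cadlag w" "0 \<le> s"
  shows "cadlag (path_shift s w)"
proof -
  have comm: "(+) s = (\<lambda>x. x + s)" by (simp add: fun_eq_iff add.commute)
  have R: "filtermap ((+) s) (at_right t) = at_right (s + t)" for t
    using filtermap_at_right_shift[of "-s" t] by (simp add: comm add.commute[of s])
  have L: "filtermap ((+) s) (at_left t) = at_left (s + t)" for t
    using filtermap_at_left_shift[of "-s" t]  by (simp add: comm add.commute[of s])
  have "((\<lambda>r. w (s + r)) \<longlongrightarrow> w (s + t)) (at_right t)" if "0 \<le> t" for t
    using cadlag_right[of w "s+t"] assms that by (simp add: R[symmetric] filterlim_filtermap)
  moreover have "\<exists>l. ((\<lambda>r. w (s + r)) \<longlongrightarrow> l) (at_left t)" if "0 < t" for t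
  proof -
    have "0 < s + t" using assms that by simp
    then obtain l where "(w \<longlongrightarrow> l) (at_left (s + t))"
      using assms unfolding cadlag_def by blast
    then show ?thesis by (auto simp: L[symmetric] filterlim_filtermap)
  qed
  ultimately show ?thesis
    by (auto simp: cadlag_def path_shift_def continuous_within)
qed

text \<open>The first point strictly above \<open>max 0 t\<close> on the grid of mesh \<open>1 / (n +
  1)\<close>. It approximates time from the right, the side on which cadlag paths are continuous, and takes
  only countably many values.\<close>

definition grid_above :: "nat \<Rightarrow> real \<Rightarrow> real" where
  "grid_above n t = real (nat \<lfloor>max 0 t * real (Suc n)\<rfloor> + 1) / real (Suc n)"

lemma grid_above_gt: "max 0 t < grid_above n t"
  and grid_above_le: "grid_above n t \<le> max 0 t + 1 / Suc n"
proof -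
  have *: "real (nat \<lfloor>max 0 t * Suc n\<rfloor>) = of_int \<lfloor>max 0 t * Suc n\<rfloor>" by simp
  have "max 0 t * Suc n < of_int \<lfloor>max 0 t * Suc n\<rfloor> + 1" by linarith
  then show "max 0 t < grid_above n t"
    unfolding grid_above_def of_nat_add * by (subst pos_less_divide_eq) auto
  have "of_int \<lfloor>max 0 t * Suc n\<rfloor> + 1 \<le> max 0 t * Suc n + 1" by linarith
  then have "(of_int \<lfloor>max 0 t * Suc n\<rfloor> + 1) / Suc n \<le> (max 0 t * Suc n + 1) / Suc n"
    by (rule divide_right_mono) simp
  then show "grid_above n t \<le> max 0 t + 1 / Suc n"
    unfolding grid_above_def of_nat_add * by (simp add: add_divide_distrib del: of_nat_nat)
qed

lemma filterlim_grid_above: "filterlim (\<lambda>n. grid_above n t) (at_right (max 0 t)) sequentially"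
proof -
  have "(\<lambda>n. grid_above n t) \<longlonglongrightarrow> max 0 t"
  proof (rule tendsto_sandwich)
    show "\<forall>\<^sub>F n in sequentially. max 0 t \<le> grid_above n t"
      using grid_above_gt by (auto intro!: always_eventually less_imp_le)
    show "\<forall>\<^sub>F n in sequentially. grid_above n t \<le> max 0 t + 1 / Suc n"
      using grid_above_le by (auto intro!: always_eventually)
    have "(\<lambda>n. max 0 t + 1 / real (Suc n)) \<longlonglongrightarrow> max 0 t + 0"
      by (intro tendsto_add tendsto_const LIMSEQ_Suc[OF lim_1_over_n])
    then show "(\<lambda>n. max 0 t + 1 / real (Suc n)) \<longlonglongrightarrow> max 0 t" by simp
  qed simp
  then show ?thesis
    using grid_above_gt[of t] less_imp_neq[OF grid_above_gt[of t], symmetric]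
    unfolding filterlim_at by (intro conjI always_eventually allI) auto
qed

text \<open>A right-continuous path is the limit of its values along \<open>grid_above\<close>, so that joint
  measurability in path and time reduces to that of countably many coordinates. Times are cut off at
  \<open>0\<close> because the sigma-algebra does not see negative times.\<close>

lemma measurable_evaluation:
  "(\<lambda>(w, t). w (max 0 t)) \<in> path_space \<Otimes>\<^sub>M borel \<rightarrow>\<^sub>M (borel :: 'a::metric_space measure)"
proof (rule borel_measurable_LIMSEQ_metric)
  fix n :: nat
  have g: "(\<lambda>x :: (real \<Rightarrow> 'a) \<times> real. nat \<lfloor>max 0 (snd x) * real (Suc n)\<rfloor>) \<in> path_space \<Otimes>\<^sub>M borel \<rightarrow>\<^sub>M count_space UNIV"
    by measurable
  have "(\<lambda>x. (fst x) (real (nat \<lfloor>max 0 (snd x) * real (Suc n)\<rfloor> + 1) / real (Suc n)))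
     \<in> path_space \<Otimes>\<^sub>M borel \<rightarrow>\<^sub>M (borel :: 'a measure)"
    by (rule measurable_compose_countable[OF _ g],
        rule measurable_compose[OF measurable_fst measurable_coordinate]) simp
  then show "(\<lambda>(w, t). w (grid_above n t)) \<in> path_space \<Otimes>\<^sub>M borel \<rightarrow>\<^sub>M (borel :: 'a measure)"
    by (simp add: grid_above_def case_prod_beta)
next
  fix x :: "(real \<Rightarrow> 'a) \<times> real" assume "x \<in> space (path_space \<Otimes>\<^sub>M borel)"
  then have "cadlag (fst x)" by (auto simp: space_pair_measure space_path_algebra)
  then have "(\<lambda>n. (fst x) (grid_above n (snd x))) \<longlonglongrightarrow> (fst x) (max 0 (snd x))"
    by (intro filterlim_compose[OF cadlag_right filterlim_grid_above]) auto
  then show "(\<lambda>n. case x of (w, t) \<Rightarrow> w (grid_above n t)) \<longlonglongrightarrow> (case x of (w, t) \<Rightarrow> w (max 0 t))"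
    by (simp add: case_prod_beta)
qed

lemma measurable_eval_max:
  fixes W :: "'w \<Rightarrow> real \<Rightarrow> 'a::metric_space"
  assumes "W \<in> M \<rightarrow>\<^sub>M path_space" "\<tau> \<in> borel_measurable M"
  shows "(\<lambda>x. W x (max 0 (\<tau> x))) \<in> borel_measurable M"
  using measurable_compose[OF measurable_Pair[OF assms] measurable_evaluation] by simp

lemma measurable_eval_random:
  fixes W :: "'w \<Rightarrow> real \<Rightarrow> 'a::metric_space"
  assumes "W \<in> M \<rightarrow>\<^sub>M path_space" "\<tau> \<in> borel_measurable M" "\<And>x. x \<in> space M \<Longrightarrow> 0 \<le> \<tau> x"
  shows "(\<lambda>x. W x (\<tau> x)) \<in> borel_measurable M"
  using measurable_eval_max[OF assms(1,2)] assms(3)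
  by (subst measurable_cong[where g="\<lambda>x. W x (max 0 (\<tau> x))"]) (auto simp: max_def)

lemma measurable_path_shift:
  fixes W :: "'w \<Rightarrow> real \<Rightarrow> 'a::metric_space"
  assumes W: "W \<in> M \<rightarrow>\<^sub>M path_space" "\<tau> \<in> borel_measurable M" "\<And>x. x \<in> space M \<Longrightarrow> 0 \<le> \<tau> x"
  shows "(\<lambda>x. path_shift (\<tau> x) (W x)) \<in> M \<rightarrow>\<^sub>M path_space"
proof (rule measurable_path_algebraI)
  fix x assume "x \<in> space M"
  then show "cadlag (path_shift (\<tau> x) (W x))"
    using measurable_space[OF W(1)] W(3) by (auto simp: space_path_algebra intro!: cadlag_path_shift)
next
  fix t :: real assume "t \<in> {0..}"
  then show "(\<lambda>x. path_shift (\<tau> x) (W x) t) \<in> borel_measurable M"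
    unfolding path_shift_def
    by (intro measurable_eval_random[OF W(1)] borel_measurable_add W(2)) (auto intro: add_nonneg_nonneg W(3))
qed

lemma right_continuous_rational:
  fixes w :: "real \<Rightarrow> 'a::topological_space"
  assumes "cadlag w" "0 \<le> t" "open D" "w t \<in> D" "t < u"
  shows "\<exists>q\<in>\<rat>. t < q \<and> q < u \<and> w q \<in> D"
proof -
  have "eventually (\<lambda>s. w s \<in> D) (at_right t)"
    by (rule topological_tendstoD[OF cadlag_right]) (use assms in auto)
  then obtain b where b: "t < b" "\<And>s. t < s \<Longrightarrow> s < b \<Longrightarrow> w s \<in> D"
    by (auto simp: eventually_at_right_field)
  obtain q where "q \<in> \<rat>" "t < q" "q < min b u"
    using Rats_dense_in_real[of t "min b u"] b assms by auto
  then show ?thesis using b by auto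
qed

text \<open>By right-continuity an open set is visited before time \<open>a\<close> if and only if it is
  visited at a rational time before \<open>a\<close>. The case distinction in the proof covers the paths that
  never visit \<open>D\<close>, for which the infimum is the default value \<open>Inf {}\<close>.\<close>

lemma measurable_hitting_time:
  fixes D :: "'a::topological_space set"
  assumes D: "open D"
  shows "(\<lambda>w. Inf {t. 0 \<le> t \<and> w t \<in> D}) \<in> borel_measurable path_space"
proof (rule borel_measurableI_less)
  fix a :: real
  let ?H = "\<lambda>w :: real \<Rightarrow> 'a. {t. 0 \<le> t \<and> w t \<in> D}"
  have *: "(Inf (?H w) < a) \<longleftrightarrow>
      (if \<exists>q\<in>{0..}\<inter>\<rat>. w q \<in> D then \<exists>q\<in>{0..<a}\<inter>\<rat>. w q \<in> D else Inf ({}::real set) < a)"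
    if w: "cadlag w" for w
  proof (cases "?H w = {}")
    case False
    have bdd: "bdd_below (?H w)" by (auto intro!: bdd_belowI[of _ 0])
    obtain t where t: "0 \<le> t" "w t \<in> D" using False by auto
    have 1: "\<exists>q\<in>{0..}\<inter>\<rat>. w q \<in> D"
      using right_continuous_rational[OF w t(1) D t(2), of "t+1"] t(1) by force
    have "(Inf (?H w) < a) \<longleftrightarrow> (\<exists>t\<in>?H w. t < a)"
      by (rule cInf_less_iff[OF False bdd])
    also have "\<dots> \<longleftrightarrow> (\<exists>q\<in>{0..<a}\<inter>\<rat>. w q \<in> D)"
    proof
      assume "\<exists>t\<in>?H w. t < a"
      then obtain t where t: "0 \<le> t" "w t \<in> D" "t < a" by auto
      then show "\<exists>q\<in>{0..<a}\<inter>\<rat>. w q \<in> D"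
        using right_continuous_rational[OF w t(1) D t(2,3)] by force
    qed auto
    finally show ?thesis using 1 by simp
  next
    case True
    then have "\<not> (\<exists>q\<in>{0..}\<inter>\<rat>. w q \<in> D)" by auto
    then show ?thesis unfolding True by simp
  qed
  have C: "countable ({0..}\<inter>\<rat> :: real set)" "countable ({0..<a}\<inter>\<rat> :: real set)"
    using countable_rat by (auto intro: countable_subset)
  have "Measurable.pred path_space (\<lambda>w. \<exists>q\<in>{0..}\<inter>\<rat>. w q \<in> D)"
       "Measurable.pred path_space (\<lambda>w. \<exists>q\<in>{0..<a}\<inter>\<rat>. w q \<in> D)"
    by (intro measurable_pred_countable C pred_sets2[OF borel_open[OF D] measurable_coordinate]; simp)+
  then have "Measurable.pred path_space (\<lambda>w. if \<exists>q\<in>{0..}\<inter>\<rat>. w q \<in> D then \<exists>q\<in>{0..<a}\<inter>\<rat>. w q \<in> D else Inf ({}::real set) < a)"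
    by measurable
  then have "{w\<in>space path_space. if \<exists>q\<in>{0..}\<inter>\<rat>. w q \<in> D then \<exists>q\<in>{0..<a}\<inter>\<rat>. w q \<in> D else Inf ({}::real set) < a} \<in> sets path_space"
    by (simp add: pred_def)
  also have "{w\<in>space path_space. if \<exists>q\<in>{0..}\<inter>\<rat>. w q \<in> D then \<exists>q\<in>{0..<a}\<inter>\<rat>. w q \<in> D else Inf ({}::real set) < a}
     = {w\<in>space path_space. Inf (?H w) < a}"
    by (intro Collect_cong conj_cong refl, subst *) (simp_all only: space_path_algebra mem_Collect_eq)
  finally show "{w\<in>space path_space. Inf (?H w) < a} \<in> sets path_space" .
qed

section \<open>Large jumps of cadlag paths\<close>

definition big_jump :: "real \<Rightarrow> (real \<Rightarrow> 'a::real_normed_vector) \<Rightarrow> real \<Rightarrow> bool" where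
  "big_jump \<delta> w t \<longleftrightarrow> 0 < t \<and> \<delta> \<le> norm (w t - Lim (at_left t) w)"

text \<open>The infimum is taken in the extended half-line, so that a path without large jumps gets the value
  \<open>\<infinity>\<close>.\<close>

definition first_big_jump :: "real \<Rightarrow> (real \<Rightarrow> 'a::real_normed_vector) \<Rightarrow> ennreal" where
  "first_big_jump \<delta> w = Inf {ennreal t | t. big_jump \<delta> w t}"

lemma first_big_jump_less_iff:
  "first_big_jump \<delta> w < c \<longleftrightarrow> (\<exists>t. big_jump \<delta> w t \<and> ennreal t < c)"
  by (auto simp: first_big_jump_def Inf_less_iff)

text \<open>By compactness the points \<open>p\<^sub>n < q\<^sub>n\<close> accumulate at some
  \<open>\<tau>\<close>. If both lay on the same side of \<open>\<tau>\<close>, the increments would be small,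
  because the path has a one-sided limit on each side. Hence they straddle \<open>\<tau>\<close> and the
  increments approximate the jump at \<open>\<tau>\<close>.\<close>

lemma big_jump_of_oscillation:
  fixes w :: "real \<Rightarrow> 'a::real_normed_vector"
  assumes w: "cadlag w" and \<delta>: "0 < \<delta>"
    and osc: "\<And>n. \<exists>p q. 0 \<le> p \<and> p < q \<and> q \<le> b \<and> q - p < 1 / Suc n \<and> \<delta> - 1 / Suc n < norm (w q - w p)"
  shows "\<exists>t\<le>b. big_jump \<delta> w t"
proof -
  obtain p q where pq: "\<And>n. 0 \<le> p n \<and> p n < q n \<and> q n \<le> b \<and> q n - p n < 1 / Suc n \<and>
      \<delta> - 1 / Suc n < norm (w (q n) - w (p n))"
  proof -
    have "\<forall>n. \<exists>pq. 0 \<le> fst pq \<and> fst pq < snd pq \<and> snd pq \<le> b \<and> snd pq - fst pq < 1 / Suc n \<and>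
      \<delta> - 1 / Suc n < norm (w (snd pq) - w (fst pq))"
      using osc by (simp only: split_paired_Ex fst_conv snd_conv) blast
    from choice[OF this] obtain pq where "\<forall>n. 0 \<le> fst (pq n) \<and> fst (pq n) < snd (pq n) \<and> snd (pq n) \<le> b \<and> snd (pq n) - fst (pq n) < 1 / Suc n \<and>
      \<delta> - 1 / Suc n < norm (w (snd (pq n)) - w (fst (pq n)))" ..
    then show thesis by (intro that[of "\<lambda>n. fst (pq n)" "\<lambda>n. snd (pq n)"]) blast
  qed
  have "\<forall>n. p n \<in> {0..b}" using pq by (meson atLeastAtMost_iff less_imp_le order_trans)
  then obtain \<tau> r where \<tau>: "\<tau> \<in> {0..b}" and r: "strict_mono r" and lim: "(p \<circ> r) \<longlonglongrightarrow> \<tau>"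
    by (rule seq_compactE[OF compact_imp_seq_compact[OF compact_Icc]])
  \<comment> \<open>At \<open>\<tau> = 0\<close> there is no left side; this choice of \<open>L\<close> turns the claim into one about a jump of size \<open>0\<close>.\<close>
  define L where "L = (if \<tau> = 0 then w \<tau> else Lim (at_left \<tau>) w)"
  show ?thesis
  proof (rule ccontr)
    assume no: "\<not> ?thesis"
    have "norm (w \<tau> - L) < \<delta>"
      using no[unfolded not_ex big_jump_def, rule_format, of \<tau>] \<tau> \<delta> by (cases "\<tau> = 0") (auto simp: L_def)
    \<comment> \<open>The three errors involved, two one-sided limits and the deficit \<open>1 / Suc n\<close>, add up to less than the gap \<open>4 * \<epsilon>\<close>.\<close>
    define \<epsilon> where "\<epsilon> = (\<delta> - norm (w \<tau> - L)) / 4"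
    have \<epsilon>: "0 < \<epsilon>" using \<open>norm (w \<tau> - L) < \<delta>\<close> by (simp add: \<epsilon>_def)
    have "eventually (\<lambda>s. dist (w s) (w \<tau>) < \<epsilon>) (at_right \<tau>)"
      using cadlag_right[OF w, of \<tau>] \<tau> \<epsilon> by (auto simp: tendsto_iff)
    then obtain d1 where d1: "d1 > \<tau>" "\<And>s. \<tau> < s \<Longrightarrow> s < d1 \<Longrightarrow> norm (w s - w \<tau>) < \<epsilon>"
      by (auto simp: eventually_at_right_field dist_norm)
    have "\<exists>d2<\<tau>. \<forall>s. 0 \<le> s \<longrightarrow> d2 < s \<longrightarrow> s < \<tau> \<longrightarrow> norm (w s - L) < \<epsilon>"
    proof (cases "\<tau> = 0")
      case True then show ?thesis by (intro exI[of _ "-1"]) auto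
    next
      case False
      then have "eventually (\<lambda>s. dist (w s) L < \<epsilon>) (at_left \<tau>)"
        using cadlag_left_Lim[OF w, of \<tau>] \<tau> \<epsilon> by (auto simp: tendsto_iff L_def)
      then show ?thesis by (auto simp: eventually_at_left_field dist_norm)
    qed
    then obtain d2 where d2: "d2 < \<tau>" "\<And>s. 0 \<le> s \<Longrightarrow> d2 < s \<Longrightarrow> s < \<tau> \<Longrightarrow> norm (w s - L) < \<epsilon>"
      by blast
    have d1': "norm (w s - w \<tau>) < \<epsilon>" if "\<tau> \<le> s" "s < d1" for s
      using d1(2)[of s] that \<epsilon> by (cases "s = \<tau>") auto
    have inv: "(\<lambda>n. 1 / real (Suc n)) \<longlonglongrightarrow> 0" by (rule LIMSEQ_Suc[OF lim_1_over_n])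
    have inv': "(\<lambda>n. 1 / real (Suc (r n))) \<longlonglongrightarrow> 0"
      using LIMSEQ_subseq_LIMSEQ[OF inv r] by (simp add: o_def)
    have lim2: "(\<lambda>n. p (r n) + 1 / real (Suc (r n))) \<longlonglongrightarrow> \<tau> + 0"
      using lim by (intro tendsto_add inv') (simp add: o_def)
    have "eventually (\<lambda>n. d2 < p (r n) \<and> p (r n) + 1 / real (Suc (r n)) < d1 \<and> 1 / real (Suc (r n)) < \<epsilon>) sequentially"
      using lim d1(1) d2(1) \<epsilon>
      by (intro eventually_conj order_tendstoD(1)[OF lim[unfolded o_def]]
          order_tendstoD(2)[OF lim2] order_tendstoD(2)[OF inv']) auto
    then obtain n where n: "d2 < p (r n)" "p (r n) + 1 / real (Suc (r n)) < d1" "1 / real (Suc (r n)) < \<epsilon>"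
      by (auto simp: eventually_sequentially)
    let ?p = "p (r n)" and ?q = "q (r n)"
    have 1: "0 \<le> ?p" "?p < ?q" "?q < d1" "\<delta> - \<epsilon> < norm (w ?q - w ?p)"
      using pq[of "r n"] n by auto
    have "norm (w ?q - w ?p) < norm (w \<tau> - L) + 2 * \<epsilon>"
    proof -
      consider "\<tau> \<le> ?p" | "?q < \<tau>" | "?p < \<tau>" "\<tau> \<le> ?q" by linarith
      then show ?thesis
      proof cases
        case 1
        have "norm (w ?q - w ?p) \<le> norm (w ?q - w \<tau>) + norm (w ?p - w \<tau>)"
          using norm_triangle_ineq4[of "w ?q - w \<tau>" "w ?p - w \<tau>"] by simp
        also have "\<dots> < \<epsilon> + \<epsilon>" using \<open>?p < ?q\<close> \<open>?q < d1\<close> 1 by (intro add_strict_mono d1') auto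
        finally show ?thesis using norm_ge_zero[of "w \<tau> - L"] by linarith
      next
        case 2
        have "norm (w ?q - w ?p) \<le> norm (w ?q - L) + norm (w ?p - L)"
          using norm_triangle_ineq4[of "w ?q - L" "w ?p - L"] by simp
        also have "\<dots> < \<epsilon> + \<epsilon>" using 1 2 n by (intro add_strict_mono d2(2)) auto
        finally show ?thesis using norm_ge_zero[of "w \<tau> - L"] by linarith
      next
        case 3
        have "norm (w ?q - w ?p) = norm ((w ?q - w \<tau>) + (w \<tau> - L) - (w ?p - L))" by simp
        also have "\<dots> \<le> norm (w ?q - w \<tau>) + norm (w \<tau> - L) + norm (w ?p - L)"
          using norm_triangle_ineq4[of "(w ?q - w \<tau>) + (w \<tau> - L)" "w ?p - L"]
            norm_triangle_ineq[of "w ?q - w \<tau>" "w \<tau> - L"] by linarith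
        also have "\<dots> < \<epsilon> + norm (w \<tau> - L) + \<epsilon>"
          using 1 3 n by (intro add_strict_mono add_less_le_mono d1' d2(2)) auto
        finally show ?thesis by simp
      qed
    qed
    moreover have "norm (w \<tau> - L) = \<delta> - 4 * \<epsilon>" by (simp add: \<epsilon>_def field_simps)
    ultimately show False using 1(4) \<epsilon> by linarith
  qed
qed

text \<open>The converse: rational points close to a large jump, one on each side of it, see almost the whole
  jump.\<close>

lemma oscillation_of_big_jump:
  fixes w :: "real \<Rightarrow> 'a::real_normed_vector"
  assumes w: "cadlag w" and t: "big_jump \<delta> w t" "t < b" and \<epsilon>: "0 < \<epsilon>"
  shows "\<exists>p\<in>\<rat>. \<exists>q\<in>\<rat>. 0 \<le> p \<and> p < q \<and> q \<le> b \<and> q - p < \<epsilon> \<and> \<delta> - \<epsilon> < norm (w q - w p)"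
proof -
  let ?L = "Lim (at_left t) w"
  have t0: "0 < t" and jump: "\<delta> \<le> norm (w t - ?L)" using t by (auto simp: big_jump_def)
  have "eventually (\<lambda>s. dist (w s) (w t) < \<epsilon>/2) (at_right t)"
    by (rule tendstoD[OF cadlag_right[OF w]]) (use t0 \<epsilon> in auto)
  then obtain d1 where d1: "d1 > t" "\<And>s. t < s \<Longrightarrow> s < d1 \<Longrightarrow> norm (w s - w t) < \<epsilon>/2"
    by (auto simp: eventually_at_right_field dist_norm)
  have "eventually (\<lambda>s. dist (w s) ?L < \<epsilon>/2) (at_left t)"
    by (rule tendstoD[OF cadlag_left_Lim[OF w t0]]) (use \<epsilon> in auto)
  then obtain d2 where d2: "d2 < t" "\<And>s. d2 < s \<Longrightarrow> s < t \<Longrightarrow> norm (w s - ?L) < \<epsilon>/2"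
    by (auto simp: eventually_at_left_field dist_norm)
  obtain p where p: "p \<in> \<rat>" "max (max 0 d2) (t - \<epsilon>/2) < p" "p < t"
    using Rats_dense_in_real[of "max (max 0 d2) (t - \<epsilon>/2)" t] t0 d2 \<epsilon> by auto
  obtain q where q: "q \<in> \<rat>" "t < q" "q < min (min b d1) (t + \<epsilon>/2)"
    using Rats_dense_in_real[of t "min (min b d1) (t + \<epsilon>/2)"] t d1 \<epsilon> by auto
  have "norm (w t - ?L) = norm ((w q - w p) - (w q - w t) + (w p - ?L))" by simp
  also have "\<dots> \<le> norm (w q - w p) + norm (w q - w t) + norm (w p - ?L)"
    using norm_triangle_ineq[of "(w q - w p) - (w q - w t)" "w p - ?L"]
      norm_triangle_ineq4[of "w q - w p" "w q - w t"] by linarith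
  also have "\<dots> < norm (w q - w p) + \<epsilon>/2 + \<epsilon>/2"
    using p q by (intro add_strict_mono add_le_less_mono d1(2) d2(2)) auto
  finally have "\<delta> - \<epsilon> < norm (w q - w p)" using jump by simp
  then show ?thesis using p q by (intro bexI[of _ p] bexI[of _ q]) auto
qed

text \<open>The two preceding lemmas make the existence of a large jump a statement about countably many
  rational times before \<open>b\<close>.\<close>

lemma sets_big_jump_before:
  fixes b :: real
  assumes \<delta>: "0 < \<delta>" and I: "{0..<b} \<subseteq> I"
  shows "{w. cadlag w \<and> (\<exists>t<b. big_jump \<delta> w t)} \<in> sets (path_algebra I :: (real \<Rightarrow> 'a::euclidean_space) measure)"
proof -
  let ?osc = "\<lambda>w :: real \<Rightarrow> 'a. \<lambda>c n p q. norm (w q - w p) > \<delta> - 1 / Suc n"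
  let ?P = "\<lambda>w. \<exists>c\<in>\<rat> \<inter> {..<b}. \<forall>n::nat. \<exists>p\<in>\<rat> \<inter> {0..c}. \<exists>q\<in>\<rat> \<inter> {p<..c} \<inter> {..<p + 1 / Suc n}. ?osc w c n p q"
  have iff: "(\<exists>t<b. big_jump \<delta> w t) \<longleftrightarrow> ?P w" if w: "cadlag w" for w
  proof
    assume "\<exists>t<b. big_jump \<delta> w t"
    then obtain t where t: "t < b" "big_jump \<delta> w t" by auto
    obtain c where c: "c \<in> \<rat>" "t < c" "c < b" using Rats_dense_in_real t by blast
    have "\<exists>p\<in>\<rat> \<inter> {0..c}. \<exists>q\<in>\<rat> \<inter> {p<..c} \<inter> {..<p + 1 / Suc n}. ?osc w c n p q" for n
    proof -
      obtain p q where "p\<in>\<rat>" "q\<in>\<rat>" "0 \<le> p" "p < q" "q \<le> c" "q - p < 1 / Suc n" "\<delta> - 1 / Suc n < norm (w q - w p)"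
        using oscillation_of_big_jump[OF w t(2) c(2), of "1 / Suc n"] by auto
      then show ?thesis by (intro bexI[of _ p] bexI[of _ q]) auto
    qed
    with c show "?P w" by blast
  next
    assume "?P w"
    then obtain c where c: "c \<in> \<rat>" "c < b"
      and *: "\<And>n. \<exists>p\<in>\<rat> \<inter> {0..c}. \<exists>q\<in>\<rat> \<inter> {p<..c} \<inter> {..<p + 1 / Suc n}. ?osc w c n p q" by auto
    have "\<exists>t\<le>c. big_jump \<delta> w t"
    proof (rule big_jump_of_oscillation[OF w \<delta>])
      fix n
      obtain p q where "0 \<le> p" "p < q" "q \<le> c" "q < p + 1 / Suc n" "?osc w c n p q"
        using *[of n] by auto
      then show "\<exists>p q. 0 \<le> p \<and> p < q \<and> q \<le> c \<and> q - p < 1 / Suc n \<and> \<delta> - 1 / Suc n < norm (w q - w p)"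
        by (intro exI[of _ p] exI[of _ q]) auto
    qed
    then show "\<exists>t<b. big_jump \<delta> w t" using c by (meson le_less_trans)
  qed
  have "{w. cadlag w \<and> (\<exists>t<b. big_jump \<delta> w t)} = {w\<in>space (path_algebra I). ?P w}"
    unfolding space_path_algebra mem_Collect_eq
    by (intro Collect_cong conj_cong refl iff)
  also have "\<dots> \<in> sets (path_algebra I)"
  proof -
    have c: "countable (\<rat> \<inter> A)" for A :: "real set" using countable_rat by (rule countable_subset[rotated]) auto
    have m: "Measurable.pred (path_algebra I) (\<lambda>w. ?osc w c n p q)" if "p \<in> I" "q \<in> I" for c n p q
    proof -
      have [measurable]: "(\<lambda>w. w p) \<in> borel_measurable (path_algebra I :: (real \<Rightarrow> 'a) measure)" 
        "(\<lambda>w. w q) \<in> borel_measurable (path_algebra I :: (real \<Rightarrow> 'a) measure)"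
        using that by (auto intro: measurable_coordinate)
      show ?thesis by measurable
    qed
    have "Measurable.pred (path_algebra I) ?P"
      unfolding Int_assoc
      by (rule measurable_pred_countable(2)[OF c], rule pred_intros_countable(1),
          rule measurable_pred_countable(2)[OF c], rule measurable_pred_countable(2)[OF c], rule m) (use I in auto)
    then show ?thesis by (simp add: pred_def)
  qed
  finally show ?thesis .
qed

lemma sets_natural_filtrationI:
  assumes "A \<subseteq> {w. cadlag w}"
    and "\<And>s. t < s \<or> s = \<infinity> \<Longrightarrow> A \<in> sets (path_algebra {r. 0 \<le> r \<and> ennreal r \<le> s})"
  shows "A \<in> sets (natural_filtration Q t)"
proof -
  have "A \<in> {A. A \<subseteq> {w. cadlag w} \<and>
         (\<forall>s. t < s \<or> s = \<infinity> \<longrightarrow>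
           (\<exists>B\<in>sets (path_algebra {r. 0 \<le> r \<and> ennreal r \<le> s}). \<exists>N\<in>sets path_space.
              (\<forall>q\<in>Q. emeasure q N = 0) \<and> (A - B) \<union> (B - A) \<subseteq> N))}"
  proof (intro CollectI conjI allI impI)
    fix s assume "t < s \<or> s = \<infinity>"
    then show "\<exists>B\<in>sets (path_algebra {r. 0 \<le> r \<and> ennreal r \<le> s}). \<exists>N\<in>sets path_space.
              (\<forall>q\<in>Q. emeasure q N = 0) \<and> (A - B) \<union> (B - A) \<subseteq> N"
      by (intro bexI[OF _ assms(2)] bexI[of _ "{}"]) auto
  qed (rule assms(1))
  then show ?thesis
    unfolding natural_filtration_def by (subst sets_measure_of) (blast, blast)
qed

text \<open>That the infimum is at most \<open>t\<close> means that for every \<open>k\<close> a large jump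
  occurs before \<open>t + 1/k\<close>. Such an event depends on the path slightly beyond \<open>t\<close>,
  and it is the right-continuity of the filtration that admits it at time \<open>t\<close>.\<close>

lemma stopping_time_first_big_jump:
  assumes \<delta>: "0 < \<delta>"
  shows "stopping_time (natural_filtration Q) (first_big_jump \<delta> :: (real \<Rightarrow> 'a::euclidean_space) \<Rightarrow> ennreal)"
proof (rule stopping_timeI)
  fix t :: ennreal
  let ?A = "{w :: real \<Rightarrow> 'a. cadlag w \<and> first_big_jump \<delta> w \<le> t}"
  have "?A \<in> sets (path_algebra {r. 0 \<le> r \<and> ennreal r \<le> s})" if s: "t < s \<or> s = \<infinity>" for s
  proof (cases t)
    case top
    have "?A = space (path_algebra {r. 0 \<le> r \<and> ennreal r \<le> s})"
      by (auto simp: space_path_algebra top)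
    then show ?thesis by simp
  next
    case (real r)
    have "\<exists>K. ennreal (r + 1 / Suc K) \<le> s"
    proof (cases s)
      case (real s')
      with s \<open>t = ennreal r\<close> \<open>0 \<le> r\<close> have "r < s'" by (auto simp: ennreal_less_iff)
      then obtain K where "1 / Suc K < s' - r" using nat_approx_posE[of "s' - r"] by auto
      then show ?thesis using real by (intro exI[of _ K]) (auto intro!: ennreal_leI)
    qed auto
    then obtain K where K: "ennreal (r + 1 / Suc K) \<le> s" by auto
    have "first_big_jump \<delta> w \<le> t \<longleftrightarrow> (\<forall>k. \<exists>u < r + 1 / Suc (K + k). big_jump \<delta> w u)" (is "_ \<longleftrightarrow> ?R") for w :: "real \<Rightarrow> 'a"
    proof
      assume le: "first_big_jump \<delta> w \<le> t"
      show ?R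
      proof
        fix k
        have "t < ennreal (r + 1 / Suc (K + k))"
          using real by (auto simp: ennreal_less_iff)
        with le have "first_big_jump \<delta> w < ennreal (r + 1 / Suc (K + k))" by (rule le_less_trans)
        then show "\<exists>u < r + 1 / Suc (K + k). big_jump \<delta> w u"
          by (auto simp: first_big_jump_less_iff big_jump_def ennreal_less_iff)
      qed
    next
      assume R: ?R
      show "first_big_jump \<delta> w \<le> t"
      proof (rule ennreal_le_epsilon)
        fix e :: real assume e: "0 < e"
        obtain k where k: "1 / Suc k < e" using nat_approx_posE[OF e] by auto
        obtain u where u: "u < r + 1 / Suc (K + k)" "big_jump \<delta> w u" using R by auto
        have "1 / real (Suc (K + k)) \<le> 1 / Suc k" by (simp add: frac_le)
        then have "u < r + e" using u k by linarith
        moreover have "0 < u" using u by (simp add: big_jump_def)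
        ultimately have "ennreal u < ennreal (r + e)" by (simp add: ennreal_less_iff)
        then have "first_big_jump \<delta> w < ennreal (r + e)"
          using u(2) by (auto simp: first_big_jump_less_iff)
        then show "first_big_jump \<delta> w \<le> t + ennreal e"
          using real e by (simp add: ennreal_plus)
      qed
    qed
    then have "?A = (\<Inter>k. {w. cadlag w \<and> (\<exists>u < r + 1 / Suc (K + k). big_jump \<delta> w u)})" by auto
    also have "\<dots> \<in> sets (path_algebra {r. 0 \<le> r \<and> ennreal r \<le> s})"
    proof (intro sets.countable_INT' sets_big_jump_before[OF \<delta>] image_subsetI)
      fix k
      have "1 / real (Suc (K + k)) \<le> 1 / real (Suc K)" by (simp add: frac_le)
      then have "u < r + 1 / real (Suc (K + k)) \<Longrightarrow> ennreal u \<le> s" for u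
        using K by (auto intro!: order_trans[OF ennreal_leI K])
      then show "{0..<r + 1 / real (Suc (K + k))} \<subseteq> {r. 0 \<le> r \<and> ennreal r \<le> s}" by auto
    qed auto
    finally show ?thesis .
  qed
  then have "?A \<in> sets (natural_filtration Q t)"
    by (intro sets_natural_filtrationI) auto
  then show "Measurable.pred (natural_filtration Q t) (\<lambda>w. first_big_jump \<delta> w \<le> t)"
    by (simp add: pred_def filtration.space_F[OF filtration_natural_filtration])
qed

lemma measurable_first_big_jump:
  assumes \<delta>: "0 < \<delta>"
  shows "first_big_jump \<delta> \<in> borel_measurable (path_space :: (real \<Rightarrow> 'a::euclidean_space) measure)"
proof (rule borel_measurableI_less)
  fix c :: ennreal
  have "{w \<in> space path_space. first_big_jump \<delta> w < c} =
     (\<Union>q\<in>{q\<in>\<rat>. ennreal q \<le> c}. {w :: real \<Rightarrow> 'a. cadlag w \<and> (\<exists>u<q. big_jump \<delta> w u)})" (is "?L = ?R")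
  proof (intro equalityI subsetI)
    fix w assume "w \<in> ?L"
    then obtain u where u: "cadlag w" "big_jump \<delta> w u" "ennreal u < c"
      by (auto simp: first_big_jump_less_iff space_path_algebra)
    then obtain v where v: "u < v" "ennreal v \<le> c"
    proof (cases c)
      case (real r)
      then show ?thesis using u that[of r] by (auto simp: ennreal_less_iff big_jump_def)
    next
      case top
      then show ?thesis using that[of "u + 1"] by auto
    qed
    obtain q where q: "q \<in> \<rat>" "u < q" "q < v" using Rats_dense_in_real[OF v(1)] by auto
    then have "ennreal q \<le> c" using v by (meson ennreal_leI less_imp_le order_trans)
    then show "w \<in> ?R" using q u by auto
  next
    fix w assume "w \<in> ?R"
    then obtain q u where "ennreal q \<le> c" "cadlag w" "u < q" "big_jump \<delta> w u" by auto
    then have "0 < u" "u < q" by (simp_all add: big_jump_def)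
    then have "ennreal u < ennreal q" by (simp add: ennreal_less_iff)
    then have "ennreal u < c" using \<open>ennreal q \<le> c\<close> by (rule less_le_trans)
    then have "first_big_jump \<delta> w < c" using \<open>big_jump \<delta> w u\<close> unfolding first_big_jump_less_iff by blast
    then show "w \<in> ?L" using \<open>cadlag w\<close> by (simp add: space_path_algebra)
  qed
  also have "\<dots> \<in> sets path_space"
  proof (rule sets.countable_UN')
    show "countable {q \<in> \<rat>. ennreal q \<le> c}" using countable_rat by (rule countable_subset[rotated]) auto
    show "(\<lambda>q. {w :: real \<Rightarrow> 'a. cadlag w \<and> (\<exists>u<q. big_jump \<delta> w u)}) ` {q \<in> \<rat>. ennreal q \<le> c} \<subseteq> sets path_space"
      by (intro image_subsetI sets_big_jump_before[OF \<delta>]) auto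
  qed
  finally show "{w \<in> space path_space. first_big_jump \<delta> w < c} \<in> sets (path_space :: (real \<Rightarrow> 'a) measure)" .
qed

text \<open>For fixed \<open>k\<close> and \<open>q\<close> let \<open>J k q\<close> consist of the times
  \<open>t > q\<close> with a jump larger than \<open>4 / (k + 1)\<close> such that the path stays within
  \<open>1 / (k + 1)\<close> of its left limit during all of \<open>]q, t[\<close>. Two such times cannot
  coexist, since the jump at the earlier one would violate the requirement of the later one. Every jump time
  belongs to some \<open>J k q\<close> with rational \<open>q\<close>.\<close>

lemma countable_jumps:
  fixes w :: "real \<Rightarrow> 'a::metric_space"
  assumes w: "cadlag w"
  shows "countable {t. 0 < t \<and> Lim (at_left t) w \<noteq> w t}"
proof -
  let ?L = "\<lambda>t. Lim (at_left t) w"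
  define J where "J k q = {t. q < t \<and> 4 / Suc k < dist (w t) (?L t) \<and> (\<forall>s. q < s \<and> s < t \<longrightarrow> dist (w s) (?L t) < 1 / Suc k)}"
    for k :: nat and q :: real
  have no_two: False if "t \<in> J k q" "t' \<in> J k q" "t < t'" for t t' k q
  proof -
    have "q < t" using that by (auto simp: J_def)
    then obtain s where s: "q < s" "s < t" using dense by blast
    have "dist (w t) (?L t') < 1 / Suc k" "dist (w s) (?L t') < 1 / Suc k" "dist (w s) (?L t) < 1 / Suc k"
      "4 / Suc k < dist (w t) (?L t)"
      using that s by (auto simp: J_def)
    moreover have "dist (w t) (?L t) \<le> dist (w t) (?L t') + dist (w s) (?L t') + dist (w s) (?L t)"
      using dist_triangle[of "w t" "?L t" "?L t'"] dist_triangle[of "?L t'" "?L t" "w s"]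
      by (simp add: dist_commute)
    moreover have "4 / real (Suc k) = 1 / Suc k + 1 / Suc k + 1 / Suc k + 1 / Suc k" by simp
    moreover have "0 < 1 / real (Suc k)" by simp
    ultimately show False by linarith
  qed
  have "countable (J k q)" for k q
  proof -
    have "J k q = {} \<or> (\<exists>t. J k q = {t})"
      using no_two by (metis equals0I insertI1 is_singletonI' is_singletonE linorder_cases)
    then show ?thesis by auto
  qed
  then have "countable (\<Union>k. \<Union>q\<in>\<rat>. J k q)" by (intro countable_UN countable_rat) auto
  moreover have "{t. 0 < t \<and> ?L t \<noteq> w t} \<subseteq> (\<Union>k. \<Union>q\<in>\<rat>. J k q)"
  proof
    fix t assume "t \<in> {t. 0 < t \<and> ?L t \<noteq> w t}"
    then have t: "0 < t" "0 < dist (w t) (?L t) / 4" by auto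
    then obtain k where k: "1 / Suc k < dist (w t) (?L t) / 4" using nat_approx_posE by blast
    have "eventually (\<lambda>s. dist (w s) (?L t) < 1 / Suc k) (at_left t)"
      using cadlag_left_Lim[OF w t(1)] by (auto simp: tendsto_iff)
    then obtain d where d: "d < t" "\<And>s. d < s \<Longrightarrow> s < t \<Longrightarrow> dist (w s) (?L t) < 1 / Suc k"
      by (auto simp: eventually_at_left_field)
    obtain q where q: "q \<in> \<rat>" "d < q" "q < t" using Rats_dense_in_real[OF d(1)] by auto
    then have "t \<in> J k q" using d k by (auto simp: J_def)
    then show "t \<in> (\<Union>k. \<Union>q\<in>\<rat>. J k q)" using q by auto
  qed
  ultimately show ?thesis by (rule countable_subset[rotated])
qed

text \<open>By Fubini it suffices to fix the path, whose countably many jump times are negligible for a law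
  with a density. To see that the event is measurable, continuity from the left at \<open>r\<close> is
  expressed along the sequence \<open>r - 1/n\<close>.\<close>

lemma AE_no_jump_at_independent_time:
  fixes R :: "(real \<Rightarrow> 'a::euclidean_space) measure"
  assumes R: "prob_space R" "sets R = sets path_space"
    and D: "prob_space D" "D = density lborel g" "g \<in> borel_measurable lborel"
  shows "AE x in R \<Otimes>\<^sub>M D. 0 < snd x \<longrightarrow> Lim (at_left (snd x)) (fst x) = fst x (snd x)"
proof -
  interpret R: prob_space R by fact
  interpret D: prob_space D by fact
  interpret RD: pair_prob_space R D ..
  have sD: "sets D = sets borel" by (simp add: D(2))
  let ?c = "\<lambda>x::(real \<Rightarrow> 'a) \<times> real. \<forall>j::nat. \<exists>m::nat. \<forall>n\<ge>m.
     norm (fst x (max 0 (snd x - 1 / Suc n)) - fst x (max 0 (snd x))) < 1 / Suc j"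
  have c_iff: "?c x \<longleftrightarrow> Lim (at_left (snd x)) (fst x) = fst x (snd x)" if w: "cadlag (fst x)" and t: "0 < snd x" for x
  proof -
    obtain w t where x: "x = (w, t)" by force
    have w: "cadlag w" and t: "0 < t" using w t x by auto
    have "(\<lambda>n. t - 1 / real (Suc n)) \<longlonglongrightarrow> t - 0"
      by (intro tendsto_diff tendsto_const LIMSEQ_Suc[OF lim_1_over_n])
    then have 1: "(\<lambda>n. max 0 (t - 1 / real (Suc n))) \<longlonglongrightarrow> max 0 t"
      by (intro tendsto_max tendsto_const) simp
    have "filterlim (\<lambda>n. max 0 (t - 1 / real (Suc n))) (at_left t) sequentially"
      using 1 t by (auto simp: filterlim_at max_def)
    then have lim: "(\<lambda>n. w (max 0 (t - 1 / real (Suc n)))) \<longlonglongrightarrow> Lim (at_left t) w"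
      by (rule filterlim_compose[OF cadlag_left_Lim[OF w t]])
    have "?c x \<longleftrightarrow> (\<lambda>n. w (max 0 (t - 1 / real (Suc n)))) \<longlonglongrightarrow> w t"
    proof
      assume c: "?c x"
      show "(\<lambda>n. w (max 0 (t - 1 / real (Suc n)))) \<longlonglongrightarrow> w t"
        unfolding LIMSEQ_def dist_norm
      proof (intro allI impI)
        fix e :: real assume "0 < e"
        then obtain j where j: "1 / Suc j < e" using nat_approx_posE by blast
        obtain m where "\<forall>n\<ge>m. norm (w (max 0 (t - 1 / Suc n)) - w t) < 1 / Suc j"
          using c[rule_format, of j] t by (auto simp: x max_def)
        then show "\<exists>m. \<forall>n\<ge>m. norm (w (max 0 (t - 1 / Suc n)) - w t) < e"
          using j by (intro exI[of _ m]) (auto intro: less_trans)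
      qed
    next
      assume "(\<lambda>n. w (max 0 (t - 1 / real (Suc n)))) \<longlonglongrightarrow> w t"
      then show "?c x" using t unfolding LIMSEQ_def dist_norm x by (simp add: max_def del: of_nat_Suc)
    qed
    also have "\<dots> \<longleftrightarrow> Lim (at_left t) w = w t"
      using lim LIMSEQ_unique by metis
    finally show ?thesis by (simp add: x)
  qed
  have "AE x in R \<Otimes>\<^sub>M D. 0 < snd x \<longrightarrow> ?c x"
  proof (rule RD.AE_pair_measure)
    have "sets (R \<Otimes>\<^sub>M D) = sets (path_space \<Otimes>\<^sub>M borel)"
      using R(2) sD by (rule sets_pair_measure_cong)
    then have RD: "measurable (R \<Otimes>\<^sub>M D) L = measurable (path_space \<Otimes>\<^sub>M borel) L" for L :: "'b measure"
      by (rule measurable_cong_sets) simp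
    have [measurable]: "snd \<in> borel_measurable (R \<Otimes>\<^sub>M D)" unfolding RD by (rule measurable_snd)
    have [measurable]: "(\<lambda>x. fst x (max 0 (snd x - 1 / Suc n))) \<in> borel_measurable (R \<Otimes>\<^sub>M D)"
       "(\<lambda>x. fst x (max 0 (snd x))) \<in> borel_measurable (R \<Otimes>\<^sub>M D)" for n
      unfolding RD by (intro measurable_eval_max measurable_fst borel_measurable_diff measurable_snd borel_measurable_const)+
    show "{x \<in> space (R \<Otimes>\<^sub>M D). 0 < snd x \<longrightarrow> ?c x} \<in> sets (R \<Otimes>\<^sub>M D)"
      by measurable
    show "AE w in R. AE t in D. 0 < snd (w, t) \<longrightarrow> ?c (w, t)"
    proof (rule AE_I2)
      fix w assume "w \<in> space R"
      then have w: "cadlag w" using sets_eq_imp_space_eq[OF R(2)] by (simp add: space_path_algebra)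
      have "AE t in lborel. t \<notin> {t. 0 < t \<and> Lim (at_left t) w \<noteq> w t}"
        using countable_imp_null_set_lborel[OF countable_jumps[OF w]] by (rule AE_not_in)
      then have "AE t in D. t \<notin> {t. 0 < t \<and> Lim (at_left t) w \<noteq> w t}"
        unfolding D(2) using D(3) by (subst AE_density) auto
      then show "AE t in D. 0 < snd (w, t) \<longrightarrow> ?c (w, t)"
      proof eventually_elim
        case (elim t)
        then show ?case using c_iff[of "(w, t)"] w by auto
      qed
    qed
  qed
  moreover have "AE x in R \<Otimes>\<^sub>M D. cadlag (fst x)"
    using sets_eq_imp_space_eq[OF R(2)] by (auto intro!: AE_I2 simp: space_pair_measure space_path_algebra)
  ultimately show ?thesis
    by eventually_elim (use c_iff in blast)
qed

section \<open>Augmented filtration and strong Markov property\<close>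

text \<open>The sets that generate \<open>natural_filtration Q t\<close> already form a sigma-algebra, so that
  every event inherits their defining property. The laws in \<open>Q\<close> have to live on the path space in
  order that countable unions of null sets are null.\<close>

lemma natural_filtration_setsD:
  fixes A :: "(real \<Rightarrow> 'a::topological_space) set"
  assumes Q: "\<And>q. q \<in> Q \<Longrightarrow> sets q = sets path_space"
    and A: "A \<in> sets (natural_filtration Q t)" and s: "t < s \<or> s = \<infinity>"
  shows "\<exists>B\<in>sets (path_algebra {r. 0 \<le> r \<and> ennreal r \<le> s}). \<exists>N\<in>sets path_space.
              (\<forall>q\<in>Q. emeasure q N = 0) \<and> (A - B) \<union> (B - A) \<subseteq> N"
proof -
  let ?I = "{r. 0 \<le> r \<and> ennreal r \<le> s}"
  let ?G = "{A :: (real \<Rightarrow> 'a) set. A \<subseteq> {w. cadlag w} \<and>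
         (\<forall>s. t < s \<or> s = \<infinity> \<longrightarrow>
           (\<exists>B\<in>sets (path_algebra {r. 0 \<le> r \<and> ennreal r \<le> s}). \<exists>N\<in>sets path_space.
              (\<forall>q\<in>Q. emeasure q N = 0) \<and> (A - B) \<union> (B - A) \<subseteq> N))}"
  have "A \<in> sigma_sets {w. cadlag w} ?G"
    using A unfolding natural_filtration_def by (subst (asm) sets_measure_of) blast
  then show ?thesis
  proof induction
    case (Basic a)
    then show ?case using s by blast
  next
    case Empty
    show ?case by (intro bexI[of _ "{}"]) auto
  next
    case (Compl a)
    then obtain B N where B: "B \<in> sets (path_algebra ?I)" and N: "N \<in> sets path_space"
      "\<forall>q\<in>Q. emeasure q N = 0" "(a - B) \<union> (B - a) \<subseteq> N" by blast
    have "{w. cadlag w} - B \<in> sets (path_algebra ?I)"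
      using sets.compl_sets[OF B] by (simp add: space_path_algebra)
    moreover have "({w. cadlag w} - a - ({w. cadlag w} - B)) \<union> ({w. cadlag w} - B - ({w. cadlag w} - a)) \<subseteq> N"
      using N(3) by blast
    ultimately show ?case using N by blast
  next
    case (Union a)
    have "\<forall>i. \<exists>BN. fst BN \<in> sets (path_algebra ?I) \<and> snd BN \<in> sets path_space \<and>
        (\<forall>q\<in>Q. emeasure q (snd BN) = 0) \<and> (a i - fst BN) \<union> (fst BN - a i) \<subseteq> snd BN" (is "\<forall>i. ?E i")
    proof
      fix i
      obtain B N where "B \<in> sets (path_algebra ?I)" "N \<in> sets path_space"
        "\<forall>q\<in>Q. emeasure q N = 0" "(a i - B) \<union> (B - a i) \<subseteq> N" using Union.IH[of i] by blast
      then show "?E i" by (intro exI[of _ "(B, N)"]) simp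
    qed
    from choice[OF this] obtain BN where BN: "\<And>i. fst (BN i) \<in> sets (path_algebra ?I)"
        "\<And>i. snd (BN i) \<in> sets path_space" "\<And>i q. q \<in> Q \<Longrightarrow> emeasure q (snd (BN i)) = 0"
        "\<And>i. (a i - fst (BN i)) \<union> (fst (BN i) - a i) \<subseteq> snd (BN i)" by blast
    have "emeasure q (\<Union>i. snd (BN i)) = 0" if q: "q \<in> Q" for q
    proof -
      have "(\<Union>i. snd (BN i)) \<in> null_sets q"
        using BN(2,3) q Q[OF q] by (intro null_sets_UN) (auto simp: null_sets_def)
      then show ?thesis by auto
    qed
    moreover have "((\<Union>i. a i) - (\<Union>i. fst (BN i))) \<union> ((\<Union>i. fst (BN i)) - (\<Union>i. a i)) \<subseteq> (\<Union>i. snd (BN i))"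
      using BN(4) by blast
    moreover have "(\<Union>i. snd (BN i)) \<in> sets path_space" "(\<Union>i. fst (BN i)) \<in> sets (path_algebra ?I)"
      using BN by auto
    ultimately show ?case by blast
  qed
qed


text \<open>The events \<open>T \<le> r\<close> for rational \<open>r\<close> differ from measurable ones by
  null sets, which are collected into one null set \<open>N\<close>. Redefining \<open>T\<close> as
  \<open>0\<close> on \<open>N\<close> makes it measurable, simultaneously for all laws in
  \<open>Q\<close>.\<close>

lemma stopping_time_measurable_version:
  fixes T :: "(real \<Rightarrow> 'a::topological_space) \<Rightarrow> ennreal"
  assumes Q: "\<And>q. q \<in> Q \<Longrightarrow> sets q = sets path_space"
    and T: "stopping_time (natural_filtration Q) T"
  obtains T' N where "T' \<in> borel_measurable path_space" "N \<in> sets path_space"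
    "\<And>q. q \<in> Q \<Longrightarrow> emeasure q N = 0" "\<And>w. w \<notin> N \<Longrightarrow> T w = T' w"
proof -
  have "{w. cadlag w \<and> T w \<le> c} \<in> sets (natural_filtration Q c)" for c
    using stopping_timeD[OF T, of c]
    by (simp add: pred_def filtration.space_F[OF filtration_natural_filtration])
  note T_sets = this
  have "\<forall>r::rat. \<exists>BN. fst BN \<in> sets path_space \<and> snd BN \<in> sets path_space \<and>
      (\<forall>q\<in>Q. emeasure q (snd BN) = 0) \<and>
      ({w. cadlag w \<and> T w \<le> ennreal (of_rat r)} - fst BN) \<union> (fst BN - {w. cadlag w \<and> T w \<le> ennreal (of_rat r)}) \<subseteq> snd BN"
    (is "\<forall>r. ?E r")
  proof (intro allI)
    fix r :: rat
    obtain B N where "B \<in> sets path_space" "N \<in> sets path_space" "\<forall>q\<in>Q. emeasure q N = 0"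
      "({w. cadlag w \<and> T w \<le> ennreal (of_rat r)} - B) \<union> (B - {w. cadlag w \<and> T w \<le> ennreal (of_rat r)}) \<subseteq> N"
      using natural_filtration_setsD[OF Q T_sets, of "ennreal (of_rat r)" \<infinity>]
      unfolding atLeast_def by auto
    then show "?E r" by (intro exI[of _ "(B, N)"]) simp
  qed
  from choice[OF this] obtain BN where BN: "\<And>r. fst (BN r) \<in> sets path_space" "\<And>r. snd (BN r) \<in> sets path_space"
     "\<And>r q. q \<in> Q \<Longrightarrow> emeasure q (snd (BN r)) = 0"
     and diff: "\<And>r. ({w. cadlag w \<and> T w \<le> ennreal (of_rat r)} - fst (BN r)) \<union>
        (fst (BN r) - {w. cadlag w \<and> T w \<le> ennreal (of_rat r)}) \<subseteq> snd (BN r)" by blast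
  define N where "N = (\<Union>r. snd (BN r))"
  have N: "N \<in> sets path_space" unfolding N_def using BN(2) by auto
  define T' where "T' w = (if w \<in> N then 0 else T w)" for w
  have "T' \<in> borel_measurable path_space"
  proof (rule borel_measurableI_less)
    fix y :: ennreal
    have "{w \<in> space path_space. T' w < y} =
        (\<Union>r\<in>{r::rat. ennreal (of_rat r) < y}. fst (BN r) - N) \<union> (if 0 < y then N else {})" (is "?L = ?R")
    proof (intro equalityI subsetI)
      fix w assume w: "w \<in> ?L"
      show "w \<in> ?R"
      proof (cases "w \<in> N")
        case True then show ?thesis using w by (auto simp: T'_def)
      next
        case False
        with w have "cadlag w" "T w < y" by (auto simp: T'_def space_path_algebra)
        then obtain r :: rat where r: "T w < real_of_rat r" "real_of_rat r < y"
          using ennreal_rat_dense by blast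
        then have "w \<in> fst (BN r)" using diff[of r] False \<open>cadlag w\<close> by (auto simp: N_def)
        then show ?thesis using r False by auto
      qed
    next
      fix w assume w: "w \<in> ?R"
      have cN: "w \<in> N \<Longrightarrow> cadlag w" using sets.sets_into_space[OF N] by (auto simp: space_path_algebra)
      show "w \<in> ?L"
      proof (cases "w \<in> N")
        case True then show ?thesis using w cN by (auto simp: T'_def space_path_algebra split: if_splits)
      next
        case False
        then obtain r :: rat where r: "ennreal (of_rat r) < y" "w \<in> fst (BN r)" using w by (auto split: if_splits)
        then have "cadlag w \<and> T w \<le> ennreal (of_rat r)" using diff[of r] False by (auto simp: N_def)
        then show ?thesis using r False by (auto simp: T'_def space_path_algebra)
      qed
    qed
    also have "\<dots> \<in> sets path_space"
    proof (rule sets.Un)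
      show "(\<Union>r\<in>{r::rat. ennreal (of_rat r) < y}. fst (BN r) - N) \<in> sets path_space"
        using BN(1) N by (intro sets.countable_UN') auto
    qed (use N in auto)
    finally show "{w \<in> space path_space. T' w < y} \<in> sets path_space" .
  qed
  moreover have "emeasure q N = 0" if q: "q \<in> Q" for q
  proof -
    have "N \<in> null_sets q"
      unfolding N_def using BN(2,3) q Q[OF q] by (intro null_sets_UN) (auto simp: null_sets_def)
    then show ?thesis by auto
  qed
  ultimately show thesis using N by (intro that[of T' N]) (auto simp: T'_def)
qed

text \<open>Outside a null set, the event \<open>T \<le> r\<close> is decided by the path up to any time
  \<open>s > r\<close>. Two paths that agree before \<open>c\<close> therefore agree about \<open>T \<le>
  r\<close> for all rational \<open>r < c\<close>. From \<open>c\<close> on they are unrelated, hence the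
  truncation at \<open>c\<close>.\<close>

lemma stopping_time_decided:
  fixes T :: "(real \<Rightarrow> 'a::topological_space) \<Rightarrow> ennreal"
  assumes Q: "\<And>q. q \<in> Q \<Longrightarrow> sets q = sets path_space"
    and T: "stopping_time (natural_filtration Q) T"
  shows "\<exists>N\<in>sets path_space. (\<forall>q\<in>Q. emeasure q N = 0) \<and>
    (\<forall>w w' c. cadlag w \<longrightarrow> cadlag w' \<longrightarrow> w \<notin> N \<longrightarrow> w' \<notin> N \<longrightarrow> (\<forall>r. 0 \<le> r \<longrightarrow> r < c \<longrightarrow> w r = w' r) \<longrightarrow>
       min (ennreal c) (T w) = min (ennreal c) (T w'))"
proof -
  have T_sets: "{w. cadlag w \<and> T w \<le> c} \<in> sets (natural_filtration Q c)" for c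
    using stopping_timeD[OF T, of c]
    by (simp add: pred_def filtration.space_F[OF filtration_natural_filtration])
  \<comment> \<open>The null set depends on both \<open>r\<close> and the horizon \<open>s\<close>; both run over the rationals in the end.\<close>
  define ok where "ok r s N \<longleftrightarrow> N \<in> sets path_space \<and> (\<forall>q\<in>Q. emeasure q N = 0) \<and>
    (ennreal r < ennreal s \<longrightarrow> (\<forall>w w'. cadlag w \<longrightarrow> cadlag w' \<longrightarrow> w \<notin> N \<longrightarrow> w' \<notin> N \<longrightarrow>
      (\<forall>u. 0 \<le> u \<and> ennreal u \<le> ennreal s \<longrightarrow> w u = w' u) \<longrightarrow> (T w \<le> ennreal r \<longleftrightarrow> T w' \<le> ennreal r)))" for r s N
  have "\<exists>N. ok r s N" for r s
  proof (cases "ennreal r < ennreal s")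
    case True
    obtain B N where B: "B \<in> sets (path_algebra {u. 0 \<le> u \<and> ennreal u \<le> ennreal s})" and N: "N \<in> sets path_space"
      "\<forall>q\<in>Q. emeasure q N = 0" and d: "({w. cadlag w \<and> T w \<le> ennreal r} - B) \<union> (B - {w. cadlag w \<and> T w \<le> ennreal r}) \<subseteq> N"
      using natural_filtration_setsD[OF Q T_sets, of "ennreal r" "ennreal s"] True by blast
    have "T w \<le> ennreal r \<longleftrightarrow> T w' \<le> ennreal r" if w: "cadlag w" "cadlag w'" "w \<notin> N" "w' \<notin> N"
        "\<forall>u. 0 \<le> u \<and> ennreal u \<le> ennreal s \<longrightarrow> w u = w' u" for w w'
    proof -
      have "T w \<le> ennreal r \<longleftrightarrow> w \<in> B" "T w' \<le> ennreal r \<longleftrightarrow> w' \<in> B" using d w by auto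
      moreover have "w \<in> B \<longleftrightarrow> w' \<in> B"
        by (rule path_algebra_determined[OF B w(1,2)]) (use w(5) in auto)
      ultimately show ?thesis by simp
    qed
    then show ?thesis using N by (auto simp: ok_def)
  next
    case False
    then show ?thesis by (intro exI[of _ "{}"]) (auto simp: ok_def)
  qed
  then have "\<forall>r. \<exists>N. \<forall>s. ok r s (N s)" by (intro allI choice) blast
  from choice[OF this] obtain N where N: "\<And>r s. ok r s (N r s)" by blast
  define N' where "N' = (\<Union>r::rat. \<Union>s::rat. N (of_rat r) (of_rat s))"
  have le: "T w' \<le> T w" if w: "cadlag w" "cadlag w'" "w \<notin> N'" "w' \<notin> N'" "\<And>r. 0 \<le> r \<Longrightarrow> r < c \<Longrightarrow> w r = w' r"
      and less: "T w < ennreal c" "T w < T w'" for w w' c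
  proof -
    obtain r :: rat where r: "T w < ennreal (of_rat r)" "ennreal (of_rat r) < min (T w') (ennreal c)"
      using ennreal_rat_dense[of "T w" "min (T w') (ennreal c)"] less by auto
    then obtain s :: rat where s: "ennreal (of_rat r) < ennreal (of_rat s)" "ennreal (of_rat s) < ennreal c"
      using ennreal_rat_dense[of "ennreal (of_rat r)" "ennreal c"] by auto
    have "w \<notin> N (of_rat r) (of_rat s)" "w' \<notin> N (of_rat r) (of_rat s)" using w by (auto simp: N'_def)
    moreover have "w u = w' u" if "0 \<le> u" "ennreal u \<le> ennreal (of_rat s)" for u
    proof -
      have "ennreal u < ennreal c" using that(2) s(2) by (rule le_less_trans)
      then show ?thesis using w(5) that(1) by (auto simp: ennreal_less_iff)
    qed
    ultimately have "T w \<le> ennreal (of_rat r) \<longleftrightarrow> T w' \<le> ennreal (of_rat r)"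
      using N[of "of_rat r" "of_rat s"] s w(1,2) unfolding ok_def by blast
    then show ?thesis using r by auto
  qed
  show ?thesis
  proof (intro bexI[of _ N'] conjI ballI allI impI)
    show "N' \<in> sets path_space" using N by (auto simp: N'_def ok_def)
    show "emeasure q N' = 0" if q: "q \<in> Q" for q
    proof -
      have "N (of_rat r) (of_rat s) \<in> null_sets q" for r s :: rat
        using N[of "of_rat r" "of_rat s"] q Q[OF q] by (auto simp: null_sets_def ok_def)
      then have "N' \<in> null_sets q"
        unfolding N'_def by (intro null_sets_UN)
      then show ?thesis by auto
    qed
    fix w w' :: "real \<Rightarrow> 'a" and c :: real
    assume w: "cadlag w" "cadlag w'" "w \<notin> N'" "w' \<notin> N'" and "\<forall>r. 0 \<le> r \<longrightarrow> r < c \<longrightarrow> w r = w' r"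
    then have eq: "\<And>r. 0 \<le> r \<Longrightarrow> r < c \<Longrightarrow> w r = w' r" by blast
    show "min (ennreal c) (T w) = min (ennreal c) (T w')"
    proof (cases "T w" "T w'" rule: linorder_cases)
      case less
      then show ?thesis using le[of w w' c, OF w eq _ less] by (cases "T w < ennreal c") (auto simp: min_def)
    next
      case greater
      then show ?thesis using le[of w' w c, OF w(2,1,4,3) eq[symmetric] _ greater]
        by (cases "T w' < ennreal c") (auto simp: min_def)
    qed simp
  qed
qed

lemma strong_markov_kernel:
  fixes law :: "'a::topological_space \<Rightarrow> (real \<Rightarrow> 'a) measure"
  assumes "strong_markov \<FF> law" "\<And>x. prob_space (law x)" "\<And>x. sets (law x) = sets path_space"
  shows "law \<in> borel \<rightarrow>\<^sub>M subprob_algebra path_space"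
  using assms by (intro measurable_subprob_algebra)
    (auto simp: strong_markov_def intro: prob_space_imp_subprob_space)

text \<open>Both sides integrate \<open>f\<close> against a measure on path space: the law of the shifted
  path, and the mixture of the laws started at the value at time \<open>S\<close>. By the strong Markov
  property these measures agree on events. The event \<open>A\<close> of the augmented filtration is replaced
  by an almost surely equal measurable \<open>A'\<close>, because densities and mixtures need
  measurability.\<close>

lemma strong_markov_nn_integral:
  fixes law :: "'a::euclidean_space \<Rightarrow> (real \<Rightarrow> 'a) measure"
  assumes sm: "strong_markov (natural_filtration Q) law"
    and law: "\<And>x. prob_space (law x)" "\<And>x. sets (law x) = sets path_space"
    and S: "stopping_time (natural_filtration Q) S" "S \<in> borel_measurable path_space"
    and A: "A \<in> sets (filtration.pre_sigma {w. cadlag w} (natural_filtration Q) S)"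
    and A': "A' \<in> sets path_space" "AE w in law x. w \<in> A \<longleftrightarrow> w \<in> A'"
    and f: "f \<in> borel_measurable path_space"
  shows "(\<integral>\<^sup>+w. indicator {w\<in>A'. S w < \<infinity>} w * f (path_shift (enn2real (S w)) w) \<partial>law x) =
    (\<integral>\<^sup>+w. indicator {w\<in>A'. S w < \<infinity>} w * (\<integral>\<^sup>+w'. f w' \<partial>law (w (enn2real (S w)))) \<partial>law x)"
proof -
  have mlaw: "measurable (law x) L = measurable path_space L" for L :: "'b measure"
    by (rule measurable_cong_sets[OF law(2) refl])
  have kernel: "law \<in> borel \<rightarrow>\<^sub>M subprob_algebra path_space"
    by (rule strong_markov_kernel[OF sm law])
  let ?I = "indicator {w\<in>A'. S w < \<infinity>} :: (real \<Rightarrow> 'a) \<Rightarrow> ennreal"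
  have sub: "A' \<subseteq> space path_space" using sets.sets_into_space[OF A'(1)] .
  have "{w\<in>A'. S w < \<infinity>} = A' \<inter> {w\<in>space path_space. S w < \<infinity>}" using sub by auto
  also have "\<dots> \<in> sets path_space" using S(2) A'(1) by measurable
  finally have I: "?I \<in> borel_measurable path_space" by simp
  have S': "(\<lambda>w. enn2real (S w)) \<in> borel_measurable path_space" using S(2) by measurable
  have \<theta>: "(\<lambda>w. path_shift (enn2real (S w)) w) \<in> path_space \<rightarrow>\<^sub>M (path_space :: (real \<Rightarrow> 'a) measure)"
    by (rule measurable_path_shift[OF _ S']) auto
  have ev: "(\<lambda>w. w (enn2real (S w))) \<in> path_space \<rightarrow>\<^sub>M (borel :: 'a measure)"
    by (rule measurable_eval_random[OF _ S']) auto
  have k: "(\<lambda>w. law (w (enn2real (S w)))) \<in> path_space \<rightarrow>\<^sub>M subprob_algebra path_space"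
    by (rule measurable_compose[OF ev kernel])
  let ?\<mu> = "density (law x) ?I"
  have m\<mu>: "measurable ?\<mu> L = measurable path_space L" for L :: "'b measure"
    by (rule measurable_cong_sets) (auto simp: law(2))
  have sp: "space (law x) = space path_space" using law(2) by (rule sets_eq_imp_space_eq)
  have ne: "space ?\<mu> \<noteq> {}" using prob_space.not_empty[OF law(1)] by simp
  have "distr ?\<mu> path_space (\<lambda>w. path_shift (enn2real (S w)) w) = ?\<mu> \<bind> (\<lambda>w. law (w (enn2real (S w))))" (is "?D = ?B")
  proof (rule measure_eqI)
    have sB: "sets ?B = sets path_space" by (rule sets_bind[OF _ ne]) (rule law(2))
    then show "sets ?D = sets ?B" by simp
    fix B assume "B \<in> sets ?D"
    then have B: "B \<in> sets path_space" by simp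
    have \<theta>B: "(\<lambda>w. path_shift (enn2real (S w)) w) -` B \<inter> space ?\<mu> \<in> sets (law x)"
      using measurable_sets[OF \<theta> B] by (simp add: law(2) sp)
    have "emeasure ?D B = (\<integral>\<^sup>+w. ?I w * indicator ((\<lambda>w. path_shift (enn2real (S w)) w) -` B \<inter> space ?\<mu>) w \<partial>law x)"
    proof -
      have "emeasure ?D B = emeasure ?\<mu> ((\<lambda>w. path_shift (enn2real (S w)) w) -` B \<inter> space ?\<mu>)"
        by (rule emeasure_distr[OF _ B]) (unfold m\<mu>, rule \<theta>)
      also have "\<dots> = (\<integral>\<^sup>+w. ?I w * indicator ((\<lambda>w. path_shift (enn2real (S w)) w) -` B \<inter> space ?\<mu>) w \<partial>law x)"
        by (rule emeasure_density[OF _ \<theta>B]) (unfold mlaw, rule I)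
      finally show ?thesis .
    qed
    also have "\<dots> = (\<integral>\<^sup>+w. indicator {w\<in>A. S w < \<infinity>} w * indicator B (path_shift (enn2real (S w)) w) \<partial>law x)"
      by (rule nn_integral_cong_AE) (use A'(2) AE_space in eventually_elim, auto simp: indicator_def)
    also have "\<dots> = (\<integral>\<^sup>+w. indicator {w\<in>A. S w < \<infinity>} w * emeasure (law (w (enn2real (S w)))) B \<partial>law x)"
      using sm S(1) A B unfolding strong_markov_def by blast
    also have "\<dots> = (\<integral>\<^sup>+w. ?I w * emeasure (law (w (enn2real (S w)))) B \<partial>law x)"
      by (rule nn_integral_cong_AE) (use A'(2) in eventually_elim, auto simp: indicator_def)
    also have "\<dots> = (\<integral>\<^sup>+w. emeasure (law (w (enn2real (S w)))) B \<partial>?\<mu>)"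
      using measurable_emeasure_kernel[OF k B] I by (intro nn_integral_density[symmetric]) (simp_all only: mlaw)
    also have "\<dots> = emeasure ?B B"
      by (rule emeasure_bind[symmetric, OF ne _ B]) (unfold m\<mu>, rule k)
    finally show "emeasure ?D B = emeasure ?B B" .
  qed
  then have "(\<integral>\<^sup>+w. f w \<partial>?D) = (\<integral>\<^sup>+w. f w \<partial>?B)" by simp
  also have "(\<integral>\<^sup>+w. f w \<partial>?D) = (\<integral>\<^sup>+w. ?I w * f (path_shift (enn2real (S w)) w) \<partial>law x)"
  proof -
    have "(\<integral>\<^sup>+w. f w \<partial>?D) = (\<integral>\<^sup>+w. f (path_shift (enn2real (S w)) w) \<partial>?\<mu>)"
      by (rule nn_integral_distr) (simp_all only: m\<mu> \<theta> f measurable_distr_eq1)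
    also have "\<dots> = (\<integral>\<^sup>+w. ?I w * f (path_shift (enn2real (S w)) w) \<partial>law x)"
      using measurable_compose[OF \<theta> f] I by (intro nn_integral_density) (simp_all only: mlaw)
    finally show ?thesis .
  qed
  also have "(\<integral>\<^sup>+w. f w \<partial>?B) = (\<integral>\<^sup>+w. ?I w * (\<integral>\<^sup>+w'. f w' \<partial>law (w (enn2real (S w)))) \<partial>law x)"
  proof -
    have "(\<integral>\<^sup>+w. f w \<partial>?B) = (\<integral>\<^sup>+w. (\<integral>\<^sup>+w'. f w' \<partial>law (w (enn2real (S w)))) \<partial>?\<mu>)"
      by (rule nn_integral_bind[OF f]) (simp only: m\<mu> k)
    also have "\<dots> = (\<integral>\<^sup>+w. ?I w * (\<integral>\<^sup>+w'. f w' \<partial>law (w (enn2real (S w)))) \<partial>law x)"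
      using measurable_compose[OF k nn_integral_measurable_subprob_algebra[OF f]] I
      by (intro nn_integral_density) (simp_all only: mlaw)
    finally show ?thesis .
  qed
  finally show ?thesis .
qed

text \<open>On \<open>S \<le> t\<close> the complementary event \<open>T < S\<close> means \<open>T \<le> d <
  S\<close> for some \<open>d \<le> t\<close> in a fixed countable set.\<close>

lemma stopping_time_le_pre_sigma:
  fixes S T :: "(real \<Rightarrow> 'a::topological_space) \<Rightarrow> ennreal"
  assumes S: "stopping_time (natural_filtration Q) S" and T: "stopping_time (natural_filtration Q) T"
  shows "{w. cadlag w \<and> S w \<le> T w} \<in> sets (filtration.pre_sigma {w. cadlag w} (natural_filtration Q) S)"
proof -
  interpret filtration "{w :: real \<Rightarrow> 'a. cadlag w}" "natural_filtration Q"
    by (rule filtration_natural_filtration)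
  obtain D :: "ennreal set"
    where D: "countable D" and sep: "\<And>x y. x < y \<Longrightarrow> (\<exists>b\<in>D. x \<le> b \<and> b < y)"
    using countable_separating_set_linorder2 by auto
  have "{w \<in> {w. cadlag w \<and> S w \<le> T w}. S w \<le> t} \<in> sets (natural_filtration Q t)" for t
  proof -
    have D': "countable {d\<in>D. d \<le> t}" using D by (rule countable_subset[rotated]) auto
    have "Measurable.pred (natural_filtration Q t) (\<lambda>w. S w \<le> t \<and> \<not> (\<exists>d\<in>{d\<in>D. d \<le> t}. T w \<le> d \<and> \<not> S w \<le> d))"
      by (intro pred_intros_logic measurable_pred_countable(2)[OF D'] stopping_time_le_const[OF T] stopping_time_le_const[OF S]) auto
    moreover have "(S w \<le> t \<and> \<not> (\<exists>d\<in>{d\<in>D. d \<le> t}. T w \<le> d \<and> \<not> S w \<le> d)) \<longleftrightarrow> S w \<le> T w \<and> S w \<le> t" for w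
    proof (intro iffI conjI)
      assume H: "S w \<le> t \<and> \<not> (\<exists>d\<in>{d\<in>D. d \<le> t}. T w \<le> d \<and> \<not> S w \<le> d)"
      show "S w \<le> T w"
      proof (rule ccontr)
        assume "\<not> ?thesis"
        then obtain d where "d \<in> D" "T w \<le> d" "d < S w" using sep[of "T w" "S w"] by (auto simp: not_le)
        with H show False by auto
      qed
    qed auto
    ultimately show ?thesis
      by (simp only: pred_def space_F mem_Collect_eq conj_assoc)
  qed
  then show ?thesis by (intro sets_pre_sigmaI[OF S])
qed

section \<open>First jump of a compound Poisson process\<close>

text \<open>The quadratic order is what matters: among \<open>O(m)\<close> intervals of length
  \<open>1/m\<close>, the probability that some interval carries two jumps is \<open>O(1/m)\<close>.\<close>

lemma poisson_prob_ge_2: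
  assumes "0 < \<mu>"
  shows "measure (measure_pmf (poisson_pmf \<mu>)) {2..} \<le> \<mu>\<^sup>2"
proof -
  have "measure (measure_pmf (poisson_pmf \<mu>)) {2..} = 1 - measure (measure_pmf (poisson_pmf \<mu>)) {0, 1}"
  proof -
    have "{2..} = UNIV - {0, 1 :: nat}" by auto
    then show ?thesis using measure_pmf.prob_compl[of "{0,1}" "poisson_pmf \<mu>"] by simp
  qed
  also have "measure (measure_pmf (poisson_pmf \<mu>)) {0, 1} = exp (- \<mu>) * (1 + \<mu>)"
    using assms by (simp add: measure_measure_pmf_finite algebra_simps)
  also have "(1 - \<mu>) * (1 + \<mu>) \<le> exp (- \<mu>) * (1 + \<mu>)"
    using assms exp_ge_add_one_self[of "-\<mu>"] by (intro mult_right_mono) auto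
  then have "1 - exp (- \<mu>) * (1 + \<mu>) \<le> \<mu>\<^sup>2"
    by (simp add: algebra_simps power2_eq_square)
  finally show ?thesis .
qed

lemma counting_path_first_jump:
  fixes n :: "real \<Rightarrow> nat"
  assumes n: "cadlag n" "n 0 = 0" "mono_on {0..} n" and k: "0 \<le> k" "1 \<le> n k"
  defines "z \<equiv> Inf {t. 0 \<le> t \<and> 1 \<le> n t}"
  shows "0 < z" and "1 \<le> n z" and "0 \<le> t \<Longrightarrow> t < z \<Longrightarrow> n t = 0" and "0 \<le> a \<Longrightarrow> z \<le> a \<longleftrightarrow> 1 \<le> n a"
proof -
  let ?H = "{t. 0 \<le> t \<and> 1 \<le> n t}"
  have bdd: "bdd_below ?H" by (auto intro!: bdd_belowI[of _ 0])
  have ne: "?H \<noteq> {}" using k by auto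
  show before: "n t = 0" if "0 \<le> t" "t < z" for t
    using cInf_lower[OF _ bdd, of t] that unfolding z_def by fastforce
  have z0: "0 \<le> z" unfolding z_def using ne by (intro cInf_greatest) auto
  show at: "1 \<le> n z"
  proof (rule ccontr)
    assume "\<not> 1 \<le> n z"
    then have "eventually (\<lambda>s. n s \<in> {0}) (at_right z)"
      by (intro topological_tendstoD[OF cadlag_right[OF n(1) z0]]) (auto simp: Topological_Spaces.open_discrete)
    then obtain b where b: "z < b" "\<And>s. z < s \<Longrightarrow> s < b \<Longrightarrow> n s = 0"
      by (auto simp: eventually_at_right_field)
    have "b \<le> z"
      unfolding z_def
    proof (rule cInf_greatest[OF ne])
      fix s assume s: "s \<in> ?H"
      then have "z \<le> s" unfolding z_def by (intro cInf_lower bdd)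
      moreover have "s \<noteq> z" using s \<open>\<not> 1 \<le> n z\<close> by auto
      ultimately show "b \<le> s" using b(2)[of s] s by force
    qed
    with b show False by simp
  qed
  show "0 < z" using z0 at n(2) by (cases "z = 0") auto
  show "z \<le> a \<longleftrightarrow> 1 \<le> n a" if "0 \<le> a"
  proof
    assume "z \<le> a"
    then have "n z \<le> n a" using n(3) z0 that by (auto simp: mono_on_def)
    then show "1 \<le> n a" using at by simp
  next
    assume "1 \<le> n a"
    then show "z \<le> a" unfolding z_def using that by (intro cInf_lower bdd) auto
  qed
qed

lemma measurable_nat_borel_iff: "f \<in> M \<rightarrow>\<^sub>M (borel :: nat measure) \<Longrightarrow> f \<in> M \<rightarrow>\<^sub>M count_space UNIV"
  by (rule measurable_compose[where N="borel :: nat measure" and g="\<lambda>x. x"])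
    (auto intro!: measurableI borel_open Topological_Spaces.open_discrete)

locale poisson_clock = prob_space +
  fixes rate :: real and N :: "'a \<Rightarrow> real \<Rightarrow> nat"
  assumes rate: "0 < rate" and poisson: "poisson_process M rate N"
begin

lemma N_measurable: "N \<in> M \<rightarrow>\<^sub>M path_space"
  and N_start: "\<omega> \<in> space M \<Longrightarrow> N \<omega> 0 = 0"
  and N_mono: "\<omega> \<in> space M \<Longrightarrow> mono_on {0..} (N \<omega>)"
  using poisson by (auto simp: poisson_process_def)

lemma N_cadlag: "\<omega> \<in> space M \<Longrightarrow> cadlag (N \<omega>)"
  using measurable_space[OF N_measurable] by (auto simp: space_path_algebra)

lemma N_time_measurable: "0 \<le> t \<Longrightarrow> (\<lambda>\<omega>. N \<omega> t) \<in> M \<rightarrow>\<^sub>M count_space UNIV"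
  by (intro measurable_nat_borel_iff measurable_compose[OF N_measurable measurable_coordinate]) auto

lemma prob_increment:
  assumes "0 \<le> s" "s < t"
  shows "prob {\<omega>\<in>space M. N \<omega> t - N \<omega> s \<in> A} = measure (measure_pmf (poisson_pmf (rate * (t - s)))) A"
proof -
  have m: "(\<lambda>\<omega>. N \<omega> t - N \<omega> s) \<in> M \<rightarrow>\<^sub>M count_space UNIV"
    using measurable_compose_countable[OF _ N_time_measurable[of s], of "\<lambda>i \<omega>. N \<omega> t - i" "count_space UNIV"]
      measurable_compose[OF N_time_measurable[of t], of "\<lambda>x. x - i" "count_space UNIV" for i] assms
    by simp
  have "measure (distr M (count_space UNIV) (\<lambda>\<omega>. N \<omega> t - N \<omega> s)) A = prob {\<omega>\<in>space M. N \<omega> t - N \<omega> s \<in> A}"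
    by (subst measure_distr[OF m]) (auto intro!: arg_cong[where f=prob])
  then show ?thesis
    using poisson assms by (simp add: poisson_process_def)
qed

lemma prob_no_jump:
  assumes "0 \<le> t"
  shows "prob {\<omega>\<in>space M. N \<omega> t = 0} = exp (- t * rate)"
proof (cases "t = 0")
  case True
  have "{\<omega>\<in>space M. N \<omega> t = 0} = space M" using N_start True by auto
  then show ?thesis using True by (simp add: prob_space)
next
  case False
  then have "0 < t" using assms by simp
  have "{\<omega>\<in>space M. N \<omega> t = 0} = {\<omega>\<in>space M. N \<omega> t - N \<omega> 0 \<in> {0}}"
    using N_start by auto
  then have "prob {\<omega>\<in>space M. N \<omega> t = 0} = measure (measure_pmf (poisson_pmf (rate * (t - 0)))) {0}"
    using prob_increment[of 0 t "{0}"] \<open>0 < t\<close> by simp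
  also have "\<dots> = exp (- t * rate)"
    using \<open>0 < t\<close> rate by (simp add: measure_measure_pmf_finite mult.commute)
  finally show ?thesis .
qed

lemma AE_jump: "AE \<omega> in M. \<exists>k::nat. 1 \<le> N \<omega> k"
proof -
  have m: "{\<omega>\<in>space M. N \<omega> (real k) = 0} \<in> events" for k
    using N_time_measurable[of "real k"] by (auto intro!: pred_intros_logic simp: pred_def[symmetric]) measurable
  let ?A = "\<Inter>k::nat. {\<omega>\<in>space M. N \<omega> (real k) = 0}"
  have A: "?A \<in> events" using m by auto
  have "prob ?A \<le> exp (- real k * rate)" for k
    using prob_no_jump[of "real k"] finite_measure_mono[OF _ m[of k], of ?A] by auto
  moreover have "(\<lambda>k. exp (- real k * rate)) \<longlonglongrightarrow> 0"
    using rate by real_asymp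
  ultimately have "prob ?A \<le> 0" by (intro LIMSEQ_le_const) auto
  then have "?A \<in> null_sets M" using A by (auto simp: null_sets_def emeasure_eq_measure measure_le_0_iff)
  then have "AE \<omega> in M. \<omega> \<notin> ?A" by (rule AE_not_in)
  then show ?thesis using AE_space by eventually_elim (auto simp: Suc_le_eq)
qed

lemma AE_first_jump:
  "AE \<omega> in M. 0 < first_jump N \<omega> \<and> 1 \<le> N \<omega> (first_jump N \<omega>) \<and>
     (\<forall>t. 0 \<le> t \<longrightarrow> t < first_jump N \<omega> \<longrightarrow> N \<omega> t = 0) \<and> (\<forall>a\<ge>0. first_jump N \<omega> \<le> a \<longleftrightarrow> 1 \<le> N \<omega> a)"
  using AE_jump AE_space
proof eventually_elim
  case (elim \<omega>)
  then obtain k :: nat where k: "1 \<le> N \<omega> (real k)" by auto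
  note c = counting_path_first_jump[OF N_cadlag[OF elim(2)] N_start[OF elim(2)] N_mono[OF elim(2)] of_nat_0_le_iff k]
  show ?case unfolding first_jump_def
    by (intro conjI allI impI c) assumption+
qed

lemma first_jump_measurable: "first_jump N \<in> borel_measurable M"
proof -
  have "first_jump N = (\<lambda>\<omega>. Inf {t. 0 \<le> t \<and> N \<omega> t \<in> {1..}})" by (auto simp: first_jump_def)
  also have "\<dots> \<in> borel_measurable M"
    by (rule measurable_compose[OF N_measurable measurable_hitting_time]) (rule Topological_Spaces.open_discrete)
  finally show ?thesis .
qed

text \<open>The first jump is at most \<open>a\<close> if and only if the process has left \<open>0\<close> by
  time \<open>a\<close>.\<close>

lemma first_jump_exponential: "distributed M lborel (first_jump N) (exponential_density rate)"
proof (rule exponential_distributedI[OF first_jump_measurable rate])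
  fix a :: real assume a: "0 \<le> a"
  have m: "{\<omega>\<in>space M. N \<omega> a = 0} \<in> events" 
    using N_time_measurable[OF a] by measurable
  have "emeasure M {\<omega> \<in> space M. first_jump N \<omega> \<le> a} = emeasure M (space M - {\<omega>\<in>space M. N \<omega> a = 0})"
  proof (rule emeasure_eq_AE)
    show "AE x in M. (x \<in> {\<omega> \<in> space M. first_jump N \<omega> \<le> a}) = (x \<in> space M - {\<omega>\<in>space M. N \<omega> a = 0})"
      using AE_first_jump by eventually_elim (use a in auto)
    show "{\<omega> \<in> space M. first_jump N \<omega> \<le> a} \<in> events" using first_jump_measurable by measurable
  qed (use m in auto)
  also have "\<dots> = ennreal (1 - exp (- a * rate))"
    using prob_compl[OF m] prob_no_jump[OF a] by (simp add: emeasure_eq_measure)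
  finally show "emeasure M {\<omega> \<in> space M. first_jump N \<omega> \<le> a} = 1 - ennreal (exp (- a * rate))"
    using a rate by (simp add: ennreal_minus[symmetric])
qed

text \<open>Suppose that the first jump occurs by time \<open>K\<close> and has height at least two. On each
  grid of mesh \<open>1 / (m + 1)\<close> the interval that contains it has an increment of at least two. This
  has probability at most \<open>K * rate\<^sup>2 / (m + 1)\<close>, for all \<open>m\<close>.\<close>

lemma AE_unit_jump: "AE \<omega> in M. N \<omega> (first_jump N \<omega>) = 1"
proof -
  define inc where "inc m j = {\<omega>\<in>space M. N \<omega> (real (Suc j) / real (Suc m)) - N \<omega> (real j / real (Suc m)) \<in> {2..}}" for m j :: nat
  have m: "inc m j \<in> events" for m j
  proof -
    have "(\<lambda>\<omega>. N \<omega> (real (Suc j) / real (Suc m))) \<in> M \<rightarrow>\<^sub>M count_space UNIV"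
      "(\<lambda>\<omega>. N \<omega> (real j / real (Suc m))) \<in> M \<rightarrow>\<^sub>M count_space UNIV"
      by (rule N_time_measurable; simp)+
    then show ?thesis unfolding inc_def by measurable
  qed
  define bad where "bad K m = (\<Union>j<K * Suc m. inc m j)" for K m :: nat
  have bad: "bad K m \<in> events" for K m unfolding bad_def using m by auto
  have "prob (bad K m) \<le> K * rate\<^sup>2 / Suc m" for K m
  proof -
    have p: "prob (inc m j) \<le> (rate / Suc m)\<^sup>2" for j
    proof -
      have "real (Suc j) / real (Suc m) - real j / real (Suc m) = 1 / Suc m"
        by (simp add: diff_divide_distrib[symmetric])
      then have "prob (inc m j) = measure (measure_pmf (poisson_pmf (rate * (1 / Suc m)))) {2..}"
        unfolding inc_def by (subst prob_increment) (auto simp: divide_strict_right_mono)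
      also have "\<dots> \<le> (rate * (1 / Suc m))\<^sup>2" using rate by (intro poisson_prob_ge_2) simp
      finally show ?thesis by simp
    qed
    have "prob (bad K m) \<le> (\<Sum>j<K * Suc m. prob (inc m j))"
      unfolding bad_def using m by (intro finite_measure_subadditive_finite) auto
    also have "\<dots> \<le> (\<Sum>j<K * Suc m. (rate / Suc m)\<^sup>2)" by (intro sum_mono p)
    also have "\<dots> = K * rate\<^sup>2 / Suc m"
      unfolding sum_constant card_lessThan of_nat_mult by (simp add: power2_eq_square divide_simps del: of_nat_Suc)
    finally show ?thesis .
  qed
  moreover have "(\<lambda>m. K * rate\<^sup>2 / Suc m) \<longlonglongrightarrow> 0" for K :: nat by real_asymp
  moreover have "prob (\<Inter>m. bad K m) \<le> prob (bad K m)" for K m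
    using bad by (intro finite_measure_mono) auto
  ultimately have "prob (\<Inter>m. bad K m) \<le> 0" for K
    by (intro LIMSEQ_le_const[where X="\<lambda>m. K * rate\<^sup>2 / Suc m"]) (blast intro: order_trans)+
  then have "(\<Inter>m. bad K m) \<in> null_sets M" for K
    using bad by (auto simp: null_sets_def emeasure_eq_measure measure_le_0_iff)
  then have "AE \<omega> in M. \<forall>K. \<omega> \<notin> (\<Inter>m. bad K m)" unfolding AE_all_countable by (intro allI AE_not_in)
  then show ?thesis using AE_first_jump AE_space
  proof eventually_elim
    case (elim \<omega>)
    let ?z = "first_jump N \<omega>"
    have z: "0 < ?z" "1 \<le> N \<omega> ?z" "\<And>t. 0 \<le> t \<Longrightarrow> t < ?z \<Longrightarrow> N \<omega> t = 0" using elim by auto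
    obtain K :: nat where K: "?z \<le> real K" using real_arch_simple by blast
    obtain m where m: "\<omega> \<notin> bad K m" using elim by blast
    \<comment> \<open>The jump time lies in the half-open interval from \<open>j / (m + 1)\<close>, exclusively, to \<open>(j + 1) / (m + 1)\<close>.\<close>
    define j where "j = nat (\<lceil>?z * Suc m\<rceil> - 1)"
    have pos: "0 < ?z * Suc m" using z by simp
    then have j: "real j = of_int \<lceil>?z * Suc m\<rceil> - 1" unfolding j_def by simp
    have "real j < ?z * Suc m" "?z * Suc m \<le> real (Suc j)" using j by linarith+
    then have j1: "real j / Suc m < ?z" "?z \<le> real (Suc j) / Suc m"
      by (simp_all add: pos_divide_less_eq pos_le_divide_eq del: of_nat_Suc)
    have "real j < real (K * Suc m)"
      unfolding of_nat_mult
      by (rule less_le_trans[OF \<open>real j < ?z * Suc m\<close> mult_right_mono[OF K]]) simp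
    then have "j < K * Suc m" by (simp only: of_nat_less_iff)
    then have "\<omega> \<notin> inc m j" using m unfolding bad_def by blast
    moreover have "N \<omega> (real j / Suc m) = 0" using j1 by (intro z) auto
    ultimately have "N \<omega> (real (Suc j) / Suc m) < 2" using elim by (auto simp: inc_def)
    moreover have "N \<omega> ?z \<le> N \<omega> (real (Suc j) / Suc m)"
      using N_mono[of \<omega>] elim z(1) j1(2) by (auto simp: mono_on_def)
    ultimately show ?case using z(2) by simp
  qed
qed

end

text \<open>Only \<open>Z\<close> is independent of \<open>Y\<close>, so the first jump time and the first
  jump have to be read off \<open>Z\<close>. They are the hitting time of the complement of \<open>0\<close>
  and the value at that time, because \<open>N\<close> jumps by one first and \<open>U\<^sub>1\<close> does
  not vanish.\<close>

lemma (in prob_space) compound_poisson_first_jump_law: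
  fixes U :: "nat \<Rightarrow> 'a \<Rightarrow> 'b::euclidean_space"
  assumes rate: "0 < rate" and Z: "compound_poisson_process M rate F N U Z"
    and F: "AE v in F. v \<noteq> 0"
    and Y: "indep_var path_space Y path_space Z"
  shows "distr M (path_space \<Otimes>\<^sub>M (borel \<Otimes>\<^sub>M borel)) (\<lambda>\<omega>. (Y \<omega>, first_jump N \<omega>, U 1 \<omega>)) =
    distr M path_space Y \<Otimes>\<^sub>M (density lborel (exponential_density rate) \<Otimes>\<^sub>M F)"
    and "AE \<omega> in M. \<forall>t. 0 \<le> t \<longrightarrow> t < first_jump N \<omega> \<longrightarrow> Z \<omega> t = 0"
    and "AE \<omega> in M. Z \<omega> (first_jump N \<omega>) = U 1 \<omega>"
    and "U 1 \<in> borel_measurable M" and "distr M borel (U 1) = F"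
proof -
  interpret poisson_clock M rate N
    by standard (use rate Z in \<open>auto simp: compound_poisson_process_def\<close>)
  have U: "indep_vars (\<lambda>_. borel) U {1..}" and UF: "distr M borel (U 1) = F"
    and ind: "indep_set {N -` A \<inter> space M | A. A \<in> sets path_space}
       {(\<lambda>\<omega>. \<lambda>k\<in>{1..}. U k \<omega>) -` B \<inter> space M | B. B \<in> sets (Pi\<^sub>M {1..} (\<lambda>_. borel))}"
    and Z_eq: "\<And>\<omega> t. \<omega> \<in> space M \<Longrightarrow> 0 \<le> t \<Longrightarrow> Z \<omega> t = (\<Sum>k=1..N \<omega> t. U k \<omega>)"
    using Z by (auto simp: compound_poisson_process_def)
  show U1: "U 1 \<in> borel_measurable M" using U by (auto simp: indep_vars_def)
  show "distr M borel (U 1) = F" by (rule UF)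
  show before: "AE \<omega> in M. \<forall>t. 0 \<le> t \<longrightarrow> t < first_jump N \<omega> \<longrightarrow> Z \<omega> t = 0"
    using AE_first_jump AE_space by eventually_elim (simp add: Z_eq)
  show at: "AE \<omega> in M. Z \<omega> (first_jump N \<omega>) = U 1 \<omega>"
    using AE_first_jump AE_unit_jump AE_space by eventually_elim (simp add: Z_eq)
  have U_ne: "AE \<omega> in M. U 1 \<omega> \<noteq> 0"
    using F unfolding UF[symmetric] by (subst (asm) AE_distr_iff) (use U1 in auto)
  let ?E = "density lborel (exponential_density rate) :: real measure"
  have \<zeta>: "distr M borel (first_jump N) = ?E"
    using first_jump_exponential by (simp add: distributed_def cong: distr_cong)
  interpret E: prob_space ?E
    using prob_space_distr[OF first_jump_measurable] by (simp add: \<zeta>)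
  interpret F: prob_space F using prob_space_distr[OF U1] unfolding UF .
  have \<zeta>U: "distr M (borel \<Otimes>\<^sub>M borel) (\<lambda>\<omega>. (first_jump N \<omega>, U 1 \<omega>)) = ?E \<Otimes>\<^sub>M F"
  proof (rule pair_measure_eqI[symmetric])
    show "sigma_finite_measure ?E" "sigma_finite_measure F" by unfold_locales
    have "sets F = sets borel" using UF by auto
    then show "sets (?E \<Otimes>\<^sub>M F) = sets (distr M (borel \<Otimes>\<^sub>M borel) (\<lambda>\<omega>. (first_jump N \<omega>, U 1 \<omega>)))"
      by (simp cong: sets_pair_measure_cong)
    fix A :: "real set" and B assume "A \<in> sets ?E" "B \<in> sets F"
    with \<open>sets F = sets borel\<close> have A: "A \<in> sets borel" and B: "B \<in> sets borel" by auto
    have hit: "(\<lambda>n::real \<Rightarrow> nat. Inf {t. 0 \<le> t \<and> n t \<in> {1..}}) \<in> borel_measurable path_space"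
      by (rule measurable_hitting_time) (rule Topological_Spaces.open_discrete)
    have a: "first_jump N -` A \<inter> space M = N -` ((\<lambda>n::real \<Rightarrow> nat. Inf {t. 0 \<le> t \<and> n t \<in> {1..}}) -` A \<inter> space path_space) \<inter> space M"
      using measurable_space[OF N_measurable] by (auto simp: first_jump_def)
    have b: "U 1 -` B \<inter> space M = (\<lambda>\<omega>. \<lambda>k\<in>{1..}. U k \<omega>) -` ((\<lambda>u. u 1) -` B \<inter> space (Pi\<^sub>M {1..} (\<lambda>_. borel))) \<inter> space M"
      by (auto simp: space_PiM)
    have comp: "(\<lambda>u. u (1::nat)) \<in> Pi\<^sub>M {1..} (\<lambda>_. borel) \<rightarrow>\<^sub>M (borel :: 'b measure)"
      by (rule measurable_component_singleton) simp
    have "first_jump N -` A \<inter> space M \<in> {N -` A \<inter> space M | A. A \<in> sets path_space}"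
      unfolding a using measurable_sets[OF hit A] by blast
    moreover have "U 1 -` B \<inter> space M \<in>
        {(\<lambda>\<omega>. \<lambda>k\<in>{1..}. U k \<omega>) -` B \<inter> space M | B. B \<in> sets (Pi\<^sub>M {1..} (\<lambda>_. borel))}"
      unfolding b using measurable_sets[OF comp B] by blast
    ultimately have "prob ((first_jump N -` A \<inter> space M) \<inter> (U 1 -` B \<inter> space M)) =
       prob (first_jump N -` A \<inter> space M) * prob (U 1 -` B \<inter> space M)"
      by (rule indep_setD[OF ind])
    moreover have "(\<lambda>\<omega>. (first_jump N \<omega>, U 1 \<omega>)) -` (A \<times> B) \<inter> space M = (first_jump N -` A \<inter> space M) \<inter> (U 1 -` B \<inter> space M)"
      by auto
    ultimately show "emeasure ?E A * emeasure F B = emeasure (distr M (borel \<Otimes>\<^sub>M borel) (\<lambda>\<omega>. (first_jump N \<omega>, U 1 \<omega>))) (A \<times> B)"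
      using A B U1 first_jump_measurable
      by (simp add: \<zeta>[symmetric] UF[symmetric] emeasure_distr emeasure_eq_measure ennreal_mult)
  qed
  let ?z = "\<lambda>z::real \<Rightarrow> 'b. Inf {t. 0 \<le> t \<and> z t \<in> - {0}}"
  define g where "g z = (?z z, z (max 0 (?z z)))" for z
  have z: "?z \<in> borel_measurable path_space" by (rule measurable_hitting_time) auto
  have g: "g \<in> path_space \<rightarrow>\<^sub>M borel \<Otimes>\<^sub>M borel"
    unfolding g_def[abs_def] by (intro measurable_Pair z measurable_eval_max measurable_ident[unfolded id_def])
  have gZ: "AE \<omega> in M. g (Z \<omega>) = (first_jump N \<omega>, U 1 \<omega>)"
    using before at U_ne AE_first_jump
  proof eventually_elim
    case (elim \<omega>)
    have "?z (Z \<omega>) = first_jump N \<omega>"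
      by (rule cInf_eq_minimum) (use elim in \<open>force simp: not_less[symmetric]\<close>)+
    then show ?case using elim by (simp add: g_def max_def)
  qed
  have Ym: "Y \<in> M \<rightarrow>\<^sub>M path_space" using Y by (rule indep_var_rv1)
  have Zm: "Z \<in> M \<rightarrow>\<^sub>M path_space" using Y by (rule indep_var_rv2)
  have "distr M (path_space \<Otimes>\<^sub>M (borel \<Otimes>\<^sub>M borel)) (\<lambda>\<omega>. (Y \<omega>, first_jump N \<omega>, U 1 \<omega>)) =
      distr M (path_space \<Otimes>\<^sub>M (borel \<Otimes>\<^sub>M borel)) (\<lambda>\<omega>. (Y \<omega>, g (Z \<omega>)))"
  proof (rule distr_cong_AE[OF refl refl])
    show "AE \<omega> in M. (Y \<omega>, first_jump N \<omega>, U 1 \<omega>) = (Y \<omega>, g (Z \<omega>))"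
      using gZ by eventually_elim simp
  qed (intro measurable_Pair Ym U1 first_jump_measurable measurable_compose[OF Zm g])+
  also have "\<dots> = distr (distr M (path_space \<Otimes>\<^sub>M path_space) (\<lambda>\<omega>. (Y \<omega>, Z \<omega>)))
      (path_space \<Otimes>\<^sub>M (borel \<Otimes>\<^sub>M borel)) (\<lambda>(y, z). (y, g z))"
  proof (subst distr_distr)
    show "(\<lambda>(y, z). (y, g z)) \<in> path_space \<Otimes>\<^sub>M path_space \<rightarrow>\<^sub>M path_space \<Otimes>\<^sub>M (borel \<Otimes>\<^sub>M borel)"
      unfolding case_prod_beta
      by (rule measurable_Pair[OF measurable_fst measurable_compose[OF measurable_snd g]])
    show "(\<lambda>\<omega>. (Y \<omega>, Z \<omega>)) \<in> M \<rightarrow>\<^sub>M path_space \<Otimes>\<^sub>M path_space" by (intro measurable_Pair Ym Zm)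
  qed (simp add: comp_def)
  also have "\<dots> = distr (distr M path_space Y \<Otimes>\<^sub>M distr M path_space Z)
      (path_space \<Otimes>\<^sub>M (borel \<Otimes>\<^sub>M borel)) (\<lambda>(y, z). (y, g z))"
    using Y unfolding indep_var_distribution_eq by simp
  also have "\<dots> = distr (distr M path_space Y) path_space (\<lambda>y. y) \<Otimes>\<^sub>M distr (distr M path_space Z) (borel \<Otimes>\<^sub>M borel) g"
  proof (rule pair_measure_distr[symmetric])
    show "(\<lambda>y. y) \<in> distr M path_space Y \<rightarrow>\<^sub>M path_space" by simp
    show "g \<in> distr M path_space Z \<rightarrow>\<^sub>M borel \<Otimes>\<^sub>M borel" using g by (simp only: measurable_distr_eq1)
    have "g \<in> distr M path_space Z \<rightarrow>\<^sub>M borel \<Otimes>\<^sub>M borel" using g by (simp only: measurable_distr_eq1)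
    then show "sigma_finite_measure (distr (distr M path_space Z) (borel \<Otimes>\<^sub>M borel) g)"
      using prob_space.prob_space_distr[OF prob_space_distr[OF Zm]]
      by (blast intro: prob_space_imp_sigma_finite)
  qed
  also have "distr (distr M path_space Y) path_space (\<lambda>y. y) = distr M path_space Y"
    using Ym by (subst distr_distr) (auto simp: comp_def)
  also have "distr (distr M path_space Z) (borel \<Otimes>\<^sub>M borel) g = distr M (borel \<Otimes>\<^sub>M borel) (\<lambda>\<omega>. g (Z \<omega>))"
    using distr_distr[OF g Zm] by (simp add: comp_def)
  also have "distr M (borel \<Otimes>\<^sub>M borel) (\<lambda>\<omega>. g (Z \<omega>)) = distr M (borel \<Otimes>\<^sub>M borel) (\<lambda>\<omega>. (first_jump N \<omega>, U 1 \<omega>))"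
    by (rule distr_cong_AE[OF refl refl gZ])
      (intro measurable_Pair U1 first_jump_measurable measurable_compose[OF Zm g])+
  finally show "distr M (path_space \<Otimes>\<^sub>M (borel \<Otimes>\<^sub>M borel)) (\<lambda>\<omega>. (Y \<omega>, first_jump N \<omega>, U 1 \<omega>)) =
    distr M path_space Y \<Otimes>\<^sub>M (?E \<Otimes>\<^sub>M F)" unfolding \<zeta>U .
qed

section \<open>Renewal equations for translated kernels\<close>

lemma measure_of_eq_measure:
  assumes "sets B = sets borel" "\<And>A. A \<in> sets borel \<Longrightarrow> \<mu> A = emeasure B A"
  shows "measure_of UNIV (sets (borel :: 'a::topological_space measure)) \<mu> = B"
proof -
  have "space B = UNIV" using sets_eq_imp_space_eq[OF assms(1)] by simp
  then have "measure_of UNIV (sets borel) (emeasure B) = B"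
    using measure_of_of_measure[of B] assms(1) by simp
  moreover have "measure_of UNIV (sets borel) \<mu> = measure_of UNIV (sets borel) (emeasure B)"
    by (rule measure_of_eq) (use assms(2) sets.sigma_sets_eq[of "borel :: 'a measure"] in auto)
  ultimately show ?thesis by simp
qed

lemma suminf_finite_imp_tendsto_0:
  fixes a :: "nat \<Rightarrow> ennreal"
  assumes "(\<Sum>n. a n) < \<infinity>"
  shows "a \<longlonglongrightarrow> 0"
proof -
  have "a n < \<infinity>" for n
    using sum_le_suminf[of a "{n}"] assms by (auto intro: le_less_trans)
  then have a: "a n = ennreal (enn2real (a n))" for n by (simp add: less_top)
  have "summable (\<lambda>n. enn2real (a n))"
    by (rule summable_suminf_not_top) (use assms a in \<open>auto simp: less_top\<close>)
  then have "(\<lambda>n. enn2real (a n)) \<longlonglongrightarrow> 0" by (rule summable_LIMSEQ_zero)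
  then have "(\<lambda>n. ennreal (enn2real (a n))) \<longlonglongrightarrow> ennreal 0" by (rule tendsto_ennrealI)
  then show ?thesis using a by simp
qed

locale translation_kernel =
  fixes G :: "'a::euclidean_space \<Rightarrow> 'a measure"
  assumes G: "G \<in> borel \<rightarrow>\<^sub>M subprob_algebra borel"
begin

text \<open>The law of the next partial sum when the current one is \<open>y\<close>. The powers of
  \<open>G\<close> are iterated mixtures of this kernel.\<close>

definition moved :: "'a \<Rightarrow> 'a \<Rightarrow> 'a measure" where
  "moved x y = distr (G (x - y)) borel (\<lambda>z. z + y)"

lemma sets_G: "sets (G x) = sets borel"
  using G by (auto dest!: measurable_space[where x=x] simp: space_subprob_algebra)

lemma measurable_G: "measurable (G x) L = measurable borel L"
  by (rule measurable_cong_sets[OF sets_G refl])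

lemma moved_measurable: "(\<lambda>(x, y). moved x y) \<in> borel \<Otimes>\<^sub>M borel \<rightarrow>\<^sub>M subprob_algebra borel"
  unfolding moved_def case_prod_beta
  by (rule measurable_distr2[where M=borel]) (use G in measurable)

lemma moved_measurable': "moved x \<in> borel \<rightarrow>\<^sub>M subprob_algebra borel"
  using measurable_compose[OF measurable_Pair1' moved_measurable, of x] by simp

lemma nn_integral_moved:
  assumes "f \<in> borel_measurable borel"
  shows "(\<integral>\<^sup>+z. f z \<partial>moved x y) = (\<integral>\<^sup>+z. f (z + y) \<partial>G (x - y))"
  unfolding moved_def by (rule nn_integral_distr) (use assms in \<open>auto simp: measurable_G\<close>)

lemma kernel_power_Suc_bind:
  assumes "kernel_power G n x \<in> space (subprob_algebra borel)"
  shows "kernel_power G (Suc n) x = kernel_power G n x \<bind> moved x"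
proof -
  have sets_n: "sets (kernel_power G n x) = sets borel" using assms by (simp add: space_subprob_algebra)
  have ne: "space (kernel_power G n x) \<noteq> {}" using sets_eq_imp_space_eq[OF sets_n] by simp
  have m: "moved x \<in> kernel_power G n x \<rightarrow>\<^sub>M subprob_algebra borel"
    using moved_measurable' by (simp only: measurable_cong_sets[OF sets_n refl])
  show ?thesis unfolding kernel_power.simps
  proof (rule measure_of_eq_measure)
    show "sets (kernel_power G n x \<bind> moved x) = sets borel"
      by (rule sets_bind[OF _ ne]) (simp add: moved_def)
    fix A :: "'a set" assume A: "A \<in> sets borel"
    have "(\<lambda>z. z - y) ` A = (\<lambda>z. z + y) -` A" for y :: 'a
      by (force simp: image_iff)
    then have "emeasure (G (x - y)) ((\<lambda>z. z - y) ` A) = emeasure (moved x y) A" for y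
      unfolding moved_def using A sets_eq_imp_space_eq[OF sets_G[of "x - y"]]
      by (subst emeasure_distr) (auto simp: measurable_G)
    then show "(\<integral>\<^sup>+y. emeasure (G (x - y)) ((\<lambda>z. z - y) ` A) \<partial>kernel_power G n x) =
       emeasure (kernel_power G n x \<bind> moved x) A"
      by (simp add: emeasure_bind[OF ne m A])
  qed
qed

lemma kernel_power_subprob: "kernel_power G n x \<in> space (subprob_algebra borel)"
proof (induction n)
  case 0
  show ?case by (simp add: space_subprob_algebra subprob_space_return)
next
  case (Suc n)
  have s: "sets (kernel_power G n x) = sets borel" using Suc by (simp add: space_subprob_algebra)
  have "moved x \<in> kernel_power G n x \<rightarrow>\<^sub>M subprob_algebra borel"
    using moved_measurable' by (simp only: measurable_cong_sets[OF s refl])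
  then have "subprob_space (kernel_power G n x \<bind> moved x)"
    using Suc by (intro subprob_space_bind) (auto simp: space_subprob_algebra)
  moreover have "sets (kernel_power G n x \<bind> moved x) = sets borel"
    using sets_eq_imp_space_eq[OF s] by (intro sets_bind) (auto simp: moved_def)
  ultimately show ?case
    unfolding kernel_power_Suc_bind[OF Suc] by (simp add: space_subprob_algebra)
qed

lemma sets_kernel_power: "sets (kernel_power G n x) = sets borel"
  using kernel_power_subprob by (simp add: space_subprob_algebra)

lemma measurable_kernel_power: "measurable (kernel_power G n x) L = measurable borel L"
  by (rule measurable_cong_sets[OF sets_kernel_power refl])

lemma nn_integral_kernel_power_Suc:
  assumes f: "f \<in> borel_measurable borel"
  shows "(\<integral>\<^sup>+y. f y \<partial>kernel_power G (Suc n) x) = (\<integral>\<^sup>+y. \<integral>\<^sup>+z. f (z + y) \<partial>G (x - y) \<partial>kernel_power G n x)"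
proof -
  have "moved x \<in> kernel_power G n x \<rightarrow>\<^sub>M subprob_algebra borel"
    using moved_measurable' by (simp only: measurable_kernel_power)
  then show ?thesis
    unfolding kernel_power_Suc_bind[OF kernel_power_subprob]
    by (simp add: nn_integral_bind[OF f] nn_integral_moved[OF f])
qed

lemma kernel_power_sum:
  shows sets_kernel_power_sum: "sets (kernel_power_sum G x) = sets borel"
    and emeasure_kernel_power_sum: "A \<in> sets borel \<Longrightarrow> emeasure (kernel_power_sum G x) A = (\<Sum>n. emeasure (kernel_power G n x) A)"
proof -
  show "sets (kernel_power_sum G x) = sets borel"
    using sets.sets_measure_of_eq[of "borel :: 'a measure"] by (simp add: kernel_power_sum_def)
  assume A: "A \<in> sets borel"
  show "emeasure (kernel_power_sum G x) A = (\<Sum>n. emeasure (kernel_power G n x) A)"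
    unfolding kernel_power_sum_def
  proof (rule emeasure_measure_of_sigma)
    show "sigma_algebra UNIV (sets (borel :: 'a measure))"
      using sets.sigma_algebra_axioms[of "borel :: 'a measure"] by simp
    show "positive (sets borel) (\<lambda>A. \<Sum>n. emeasure (kernel_power G n x) A)"
      by (simp add: positive_def)
    show "countably_additive (sets borel) (\<lambda>A. \<Sum>n. emeasure (kernel_power G n x) A)"
    proof (rule countably_additiveI)
      fix B :: "nat \<Rightarrow> 'a set" assume B: "range B \<subseteq> sets borel" "disjoint_family B"
      have "(\<Sum>i. \<Sum>n. emeasure (kernel_power G n x) (B i)) = (\<Sum>n. \<Sum>i. emeasure (kernel_power G n x) (B i))"
        using nn_integral_suminf[of "\<lambda>i n. emeasure (kernel_power G n x) (B i)" "count_space (UNIV :: nat set)"]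
        by (simp add: nn_integral_count_space_nat)
      also have "\<dots> = (\<Sum>n. emeasure (kernel_power G n x) (\<Union>i. B i))"
        using B by (intro suminf_cong suminf_emeasure) (auto simp: sets_kernel_power)
      finally show "(\<Sum>i. \<Sum>n. emeasure (kernel_power G n x) (B i)) = (\<Sum>n. emeasure (kernel_power G n x) (\<Union>i. B i))" .
    qed
  qed (rule A)
qed

text \<open>Induction over the integrand; a countable sum commutes with all the operations, in particular with
  suprema of increasing sequences.\<close>

lemma nn_integral_kernel_power_sum:
  assumes "f \<in> borel_measurable borel"
  shows "(\<integral>\<^sup>+y. f y \<partial>kernel_power_sum G x) = (\<Sum>n. \<integral>\<^sup>+y. f y \<partial>kernel_power G n x)"
  using assms
proof (induction rule: borel_measurable_induct)
  case (cong f g)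
  then have "f = g" by auto
  then show ?case using cong by simp
next
  case (set A)
  then show ?case by (simp add: sets_kernel_power sets_kernel_power_sum emeasure_kernel_power_sum)
next
  case (mult u c)
  then show ?case
    by (simp add: nn_integral_cmult measurable_kernel_power measurable_cong_sets[OF sets_kernel_power_sum refl])
next
  case (add u v)
  then show ?case
    by (simp add: nn_integral_add measurable_kernel_power measurable_cong_sets[OF sets_kernel_power_sum refl] suminf_add[symmetric])
next
  case (seq V)
  have "(\<integral>\<^sup>+y. (SUP i. V i) y \<partial>kernel_power_sum G x) = (SUP i. \<integral>\<^sup>+y. V i y \<partial>kernel_power_sum G x)"
    using seq unfolding SUP_apply
    by (intro nn_integral_monotone_convergence_SUP) (simp_all add: measurable_cong_sets[OF sets_kernel_power_sum refl])
  also have "\<dots> = (SUP i. \<Sum>n. \<integral>\<^sup>+y. V i y \<partial>kernel_power G n x)" using seq by simp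
  also have "\<dots> = (\<Sum>n. SUP i. \<integral>\<^sup>+y. V i y \<partial>kernel_power G n x)"
    using seq by (intro ennreal_suminf_SUP_eq[symmetric]) (auto simp: incseq_def le_fun_def intro!: nn_integral_mono)
  also have "\<dots> = (\<Sum>n. \<integral>\<^sup>+y. (SUP i. V i) y \<partial>kernel_power G n x)"
    using seq unfolding SUP_apply
    by (intro suminf_cong nn_integral_monotone_convergence_SUP[symmetric]) (simp_all add: measurable_kernel_power)
  finally show ?case .
qed

lemma renewal_iterate:
  assumes u: "u \<in> borel_measurable borel" and h: "h \<in> borel_measurable borel"
    and renewal: "\<And>x. u x = h x + (\<integral>\<^sup>+z. u (x - z) \<partial>G x)"
  shows "u x = (\<Sum>n<m. \<integral>\<^sup>+y. h (x - y) \<partial>kernel_power G n x) + (\<integral>\<^sup>+y. u (x - y) \<partial>kernel_power G m x)"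
proof (induction m)
  case 0
  have "(\<lambda>y. u (x - y)) \<in> borel_measurable borel" using u by measurable
  then show ?case by (simp add: nn_integral_return)
next
  case (Suc m)
  have ux: "(\<lambda>y. u (x - y)) \<in> borel_measurable borel" for x using u by measurable
  have hx: "(\<lambda>y. h (x - y)) \<in> borel_measurable borel" using h by measurable
  have "(\<lambda>(y, z). u (x - y - z)) \<in> borel_measurable (borel \<Otimes>\<^sub>M borel)" using u by measurable
  moreover have "(\<lambda>y. G (x - y)) \<in> borel \<rightarrow>\<^sub>M subprob_algebra borel" using G by measurable
  ultimately have inner: "(\<lambda>y. \<integral>\<^sup>+z. u (x - y - z) \<partial>G (x - y)) \<in> borel_measurable borel"
    by (rule nn_integral_measurable_subprob_algebra2)
  have "(\<integral>\<^sup>+y. u (x - y) \<partial>kernel_power G m x) =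
      (\<integral>\<^sup>+y. h (x - y) + (\<integral>\<^sup>+z. u (x - y - z) \<partial>G (x - y)) \<partial>kernel_power G m x)"
    by (subst renewal) simp
  also have "\<dots> = (\<integral>\<^sup>+y. h (x - y) \<partial>kernel_power G m x) + (\<integral>\<^sup>+y. \<integral>\<^sup>+z. u (x - y - z) \<partial>G (x - y) \<partial>kernel_power G m x)"
    by (rule nn_integral_add) (simp_all only: measurable_kernel_power hx inner)
  also have "(\<integral>\<^sup>+y. \<integral>\<^sup>+z. u (x - y - z) \<partial>G (x - y) \<partial>kernel_power G m x) = (\<integral>\<^sup>+y. u (x - y) \<partial>kernel_power G (Suc m) x)"
    by (subst nn_integral_kernel_power_Suc[OF ux]) (simp add: algebra_simps)
  finally show ?case using Suc.IH by (simp add: add.assoc)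
qed

text \<open>The \<open>n\<close>-th term of the iterated equation for \<open>g\<close> is \<open>c\<close>
  times the mass of the power of order \<open>n + 1\<close>. These terms have a sum of at most \<open>g
  x\<close>, so they tend to \<open>0\<close>.\<close>

lemma kernel_power_mass_tendsto_0:
  assumes g: "g \<in> borel_measurable borel" "\<And>x. g x < \<infinity>"
    and renewal: "\<And>x. g x = c * emeasure (G x) UNIV + (\<integral>\<^sup>+z. g (x - z) \<partial>G x)" and c: "0 < c" "c < \<infinity>"
  shows "(\<lambda>n. emeasure (kernel_power G n x) UNIV) \<longlonglongrightarrow> 0"
proof -
  have mass: "(\<lambda>x. emeasure (G x) UNIV) \<in> borel_measurable borel"
    using measurable_emeasure_kernel[OF G, of UNIV] by simp
  have massx: "(\<lambda>y. emeasure (G (x - y)) UNIV) \<in> borel_measurable borel"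
    by (rule measurable_compose[OF _ mass]) simp
  have iterate: "(\<integral>\<^sup>+y. c * emeasure (G (x - y)) UNIV \<partial>kernel_power G n x) = c * emeasure (kernel_power G (Suc n) x) UNIV" for n
  proof -
    have "emeasure (kernel_power G (Suc n) x) UNIV = (\<integral>\<^sup>+y. 1 \<partial>kernel_power G (Suc n) x)"
      using sets_eq_imp_space_eq[OF sets_kernel_power[of "Suc n" x]] by simp
    also have "\<dots> = (\<integral>\<^sup>+y. emeasure (G (x - y)) UNIV \<partial>kernel_power G n x)"
      using sets_eq_imp_space_eq[OF sets_G] by (subst nn_integral_kernel_power_Suc) simp_all
    finally show ?thesis
      using massx by (simp add: nn_integral_cmult measurable_kernel_power)
  qed
  have "(\<Sum>n<m. c * emeasure (kernel_power G (Suc n) x) UNIV) \<le> g x" for m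
  proof -
    have "(\<lambda>x. c * emeasure (G x) UNIV) \<in> borel_measurable borel" using mass by measurable
    from renewal_iterate[OF g(1) this renewal, of x m] show ?thesis
      unfolding iterate by (metis le_iff_add)
  qed
  then have "(\<Sum>n. c * emeasure (kernel_power G (Suc n) x) UNIV) \<le> g x"
    by (intro suminf_le_const) auto
  then have "c * (\<Sum>n. emeasure (kernel_power G (Suc n) x) UNIV) < \<infinity>"
    using g(2)[of x] by (simp add: ennreal_suminf_cmult le_less_trans)
  then have "(\<Sum>n. emeasure (kernel_power G (Suc n) x) UNIV) < \<infinity>"
    using c by (auto simp: ennreal_mult_less_top)
  then have "(\<lambda>n. emeasure (kernel_power G (Suc n) x) UNIV) \<longlonglongrightarrow> 0"
    by (rule suminf_finite_imp_tendsto_0)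
  then show ?thesis by (rule LIMSEQ_imp_Suc)
qed

text \<open>The remainder of the iterated equation is at most \<open>C\<close> times the mass of the
  \<open>m\<close>-th power.\<close>

theorem renewal_representation:
  assumes u: "u \<in> borel_measurable borel" "\<And>x. u x \<le> C" "C < \<infinity>" and h: "h \<in> borel_measurable borel"
    and renewal: "\<And>x. u x = h x + (\<integral>\<^sup>+z. u (x - z) \<partial>G x)"
    and mass: "\<And>x. (\<lambda>n. emeasure (kernel_power G n x) UNIV) \<longlonglongrightarrow> 0"
  shows "u x = (\<integral>\<^sup>+y. h (x - y) \<partial>kernel_power_sum G x)"
proof -
  have "(\<integral>\<^sup>+y. u (x - y) \<partial>kernel_power G m x) \<le> C * emeasure (kernel_power G m x) UNIV" for m
  proof -
    have "(\<integral>\<^sup>+y. u (x - y) \<partial>kernel_power G m x) \<le> (\<integral>\<^sup>+y. C \<partial>kernel_power G m x)"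
      by (intro nn_integral_mono u(2))
    also have "\<dots> = C * emeasure (kernel_power G m x) UNIV"
      using sets_eq_imp_space_eq[OF sets_kernel_power[of m x]] by simp
    finally show ?thesis .
  qed
  note bound = this
  have "C < top" using u(3) by simp
  from ennreal_tendsto_cmult[OF this mass[of x]]
  have upper: "(\<lambda>m. C * emeasure (kernel_power G m x) UNIV) \<longlonglongrightarrow> 0"
    unfolding mult_zero_right .
  have rest: "(\<lambda>m. \<integral>\<^sup>+y. u (x - y) \<partial>kernel_power G m x) \<longlonglongrightarrow> 0"
    by (rule tendsto_sandwich[OF always_eventually always_eventually tendsto_const upper])
      (intro allI zero_le bound)+
  have "(\<lambda>m. \<Sum>n<m. \<integral>\<^sup>+y. h (x - y) \<partial>kernel_power G n x) \<longlonglongrightarrow> (\<Sum>n. \<integral>\<^sup>+y. h (x - y) \<partial>kernel_power G n x)"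
    by (rule summable_LIMSEQ) simp
  from tendsto_add[OF this rest] have "(\<lambda>m. u x) \<longlonglongrightarrow> (\<Sum>n. \<integral>\<^sup>+y. h (x - y) \<partial>kernel_power G n x)"
    unfolding renewal_iterate[OF u(1) h renewal, of x, symmetric] add_0_right .
  then have "u x = (\<Sum>n. \<integral>\<^sup>+y. h (x - y) \<partial>kernel_power G n x)"
    unfolding LIMSEQ_const_iff .
  moreover have "(\<lambda>y. h (x - y)) \<in> borel_measurable borel" using h by measurable
  ultimately show ?thesis by (simp add: nn_integral_kernel_power_sum)
qed

end

section \<open>Occupation integrals\<close>

text \<open>The argument \<open>c\<close> is the killing time. Replacing \<open>s\<close> by \<open>max 0
  s\<close> makes the integrand measurable on the whole real line, also for paths that are arbitrary at
  negative times.\<close>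

definition occupation :: "('a \<Rightarrow> ennreal) \<Rightarrow> ennreal \<Rightarrow> (real \<Rightarrow> 'a) \<Rightarrow> ennreal" where
  "occupation f c w = (\<integral>\<^sup>+s. f (w (max 0 s)) * indicator {s. 0 \<le> s \<and> ennreal s < c} s \<partial>lborel)"

lemma measurable_occupation_integrand:
  fixes f :: "'a::metric_space \<Rightarrow> ennreal" and W :: "'w \<Rightarrow> real \<Rightarrow> 'a"
  assumes f: "f \<in> borel_measurable borel" and W: "W \<in> A \<rightarrow>\<^sub>M path_space" and c: "c \<in> borel_measurable A"
  shows "(\<lambda>(x, s). f (W x (max 0 s)) * indicator {s. 0 \<le> s \<and> ennreal s < c x} s) \<in> borel_measurable (A \<Otimes>\<^sub>M lborel)"
proof -
  note [measurable] = c
  have 1: "(\<lambda>p. f (W (fst p) (max 0 (snd p)))) \<in> borel_measurable (A \<Otimes>\<^sub>M borel)"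
    by (rule measurable_compose[OF measurable_eval_max[OF measurable_compose[OF measurable_fst W] measurable_snd] f])
  have 2: "(\<lambda>p. if 0 \<le> snd p \<and> ennreal (snd p) < c (fst p) then 1 else 0 :: ennreal)
      \<in> borel_measurable (A \<Otimes>\<^sub>M borel)"
    by measurable
  have "(\<lambda>p. f (W (fst p) (max 0 (snd p))) * (if 0 \<le> snd p \<and> ennreal (snd p) < c (fst p) then 1 else 0))
      \<in> borel_measurable (A \<Otimes>\<^sub>M borel)"
    using 1 2 by measurable
  moreover have "(\<lambda>(x, s). f (W x (max 0 s)) * indicator {s. 0 \<le> s \<and> ennreal s < c x} s) =
     (\<lambda>p. f (W (fst p) (max 0 (snd p))) * (if 0 \<le> snd p \<and> ennreal (snd p) < c (fst p) then 1 else 0))"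
    by (auto simp: fun_eq_iff indicator_def)
  ultimately show ?thesis
    by (simp only: measurable_cong_sets[OF sets_pair_measure_cong[OF refl sets_lborel] refl])
qed

lemma measurable_occupation:
  fixes W :: "'w \<Rightarrow> real \<Rightarrow> 'a::metric_space"
  assumes "f \<in> borel_measurable borel" "W \<in> A \<rightarrow>\<^sub>M path_space" "c \<in> borel_measurable A"
  shows "(\<lambda>x. occupation f (c x) (W x)) \<in> borel_measurable A"
  unfolding occupation_def
  by (rule lborel.borel_measurable_nn_integral[OF measurable_occupation_integrand[OF assms]])

lemma occupation_0: "occupation f 0 w = 0"
  by (simp add: occupation_def)

lemma occupation_one: "occupation (\<lambda>_. 1) c w = c"
proof (cases c)
  case (real r)
  then have "{s. 0 \<le> s \<and> ennreal s < c} = {0..<r}" by (auto simp: ennreal_less_iff)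
  then show ?thesis using real by (simp add: occupation_def)
next
  case top
  then have "{s. 0 \<le> s \<and> ennreal s < c} = {0..}" by auto
  moreover have "emeasure lborel {0::real..} = \<infinity>"
  proof (cases "emeasure lborel {0::real..}")
    case (real r)
    have "ennreal (r + 1) = emeasure lborel {0..r + 1}" using real by simp
    also have "\<dots> \<le> emeasure lborel {0::real..}" by (rule emeasure_mono) auto
    finally show ?thesis using real by (simp add: ennreal_le_iff)
  qed simp
  ultimately show ?thesis using top by (simp add: occupation_def)
qed

lemma occupation_split:
  fixes w :: "real \<Rightarrow> 'a::metric_space"
  assumes f: "f \<in> borel_measurable borel" and w: "cadlag w" and c: "0 \<le> c"
  shows "occupation f (ennreal c + c') w = occupation f (ennreal c) w + occupation f c' (path_shift c w)"
proof -
  have w': "(\<lambda>_. w) \<in> borel \<rightarrow>\<^sub>M (path_space :: (real \<Rightarrow> 'a) measure)"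
    using w by (intro measurable_const) (simp add: space_path_algebra)
  have [measurable]: "(\<lambda>s. f (w (max 0 s))) \<in> borel_measurable (borel :: real measure)"
    by (rule measurable_compose[OF measurable_eval_max[OF w'] f]) simp
  have "occupation f (ennreal c + c') w =
     (\<integral>\<^sup>+s. f (w (max 0 s)) * indicator {s. 0 \<le> s \<and> ennreal s < ennreal c} s +
        f (w (max 0 s)) * indicator {s. c \<le> s \<and> ennreal s < ennreal c + c'} s \<partial>lborel)"
    unfolding occupation_def
  proof (rule nn_integral_cong)
    fix s
    have "indicator {s. 0 \<le> s \<and> ennreal s < ennreal c + c'} s =
      (indicator {s. 0 \<le> s \<and> ennreal s < ennreal c} s + indicator {s. c \<le> s \<and> ennreal s < ennreal c + c'} s :: ennreal)"
    proof (cases "c \<le> s")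
      case True
      then have "0 \<le> s" "\<not> ennreal s < ennreal c" using c by (simp_all add: not_less ennreal_leI)
      then show ?thesis using True by (simp add: indicator_def)
    next
      case False
      have "ennreal s < ennreal c" if "0 \<le> s" using that False by (simp add: ennreal_less_iff)
      moreover have "ennreal s < ennreal c + c'" if "ennreal s < ennreal c"
        using that by (rule less_le_trans) simp
      ultimately show ?thesis using False by (auto simp only: indicator_def mem_Collect_eq) simp_all
    qed
    then show "f (w (max 0 s)) * indicator {s. 0 \<le> s \<and> ennreal s < ennreal c + c'} s =
      f (w (max 0 s)) * indicator {s. 0 \<le> s \<and> ennreal s < ennreal c} s +
        f (w (max 0 s)) * indicator {s. c \<le> s \<and> ennreal s < ennreal c + c'} s"
      by (simp add: distrib_left)
  qed
  also have "\<dots> = occupation f (ennreal c) w +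
      (\<integral>\<^sup>+s. f (w (max 0 s)) * indicator {s. c \<le> s \<and> ennreal s < ennreal c + c'} s \<partial>lborel)"
    unfolding occupation_def by (rule nn_integral_add) simp_all
  also have "(\<integral>\<^sup>+s. f (w (max 0 s)) * indicator {s. c \<le> s \<and> ennreal s < ennreal c + c'} s \<partial>lborel) =
      (\<integral>\<^sup>+s. f (w (max 0 (c + s))) * indicator {s. c \<le> s \<and> ennreal s < ennreal c + c'} (c + s) \<partial>lborel)"
    by (subst nn_integral_real_affine[where c=1 and t=c]) simp_all
  also have "\<dots> = occupation f c' (path_shift c w)"
    unfolding occupation_def
  proof (rule nn_integral_cong)
    fix s :: real
    show "f (w (max 0 (c + s))) * indicator {s. c \<le> s \<and> ennreal s < ennreal c + c'} (c + s) =
      f (path_shift c w (max 0 s)) * indicator {s. 0 \<le> s \<and> ennreal s < c'} s"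
      using c by (cases "0 \<le> s") (auto simp: indicator_def path_shift_def max_def ennreal_plus ennreal_add_left_cancel_less)
  qed
  finally show ?thesis .
qed

text \<open>For an exponential time \<open>r\<close>, the mean of \<open>min r c\<close> is the integral of
  the tail \<open>exp (- s * rate)\<close> over \<open>s < c\<close>, and the tail is \<open>1 / rate\<close>
  times the density.\<close>

lemma exponential_truncated_mean:
  assumes rate: "0 < rate"
  shows "(\<integral>\<^sup>+r. min (ennreal r) c \<partial>density lborel (exponential_density rate)) =
     ennreal (1 / rate) * emeasure (density lborel (exponential_density rate)) {r. ennreal r < c}"
proof -
  let ?E = "density lborel (exponential_density rate)"
  interpret E: prob_space ?E by (rule prob_space_exponential_density[OF rate])
  interpret L: pair_sigma_finite ?E lborel ..
  have D: "distributed ?E lborel (\<lambda>x. x) (exponential_density rate)"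
    by (simp add: distributed_def distr_id2)
  have tail: "emeasure ?E {r. s < r} = ennreal (exp (- s * rate))" if "0 \<le> s" for s
    using E.exponential_distributedD_gt[OF D that rate] by (simp add: E.emeasure_eq_measure)
  have "(\<integral>\<^sup>+r. min (ennreal r) c \<partial>?E) = (\<integral>\<^sup>+r. \<integral>\<^sup>+s. indicator {s. 0 \<le> s \<and> ennreal s < min (ennreal r) c} s \<partial>lborel \<partial>?E)"
    using occupation_one[of "min (ennreal r) c" "\<lambda>_. ()" for r] by (simp add: occupation_def)
  also have "\<dots> = (\<integral>\<^sup>+s. \<integral>\<^sup>+r. indicator {s. 0 \<le> s \<and> ennreal s < min (ennreal r) c} s \<partial>?E \<partial>lborel)"
  proof (rule L.Fubini'[symmetric])
    have "(\<lambda>p. if 0 \<le> snd p \<and> ennreal (snd p) < min (ennreal (fst p)) c then 1 else 0 :: ennreal) \<in> borel_measurable (borel \<Otimes>\<^sub>M borel)"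
      by measurable
    moreover have sets_eq: "sets (?E \<Otimes>\<^sub>M lborel) = sets (borel \<Otimes>\<^sub>M borel)" by (rule sets_pair_measure_cong) simp_all
    moreover have "(\<lambda>(r, s). indicator {s. 0 \<le> s \<and> ennreal s < min (ennreal r) c} s) =
        (\<lambda>p. if 0 \<le> snd p \<and> ennreal (snd p) < min (ennreal (fst p)) c then 1 else 0 :: ennreal)"
      by (auto simp: fun_eq_iff indicator_def)
    ultimately show "(\<lambda>(r, s). indicator {s. 0 \<le> s \<and> ennreal s < min (ennreal r) c} s :: ennreal) \<in> borel_measurable (?E \<Otimes>\<^sub>M lborel)"
      by (simp only: measurable_cong_sets[OF sets_eq refl])
  qed
  also have "\<dots> = (\<integral>\<^sup>+s. ennreal (1 / rate) * (ennreal (exponential_density rate s) * indicator {r. ennreal r < c} s) \<partial>lborel)"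
  proof (rule nn_integral_cong)
    fix s :: real
    have "(\<integral>\<^sup>+r. indicator {s. 0 \<le> s \<and> ennreal s < min (ennreal r) c} s \<partial>?E) =
      (\<integral>\<^sup>+r. (indicator {s. 0 \<le> s} s * indicator {s. ennreal s < c} s) * indicator {r. s < r} r \<partial>?E)"
      by (rule nn_integral_cong) (auto simp: indicator_def ennreal_less_iff)
    also have "\<dots> = (indicator {s. 0 \<le> s} s * indicator {s. ennreal s < c} s) * emeasure ?E {r. s < r}"
      by (subst nn_integral_cmult) auto
    also have "\<dots> = ennreal (1 / rate) * (ennreal (exponential_density rate s) * indicator {r. ennreal r < c} s)"
      using rate tail[of s]
      by (auto simp: indicator_def exponential_density_def ennreal_mult[symmetric] mult.commute)
    finally show "(\<integral>\<^sup>+r. indicator {s. 0 \<le> s \<and> ennreal s < min (ennreal r) c} s \<partial>?E) =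
      ennreal (1 / rate) * (ennreal (exponential_density rate s) * indicator {r. ennreal r < c} s)" .
  qed
  also have "\<dots> = ennreal (1 / rate) * (\<integral>\<^sup>+s. ennreal (exponential_density rate s) * indicator {r. ennreal r < c} s \<partial>lborel)"
    by (rule nn_integral_cmult) simp
  also have "(\<integral>\<^sup>+s. ennreal (exponential_density rate s) * indicator {r. ennreal r < c} s \<partial>lborel) = emeasure ?E {r. ennreal r < c}"
    by (rule emeasure_density[symmetric]) simp_all
  finally show ?thesis .
qed

section \<open>Renewal of the killed process at its first large jump\<close>

text \<open>If the first large jump itself kills \<open>X\<close>, the path of \<open>Y\<close> usually
  survives that time and the kernel lets the process continue. The role of \<open>T_jump\<close> is to make
  this continuation worthless.\<close>

locale killed_jump_process =
  fixes M :: "'w measure"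
    and P :: "'a::euclidean_space \<Rightarrow> 'w measure"
    and X Y Z :: "'w \<Rightarrow> real \<Rightarrow> 'a"
    and N :: "'w \<Rightarrow> real \<Rightarrow> nat"
    and U :: "nat \<Rightarrow> 'w \<Rightarrow> 'a"
    and F :: "'a measure"
    and T :: "(real \<Rightarrow> 'a) \<Rightarrow> ennreal"
    and \<delta> rate :: real
    and Q :: "(real \<Rightarrow> 'a) measure set"
  defines "Q \<equiv> range (path_law P X) \<union> range (path_law P Y)"
  assumes P: "\<And>x. prob_space (P x)" "\<And>x. sets (P x) = sets M"
    and X: "X \<in> measurable M path_space" "strong_markov (natural_filtration Q) (path_law P X)"
    and Y: "Y \<in> measurable M path_space" "strong_markov (natural_filtration Q) (path_law P Y)"
    and decomposition: "\<And>\<omega> t. \<omega> \<in> space M \<Longrightarrow> 0 \<le> t \<Longrightarrow> X \<omega> t = Y \<omega> t - Z \<omega> t"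
    and pos: "0 < \<delta>" "0 < rate"
    and small_jumps: "\<And>x. AE \<omega> in P x. \<forall>t>0. norm (Y \<omega> t - Lim (at_left t) (Y \<omega>)) < \<delta>"
    and Z: "\<And>x. compound_poisson_process (P x) rate F N U Z"
    and F: "AE v in F. \<delta> \<le> norm v"
    and indep: "\<And>x. prob_space.indep_var (P x) path_space Y path_space Z"
    and T: "terminal_time (natural_filtration Q) (path_law P X) T"
    and T_jump: "\<And>x. AE \<omega> in P x. T (X \<omega>) = ennreal (first_jump N \<omega>) \<longrightarrow> T (path_shift (first_jump N \<omega>) (X \<omega>)) = 0"
begin

abbreviation "\<zeta> \<equiv> first_jump N"
abbreviation "S \<equiv> first_big_jump \<delta> :: (real \<Rightarrow> 'a) \<Rightarrow> ennreal"

lemma space_P: "space (P x) = space M"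
  using P(2) by (rule sets_eq_imp_space_eq)

lemma measurable_P: "measurable (P x) L = measurable M L"
  by (rule measurable_cong_sets[OF P(2) refl])

lemma X_cadlag: "\<omega> \<in> space M \<Longrightarrow> cadlag (X \<omega>)"
  and Y_cadlag: "\<omega> \<in> space M \<Longrightarrow> cadlag (Y \<omega>)"
  using measurable_space[OF X(1)] measurable_space[OF Y(1)] by (auto simp: space_path_algebra)

lemma prob_path_law: "prob_space (path_law P X x)" "prob_space (path_law P Y x)"
  unfolding path_law_def
  by (rule prob_space.prob_space_distr[OF P(1)]; simp only: measurable_P X(1) Y(1))+

lemma sets_path_law: "sets (path_law P W x) = sets path_space"
  by (simp add: path_law_def)

lemma measurable_path_law: "measurable (path_law P W x) L = measurable path_space L"
  by (rule measurable_cong_sets[OF sets_path_law refl])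

lemma sets_Q: "q \<in> Q \<Longrightarrow> sets q = sets path_space"
  by (auto simp: Q_def sets_path_law)

lemma AE_path_law:
  assumes "W \<in> measurable M path_space" "AE w in path_law P W x. \<phi> w"
  shows "AE \<omega> in P x. \<phi> (W \<omega>)"
  by (rule AE_distrD[OF _ assms(2)[unfolded path_law_def]]) (simp only: measurable_P assms(1))

lemma AE_avoid_null:
  assumes "T_null \<in> sets path_space" "\<forall>q\<in>Q. emeasure q T_null = 0"
  shows "AE \<omega> in P x. X \<omega> \<notin> T_null \<and> Y \<omega> \<notin> T_null"
proof -
  have "T_null \<in> null_sets (path_law P X x)" "T_null \<in> null_sets (path_law P Y x)"
    using assms by (auto simp: null_sets_def sets_path_law Q_def)
  from AE_path_law[OF X(1) AE_not_in[OF this(1)]] AE_path_law[OF Y(1) AE_not_in[OF this(2)]] show ?thesis by eventually_elim simp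
qed

lemma T_stopping: "stopping_time (natural_filtration Q) T"
  using T by (simp add: terminal_time_def)

text \<open>The measurable version of \<open>T\<close> and the null set are chosen together, because one null
  set has to serve the laws of \<open>X\<close> and of \<open>Y\<close> for all starting points.\<close>

definition null_version :: "((real \<Rightarrow> 'a) \<Rightarrow> ennreal) \<times> (real \<Rightarrow> 'a) set" where
  "null_version = (SOME (T', T_null). T' \<in> borel_measurable path_space \<and> T_null \<in> sets path_space \<and>
     (\<forall>q\<in>Q. emeasure q T_null = 0) \<and> (\<forall>w. w \<notin> T_null \<longrightarrow> T w = T' w))"

definition "T_reg = fst null_version"
definition "T_null = snd null_version"

lemma T_reg: "T_reg \<in> borel_measurable path_space"
  and T_null: "T_null \<in> sets path_space" "\<forall>q\<in>Q. emeasure q T_null = 0"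
  and T_eq_T_reg: "w \<notin> T_null \<Longrightarrow> T w = T_reg w"
proof -
  obtain T' N' where *: "T' \<in> borel_measurable path_space" "N' \<in> sets path_space"
    "\<And>q. q \<in> Q \<Longrightarrow> emeasure q N' = 0" "\<And>w. w \<notin> N' \<Longrightarrow> T w = T' w"
    using stopping_time_measurable_version[OF sets_Q T_stopping] by blast
  have "case null_version of (T', N') \<Rightarrow> T' \<in> borel_measurable path_space \<and> N' \<in> sets path_space \<and>
     (\<forall>q\<in>Q. emeasure q N' = 0) \<and> (\<forall>w. w \<notin> N' \<longrightarrow> T w = T' w)"
    unfolding null_version_def by (rule someI[of _ "(T', N')"]) (use * in auto)
  then show "T_reg \<in> borel_measurable path_space" "T_null \<in> sets path_space" "\<forall>q\<in>Q. emeasure q T_null = 0"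
    "w \<notin> T_null \<Longrightarrow> T w = T_reg w"
    by (auto simp: T_reg_def T_null_def split: prod.splits)
qed

lemma AE_T_reg: "AE \<omega> in P x. T (X \<omega>) = T_reg (X \<omega>) \<and> T (Y \<omega>) = T_reg (Y \<omega>)"
  using AE_avoid_null[OF T_null, of x] by eventually_elim (simp add: T_eq_T_reg)

abbreviation "clock \<equiv> density lborel (exponential_density rate) :: real measure"

text \<open>The law of \<open>(Y, \<zeta>, U\<^sub>1)\<close> under \<open>P x\<close>, which depends on
  \<open>x\<close> only through the law of \<open>Y\<close>.\<close>

definition joint :: "'a \<Rightarrow> ((real \<Rightarrow> 'a) \<times> real \<times> 'a) measure" where
  "joint x = path_law P Y x \<Otimes>\<^sub>M (clock \<Otimes>\<^sub>M F)"

lemma F_nonzero: "AE v in F. v \<noteq> 0"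
  using F by eventually_elim (use pos in auto)

lemmas first_jump_law = prob_space.compound_poisson_first_jump_law[OF P(1) pos(2) Z F_nonzero indep]

lemma U1: "U 1 \<in> borel_measurable M"
  using first_jump_law(4) by (simp only: measurable_P)

lemma poisson_clock: "poisson_clock (P x) rate N"
  unfolding poisson_clock_def poisson_clock_axioms_def
  using P(1) pos(2) Z by (simp add: compound_poisson_process_def)

lemma \<zeta>_measurable: "\<zeta> \<in> borel_measurable M"
  using poisson_clock.first_jump_measurable[OF poisson_clock] by (simp only: measurable_P)

lemma prob_clock: "prob_space clock"
  by (rule prob_space_exponential_density[OF pos(2)])

lemma F_distr: "distr (P x) borel (U 1) = F"
  by (rule first_jump_law(5))

lemma prob_F: "prob_space F"
  using prob_space.prob_space_distr[OF P(1) first_jump_law(4)] unfolding F_distr .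

lemma sets_F: "sets F = sets borel"
  unfolding F_distr[of undefined, symmetric] by simp

lemma triple_measurable:
  "(\<lambda>\<omega>. (Y \<omega>, \<zeta> \<omega>, U 1 \<omega>)) \<in> P x \<rightarrow>\<^sub>M path_space \<Otimes>\<^sub>M (borel \<Otimes>\<^sub>M borel)"
  unfolding measurable_P by (intro measurable_Pair Y(1) \<zeta>_measurable U1)

lemma distr_triple: "distr (P x) (path_space \<Otimes>\<^sub>M (borel \<Otimes>\<^sub>M borel)) (\<lambda>\<omega>. (Y \<omega>, \<zeta> \<omega>, U 1 \<omega>)) = joint x"
  unfolding joint_def path_law_def by (rule first_jump_law(1))

lemma sets_joint: "sets (joint x) = sets (path_space \<Otimes>\<^sub>M (borel \<Otimes>\<^sub>M borel))"
  unfolding joint_def by (intro sets_pair_measure_cong sets_path_law) (simp_all add: sets_F)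

lemma measurable_joint: "measurable (joint x) L = measurable (path_space \<Otimes>\<^sub>M (borel \<Otimes>\<^sub>M borel)) L"
  by (rule measurable_cong_sets[OF sets_joint refl])

lemma nn_integral_joint:
  assumes "g \<in> borel_measurable (path_space \<Otimes>\<^sub>M (borel \<Otimes>\<^sub>M borel))"
  shows "(\<integral>\<^sup>+\<omega>. g (Y \<omega>, \<zeta> \<omega>, U 1 \<omega>) \<partial>P x) = (\<integral>\<^sup>+j. g j \<partial>joint x)"
  unfolding distr_triple[symmetric] by (rule nn_integral_distr[OF triple_measurable, symmetric]) (use assms in simp)

lemma nn_integral_joint_iterated:
  assumes g: "g \<in> borel_measurable (path_space \<Otimes>\<^sub>M (borel \<Otimes>\<^sub>M borel))"
  shows "(\<integral>\<^sup>+j. g j \<partial>joint x) = (\<integral>\<^sup>+w. \<integral>\<^sup>+r. \<integral>\<^sup>+v. g (w, r, v) \<partial>F \<partial>clock \<partial>path_law P Y x)"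
proof -
  interpret F: prob_space F by (rule prob_F)
  interpret E: prob_space clock by (rule prob_clock)
  interpret EF: pair_prob_space clock F ..
  have s: "sets (clock \<Otimes>\<^sub>M F) = sets (borel \<Otimes>\<^sub>M borel)" by (intro sets_pair_measure_cong) (simp_all add: sets_F)
  have "(\<integral>\<^sup>+j. g j \<partial>joint x) = (\<integral>\<^sup>+w. \<integral>\<^sup>+p. g (w, p) \<partial>(clock \<Otimes>\<^sub>M F) \<partial>path_law P Y x)"
    unfolding joint_def
    by (rule EF.nn_integral_fst[symmetric]) (use g in \<open>simp only: joint_def[symmetric] measurable_joint\<close>)
  also have "\<dots> = (\<integral>\<^sup>+w. \<integral>\<^sup>+r. \<integral>\<^sup>+v. g (w, r, v) \<partial>F \<partial>clock \<partial>path_law P Y x)"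
  proof (rule nn_integral_cong)
    fix w assume "w \<in> space (path_law P Y x)"
    then have "w \<in> space path_space" by (simp add: path_law_def)
    then have "(\<lambda>p. g (w, p)) \<in> borel_measurable (clock \<Otimes>\<^sub>M F)"
      using g by (simp only: measurable_cong_sets[OF s refl]) (rule measurable_Pair2)
    then show "(\<integral>\<^sup>+p. g (w, p) \<partial>(clock \<Otimes>\<^sub>M F)) = (\<integral>\<^sup>+r. \<integral>\<^sup>+v. g (w, r, v) \<partial>F \<partial>clock)"
      by (rule F.nn_integral_fst[symmetric])
  qed
  finally show ?thesis .
qed

lemma distr_pair: "distr (P x) (path_space \<Otimes>\<^sub>M borel) (\<lambda>\<omega>. (Y \<omega>, \<zeta> \<omega>)) = path_law P Y x \<Otimes>\<^sub>M clock"
proof -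
  interpret F: prob_space F by (rule prob_F)
  interpret E: prob_space clock by (rule prob_clock)
  interpret R: prob_space "path_law P Y x" by (rule prob_path_law)
  have "distr (P x) (path_space \<Otimes>\<^sub>M borel) (\<lambda>\<omega>. (Y \<omega>, \<zeta> \<omega>)) =
      distr (joint x) (path_space \<Otimes>\<^sub>M borel) (\<lambda>(w, p). (w, fst p))"
    unfolding distr_triple[symmetric] by (subst distr_distr[OF _ triple_measurable]) (auto simp: comp_def)
  also have "\<dots> = distr (path_law P Y x) path_space (\<lambda>w. w) \<Otimes>\<^sub>M distr (clock \<Otimes>\<^sub>M F) borel fst"
    unfolding joint_def
  proof (rule pair_measure_distr[symmetric])
    show "(\<lambda>w. w) \<in> path_law P Y x \<rightarrow>\<^sub>M path_space" by (simp add: path_law_def)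
    show "fst \<in> clock \<Otimes>\<^sub>M F \<rightarrow>\<^sub>M borel" using measurable_fst[of clock F] by simp
    have "distr (clock \<Otimes>\<^sub>M F) borel fst = clock"
      using F.distr_pair_fst[of clock] by (simp cong: distr_cong)
    then show "sigma_finite_measure (distr (clock \<Otimes>\<^sub>M F) borel fst)" using E.sigma_finite_measure_axioms by simp
  qed
  also have "distr (clock \<Otimes>\<^sub>M F) borel fst = clock"
    using F.distr_pair_fst[of clock] by (simp cong: distr_cong)
  also have "distr (path_law P Y x) path_space (\<lambda>w. w) = path_law P Y x"
    by (rule distr_id2) (simp add: path_law_def)
  finally show ?thesis .
qed

lemma AE_pair:
  assumes "AE p in path_law P Y x \<Otimes>\<^sub>M clock. \<phi> p"
  shows "AE \<omega> in P x. \<phi> (Y \<omega>, \<zeta> \<omega>)"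
  using assms unfolding distr_pair[symmetric]
  by (rule AE_distrD[rotated]) (unfold measurable_P, intro measurable_Pair Y(1) \<zeta>_measurable)

lemma AE_no_jump: "AE \<omega> in P x. 0 < \<zeta> \<omega> \<longrightarrow> Lim (at_left (\<zeta> \<omega>)) (Y \<omega>) = Y \<omega> (\<zeta> \<omega>)"
  using AE_pair[OF AE_no_jump_at_independent_time[OF prob_path_law(2) sets_path_law prob_clock refl]]
  by simp

text \<open>The killing time of \<open>Y\<close> is a function of \<open>Y\<close>, and the independent time
  \<open>\<zeta>\<close> has no atoms.\<close>

lemma AE_not_killed_at_jump: "AE \<omega> in P x. 0 < \<zeta> \<omega> \<longrightarrow> ennreal (\<zeta> \<omega>) \<noteq> T_reg (Y \<omega>)"
proof -
  interpret E: prob_space clock by (rule prob_clock)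
  interpret R: prob_space "path_law P Y x" by (rule prob_path_law)
  interpret RE: pair_prob_space "path_law P Y x" clock ..
  have "AE p in path_law P Y x \<Otimes>\<^sub>M clock. 0 < snd p \<longrightarrow> ennreal (snd p) \<noteq> T_reg (fst p)"
  proof (rule RE.AE_pair_measure)
    have s: "sets (path_law P Y x \<Otimes>\<^sub>M clock) = sets (path_space \<Otimes>\<^sub>M borel)"
      by (intro sets_pair_measure_cong sets_path_law) simp
    note [measurable] = T_reg
    have "Measurable.pred (path_space \<Otimes>\<^sub>M borel) (\<lambda>p. 0 < snd p \<longrightarrow> ennreal (snd p) \<noteq> T_reg (fst p))"
      by measurable
    then show "{p \<in> space (path_law P Y x \<Otimes>\<^sub>M clock). 0 < snd p \<longrightarrow> ennreal (snd p) \<noteq> T_reg (fst p)} \<in> sets (path_law P Y x \<Otimes>\<^sub>M clock)"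
      by (simp only: pred_def s sets_eq_imp_space_eq[OF s])
    show "AE w in path_law P Y x. AE r in clock. 0 < snd (w, r) \<longrightarrow> ennreal (snd (w, r)) \<noteq> T_reg (fst (w, r))"
    proof (rule AE_I2)
      fix w
      have "{enn2real (T_reg w)} \<in> null_sets lborel" by (rule countable_imp_null_set_lborel) simp
      then have "AE r in lborel. r \<notin> {enn2real (T_reg w)}" by (rule AE_not_in)
      then have "AE r in clock. r \<notin> {enn2real (T_reg w)}" by (subst AE_density) auto
      then show "AE r in clock. 0 < snd (w, r) \<longrightarrow> ennreal (snd (w, r)) \<noteq> T_reg (fst (w, r))"
        by eventually_elim (auto simp del: enn2real_ennreal dest!: arg_cong[where f=enn2real] simp: enn2real_ennreal less_imp_le)
    qed
  qed
  from AE_pair[OF this] show ?thesis by simp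
qed

lemma AE_before_jump:
  "AE \<omega> in P x. 0 < \<zeta> \<omega> \<and> (\<forall>t. 0 \<le> t \<longrightarrow> t < \<zeta> \<omega> \<longrightarrow> X \<omega> t = Y \<omega> t) \<and>
     X \<omega> (\<zeta> \<omega>) = Y \<omega> (\<zeta> \<omega>) - U 1 \<omega> \<and> \<delta> \<le> norm (U 1 \<omega>)"
proof -
  have "AE \<omega> in P x. \<delta> \<le> norm (U 1 \<omega>)"
    using F unfolding F_distr[of x, symmetric] by (rule AE_distrD[OF first_jump_law(4)])
  then show ?thesis
    using first_jump_law(2)[of x] first_jump_law(3)[of x] poisson_clock.AE_first_jump[OF poisson_clock, of x] AE_space
  proof eventually_elim
    case (elim \<omega>)
    then show ?case by (simp add: space_P decomposition)
  qed
qed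

text \<open>Before \<open>\<zeta>\<close> the jumps of \<open>X\<close> are jumps of \<open>Y\<close>, hence
  small. At \<open>\<zeta>\<close> the process \<open>Y\<close> is continuous, so that \<open>X\<close> jumps
  by exactly \<open>- U\<^sub>1\<close>. This makes \<open>\<zeta>\<close> a stopping time of the path of
  \<open>X\<close>.\<close>

lemma AE_first_big_jump: "AE \<omega> in P x. S (X \<omega>) = ennreal (\<zeta> \<omega>)"
  using AE_before_jump[of x] AE_no_jump[of x] small_jumps[of x] AE_space
proof eventually_elim
  case (elim \<omega>)
  then have z: "0 < \<zeta> \<omega>" and XY: "\<And>t. 0 \<le> t \<Longrightarrow> t < \<zeta> \<omega> \<Longrightarrow> X \<omega> t = Y \<omega> t"
    and XU: "X \<omega> (\<zeta> \<omega>) = Y \<omega> (\<zeta> \<omega>) - U 1 \<omega>" "\<delta> \<le> norm (U 1 \<omega>)"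
    and no: "Lim (at_left (\<zeta> \<omega>)) (Y \<omega>) = Y \<omega> (\<zeta> \<omega>)"
    and small: "\<And>t. 0 < t \<Longrightarrow> norm (Y \<omega> t - Lim (at_left t) (Y \<omega>)) < \<delta>"
    and cY: "cadlag (Y \<omega>)"
    by (auto simp: space_P Y_cadlag)
  have Lim: "Lim (at_left t) (X \<omega>) = Lim (at_left t) (Y \<omega>)" if t: "0 < t" "t \<le> \<zeta> \<omega>" for t
  proof (rule tendsto_Lim)
    have "eventually (\<lambda>s. 0 < s \<and> s < t) (at_left t)"
      using t(1) by (auto simp: eventually_at_left_field)
    then have "eventually (\<lambda>s. Y \<omega> s = X \<omega> s) (at_left t)"
      by eventually_elim (use XY t in simp)
    then show "(X \<omega> \<longlongrightarrow> Lim (at_left t) (Y \<omega>)) (at_left t)"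
      using cadlag_left_Lim[OF cY t(1)] by (rule Lim_transform_eventually[rotated])
  qed simp
  have "big_jump \<delta> (X \<omega>) (\<zeta> \<omega>)"
    using z XU by (simp add: big_jump_def Lim no)
  moreover have "\<zeta> \<omega> \<le> t" if "big_jump \<delta> (X \<omega>) t" for t
  proof (rule ccontr)
    assume "\<not> ?thesis"
    then have "t < \<zeta> \<omega>" "0 < t" using that by (auto simp: big_jump_def)
    then show False using that small[of t] by (simp add: big_jump_def Lim XY)
  qed
  ultimately show ?case
    unfolding first_big_jump_def by (intro antisym Inf_lower Inf_greatest) (auto intro: ennreal_leI)
qed

text \<open>The paths of \<open>X\<close> and \<open>Y\<close> agree before \<open>\<zeta>\<close>, and up to
  a truncation at \<open>\<zeta>\<close> this decides \<open>T\<close>.\<close>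

lemma AE_killing_agrees: "AE \<omega> in P x. min (ennreal (\<zeta> \<omega>)) (T (X \<omega>)) = min (ennreal (\<zeta> \<omega>)) (T (Y \<omega>))"
proof -
  obtain N' where N': "N' \<in> sets path_space" "\<forall>q\<in>Q. emeasure q N' = 0"
    and eq: "\<forall>w w' c. cadlag w \<longrightarrow> cadlag w' \<longrightarrow> w \<notin> N' \<longrightarrow> w' \<notin> N' \<longrightarrow> (\<forall>r. 0 \<le> r \<longrightarrow> r < c \<longrightarrow> w r = w' r) \<longrightarrow>
       min (ennreal c) (T w) = min (ennreal c) (T w')"
    using stopping_time_decided[OF sets_Q T_stopping] by auto
  from AE_avoid_null[OF N', of x] show ?thesis
    using AE_before_jump[of x] AE_space
  proof eventually_elim
    case (elim \<omega>)
    then have "\<omega> \<in> space M" "X \<omega> \<notin> N'" "Y \<omega> \<notin> N'" by (simp_all add: space_P)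
    moreover have "\<forall>r. 0 \<le> r \<longrightarrow> r < \<zeta> \<omega> \<longrightarrow> X \<omega> r = Y \<omega> r" using elim by blast
    ultimately show ?case using eq X_cadlag Y_cadlag by blast
  qed
qed

lemma X_kernel: "path_law P X \<in> borel \<rightarrow>\<^sub>M subprob_algebra path_space"
  by (rule strong_markov_kernel[OF X(2) prob_path_law(1) sets_path_law])

lemma Y_kernel: "path_law P Y \<in> borel \<rightarrow>\<^sub>M subprob_algebra path_space"
  by (rule strong_markov_kernel[OF Y(2) prob_path_law(2) sets_path_law])

lemma S_measurable: "S \<in> borel_measurable path_space"
  by (rule measurable_first_big_jump[OF pos(1)])

lemma S_stopping: "stopping_time (natural_filtration Q) S"
  by (rule stopping_time_first_big_jump[OF pos(1)])

text \<open>By the strong Markov property, the shifted path falls into the exceptional set with the mean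
  probability that a path started at \<open>X\<^sub>\<zeta>\<close> does, which is zero.\<close>

lemma AE_shift_T_reg: "AE \<omega> in P x. T (path_shift (\<zeta> \<omega>) (X \<omega>)) = T_reg (path_shift (\<zeta> \<omega>) (X \<omega>))"
proof -
  interpret filtration "{w :: real \<Rightarrow> 'a. cadlag w}" "natural_filtration Q"
    by (rule filtration_natural_filtration)
  let ?\<Omega> = "{w :: real \<Rightarrow> 'a. cadlag w}"
  have A: "?\<Omega> \<in> sets (pre_sigma S)"
    using sets.top[of "pre_sigma S"] by (simp only: space_pre_sigma)
  have A': "?\<Omega> \<in> sets path_space" using sets.top[of path_space] by (simp only: space_path_algebra)
  have "(\<integral>\<^sup>+w. indicator {w\<in>?\<Omega>. S w < \<infinity>} w * indicator T_null (path_shift (enn2real (S w)) w) \<partial>path_law P X x) =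
    (\<integral>\<^sup>+w. indicator {w\<in>?\<Omega>. S w < \<infinity>} w * (\<integral>\<^sup>+w'. indicator T_null w' \<partial>path_law P X (w (enn2real (S w)))) \<partial>path_law P X x)"
    by (rule strong_markov_nn_integral[OF X(2) prob_path_law(1) sets_path_law S_stopping S_measurable A A'])
      (use T_null(1) in auto)
  also have "\<dots> = 0"
    using T_null by (simp add: sets_path_law Q_def)
  finally have 0: "(\<integral>\<^sup>+w. indicator {w\<in>?\<Omega>. S w < \<infinity>} w * indicator T_null (path_shift (enn2real (S w)) w) \<partial>path_law P X x) = 0" .
  have "(\<lambda>w. path_shift (enn2real (S w)) w) \<in> path_space \<rightarrow>\<^sub>M path_space"
    by (rule measurable_path_shift) (use S_measurable in auto)
  note [measurable] = S_measurable T_null(1) measurable_compose[OF this borel_measurable_indicator[OF T_null(1)]]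
  have "{w\<in>?\<Omega>. S w < \<infinity>} = {w\<in>space path_space. S w < \<infinity>}" by (simp add: space_path_algebra)
  also have "\<dots> \<in> sets path_space" by measurable
  finally have "AE w in path_law P X x. indicator {w\<in>?\<Omega>. S w < \<infinity>} w * indicator T_null (path_shift (enn2real (S w)) w) = (0 :: ennreal)"
    using 0 by (subst (asm) nn_integral_0_iff_AE) (auto simp: measurable_path_law)
  from AE_path_law[OF X(1) this] show ?thesis
    using AE_first_big_jump[of x] AE_before_jump[of x] AE_space
  proof eventually_elim
    case (elim \<omega>)
    then have "path_shift (\<zeta> \<omega>) (X \<omega>) \<notin> T_null"
      by (auto simp: space_P X_cadlag indicator_def less_imp_le split: if_splits)
    then show ?case by (rule T_eq_T_reg)
  qed
qed

lemma AE_terminal: "AE \<omega> in P x. ennreal (\<zeta> \<omega>) < T (X \<omega>) \<longrightarrow> ennreal (\<zeta> \<omega>) + T (path_shift (\<zeta> \<omega>) (X \<omega>)) = T (X \<omega>)"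
proof -
  have "AE w in path_law P X x. S w < T w \<longrightarrow> S w + T (path_shift (enn2real (S w)) w) = T w"
    using T S_stopping by (simp add: terminal_time_def)
  from AE_path_law[OF X(1) this] show ?thesis
    using AE_first_big_jump[of x] AE_before_jump[of x]
    by eventually_elim (simp add: less_imp_le)
qed

end

context killed_jump_process
begin

text \<open>Potentials are considered for an arbitrary nonnegative \<open>f\<close>, since the constant
  function \<open>1\<close> is used besides \<open>l\<close>: its potential is the mean of
  \<open>T\<close>.\<close>

definition pot :: "('a \<Rightarrow> ennreal) \<Rightarrow> 'a \<Rightarrow> ennreal" where
  "pot f x = (\<integral>\<^sup>+\<omega>. occupation f (T (X \<omega>)) (X \<omega>) \<partial>P x)"

definition pot_to_jump :: "('a \<Rightarrow> ennreal) \<Rightarrow> 'a \<Rightarrow> ennreal" where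
  "pot_to_jump f x = (\<integral>\<^sup>+\<omega>. occupation f (min (ennreal (\<zeta> \<omega>)) (T (X \<omega>))) (X \<omega>) \<partial>P x)"

lemma measurable_occupation_path:
  assumes "f \<in> borel_measurable borel" "c \<in> borel_measurable path_space"
  shows "(\<lambda>w. occupation f (c w) w) \<in> borel_measurable (path_space :: (real \<Rightarrow> 'a) measure)"
  by (rule measurable_occupation[OF assms(1) _ assms(2)]) simp

lemma nn_integral_path_law_X:
  assumes "g \<in> borel_measurable path_space"
  shows "(\<integral>\<^sup>+w. g w \<partial>path_law P X x) = (\<integral>\<^sup>+\<omega>. g (X \<omega>) \<partial>P x)"
  unfolding path_law_def by (rule nn_integral_distr) (use assms X(1) in \<open>simp_all add: measurable_P\<close>)

lemma pot_eq:
  assumes f: "f \<in> borel_measurable borel"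
  shows "pot f x = (\<integral>\<^sup>+w. occupation f (T_reg w) w \<partial>path_law P X x)"
  unfolding nn_integral_path_law_X[OF measurable_occupation_path[OF f T_reg]] pot_def
  by (rule nn_integral_cong_AE) (use AE_T_reg[of x] in eventually_elim, simp)

lemma pot_measurable:
  assumes f: "f \<in> borel_measurable borel"
  shows "pot f \<in> borel_measurable borel"
  using measurable_compose[OF X_kernel nn_integral_measurable_subprob_algebra[OF measurable_occupation_path[OF f T_reg]]]
  by (simp add: pot_eq[OF f, abs_def])

lemma min_S_T_reg_measurable: "(\<lambda>w. min (S w) (T_reg w)) \<in> borel_measurable path_space"
  using S_measurable T_reg by measurable

lemma pot_to_jump_eq:
  assumes f: "f \<in> borel_measurable borel"
  shows "pot_to_jump f x = (\<integral>\<^sup>+w. occupation f (min (S w) (T_reg w)) w \<partial>path_law P X x)"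
  unfolding nn_integral_path_law_X[OF measurable_occupation_path[OF f min_S_T_reg_measurable]] pot_to_jump_def
  by (rule nn_integral_cong_AE) (use AE_T_reg[of x] AE_first_big_jump[of x] in eventually_elim, simp)

lemma pot_to_jump_measurable:
  assumes f: "f \<in> borel_measurable borel"
  shows "pot_to_jump f \<in> borel_measurable borel"
  using measurable_compose[OF X_kernel nn_integral_measurable_subprob_algebra[OF measurable_occupation_path[OF f min_S_T_reg_measurable]]]
  by (simp add: pot_to_jump_eq[OF f, abs_def])

text \<open>Arguments are triples \<open>(w, r, v)\<close> that stand for \<open>(Y, \<zeta>,
  U\<^sub>1)\<close>. The kernel \<open>G x\<close> will be the law of \<open>x + displacement\<close> on the
  event \<open>survives\<close>, so that integrating \<open>u (x - z)\<close> over it evaluates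
  \<open>u\<close> at the position \<open>Y\<^sub>\<zeta> - U\<^sub>1\<close> of \<open>X\<close> after the
  jump.\<close>

definition survives :: "(real \<Rightarrow> 'a) \<times> real \<times> 'a \<Rightarrow> ennreal" where
  "survives j = indicator {j. ennreal (fst (snd j)) < T_reg (fst j)} j"

definition displacement :: "(real \<Rightarrow> 'a) \<times> real \<times> 'a \<Rightarrow> 'a" where
  "displacement j = snd (snd j) - fst j (max 0 (fst (snd j)))"

lemma survives_measurable: "survives \<in> borel_measurable (path_space \<Otimes>\<^sub>M (borel \<Otimes>\<^sub>M borel))"
proof -
  note [measurable] = T_reg
  have "{j \<in> space (path_space \<Otimes>\<^sub>M ((borel :: real measure) \<Otimes>\<^sub>M (borel :: 'a measure))). ennreal (fst (snd j)) < T_reg (fst j)}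
     \<in> sets (path_space \<Otimes>\<^sub>M (borel \<Otimes>\<^sub>M borel))"
    by measurable
  then show ?thesis unfolding survives_def[abs_def]
    by (intro borel_measurable_indicator') (simp add: Int_def conj_commute)
qed

lemma displacement_measurable: "displacement \<in> path_space \<Otimes>\<^sub>M (borel \<Otimes>\<^sub>M borel) \<rightarrow>\<^sub>M borel"
proof -
  have "(\<lambda>j :: (real \<Rightarrow> 'a) \<times> real \<times> 'a. fst j (max 0 (fst (snd j)))) \<in> path_space \<Otimes>\<^sub>M (borel \<Otimes>\<^sub>M borel) \<rightarrow>\<^sub>M borel"
    by (rule measurable_eval_max) measurable
  then show ?thesis unfolding displacement_def[abs_def] by measurable
qed

text \<open>The occupation integral is split at \<open>\<zeta>\<close>, and the strong Markov property at the
  first large jump \<open>S\<close> of \<open>X\<close> is applied on the event \<open>S \<le> T\<close>. In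
  contrast to \<open>S < T\<close>, this event can be expressed by the killing time of \<open>Y\<close>.
  Admitting \<open>S = T\<close> changes nothing, because the restarted path is then killed
  immediately.\<close>

lemma pot_renewal:
  assumes f: "f \<in> borel_measurable borel"
  shows "pot f x = pot_to_jump f x + (\<integral>\<^sup>+j. survives j * pot f (- displacement j) \<partial>joint x)"
proof -
  define \<Phi> where "\<Phi> w = occupation f (T_reg w) w" for w
  define \<theta> where "\<theta> w = path_shift (enn2real (S w)) w" for w
  define A' where "A' = {w \<in> space path_space. S w \<le> T_reg w}"
  define I where "I = (indicator {w\<in>A'. S w < \<infinity>} :: (real \<Rightarrow> 'a) \<Rightarrow> ennreal)"
  note [measurable] = S_measurable T_reg
  have \<Phi>: "\<Phi> \<in> borel_measurable path_space"
    unfolding \<Phi>_def[abs_def] by (rule measurable_occupation_path[OF f T_reg])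
  have A': "A' \<in> sets path_space" unfolding A'_def by measurable
  have "{w\<in>A'. S w < \<infinity>} = A' \<inter> {w\<in>space path_space. S w < \<infinity>}" by (auto simp: A'_def)
  also have "\<dots> \<in> sets path_space" using A' by measurable
  finally have I: "I \<in> borel_measurable path_space" unfolding I_def by simp
  have \<theta>: "\<theta> \<in> path_space \<rightarrow>\<^sub>M path_space"
    unfolding \<theta>_def[abs_def] by (rule measurable_path_shift) (use S_measurable in auto)
  have ev: "(\<lambda>w. w (enn2real (S w))) \<in> path_space \<rightarrow>\<^sub>M (borel :: 'a measure)"
    by (rule measurable_eval_random) auto
  have m1: "(\<lambda>w. I w * \<Phi> (\<theta> w)) \<in> borel_measurable path_space"
    using I measurable_compose[OF \<theta> \<Phi>] by measurable
  have m2: "(\<lambda>w. I w * pot f (w (enn2real (S w)))) \<in> borel_measurable path_space"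
    using I measurable_compose[OF ev pot_measurable[OF f]] by measurable
  have m3: "(\<lambda>w. occupation f (min (S w) (T_reg w)) w) \<in> borel_measurable path_space"
    by (rule measurable_occupation_path[OF f min_S_T_reg_measurable])
  have sm: "(\<integral>\<^sup>+w. I w * \<Phi> (\<theta> w) \<partial>path_law P X x) = (\<integral>\<^sup>+w. I w * pot f (w (enn2real (S w))) \<partial>path_law P X x)"
  proof -
    have "AE w in path_law P X x. w \<in> {w. cadlag w \<and> S w \<le> T w} \<longleftrightarrow> w \<in> A'"
    proof -
      have "T_null \<in> null_sets (path_law P X x)" using T_null by (auto simp: null_sets_def sets_path_law Q_def)
      from AE_not_in[OF this] AE_space show ?thesis
        by eventually_elim (simp add: T_eq_T_reg A'_def path_law_def space_path_algebra)
    qed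
    from strong_markov_nn_integral[OF X(2) prob_path_law(1) sets_path_law S_stopping S_measurable
        stopping_time_le_pre_sigma[OF S_stopping T_stopping] A' this \<Phi>]
    show ?thesis
      by (simp only: I_def \<theta>_def \<Phi>_def pot_eq[OF f])
  qed
  have "pot f x = (\<integral>\<^sup>+\<omega>. occupation f (min (S (X \<omega>)) (T_reg (X \<omega>))) (X \<omega>) + I (X \<omega>) * \<Phi> (\<theta> (X \<omega>)) \<partial>P x)"
    unfolding pot_def
  proof (rule nn_integral_cong_AE)
    show "AE \<omega> in P x. occupation f (T (X \<omega>)) (X \<omega>) =
        occupation f (min (S (X \<omega>)) (T_reg (X \<omega>))) (X \<omega>) + I (X \<omega>) * \<Phi> (\<theta> (X \<omega>))"
      using AE_T_reg[of x] AE_first_big_jump[of x] AE_before_jump[of x] AE_shift_T_reg[of x] AE_terminal[of x] T_jump[of x] AE_space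
    proof eventually_elim
      case (elim \<omega>)
      then have S: "S (X \<omega>) = ennreal (\<zeta> \<omega>)" "0 < \<zeta> \<omega>" and T: "T (X \<omega>) = T_reg (X \<omega>)" and c: "cadlag (X \<omega>)"
        by (auto simp: space_P X_cadlag)
      have \<theta>X: "\<theta> (X \<omega>) = path_shift (\<zeta> \<omega>) (X \<omega>)" using S by (simp add: \<theta>_def less_imp_le)
      have T\<theta>: "T_reg (\<theta> (X \<omega>)) = T (path_shift (\<zeta> \<omega>) (X \<omega>))" using elim unfolding \<theta>X by simp
      have IX: "I (X \<omega>) = (if ennreal (\<zeta> \<omega>) \<le> T (X \<omega>) then 1 else 0)"
        using c S T by (simp add: I_def A'_def space_path_algebra indicator_def)
      consider "ennreal (\<zeta> \<omega>) < T (X \<omega>)" | "ennreal (\<zeta> \<omega>) = T (X \<omega>)" | "T (X \<omega>) < ennreal (\<zeta> \<omega>)"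
        by (rule linorder_cases)
      then show ?case
      proof cases
        case 1
        then have "ennreal (\<zeta> \<omega>) + T_reg (\<theta> (X \<omega>)) = T (X \<omega>)" using elim T\<theta> by simp
        then have "occupation f (T (X \<omega>)) (X \<omega>) = occupation f (ennreal (\<zeta> \<omega>)) (X \<omega>) + occupation f (T_reg (\<theta> (X \<omega>))) (\<theta> (X \<omega>))"
          using occupation_split[OF f c less_imp_le[OF S(2)], of "T_reg (\<theta> (X \<omega>))"] by (simp add: \<theta>X)
        then show ?thesis using 1 by (simp add: IX S T[symmetric] \<Phi>_def min_def less_imp_le)
      next
        case 2
        \<comment> \<open>Killing at the jump itself: \<open>S \<le> T\<close> holds, but \<open>T_jump\<close> makes the restarted occupation integral vanish.\<close>
        then have "T_reg (\<theta> (X \<omega>)) = 0" using elim T\<theta> by simp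
        then have "\<Phi> (\<theta> (X \<omega>)) = 0" by (simp add: \<Phi>_def occupation_0)
        then show ?thesis using 2 by (simp add: S T[symmetric])
      next
        case 3
        then have "I (X \<omega>) = 0" by (simp add: IX)
        then show ?thesis using 3 by (simp add: S T[symmetric] min_absorb2 less_imp_le)
      qed
    qed
  qed
  also have "\<dots> = (\<integral>\<^sup>+w. occupation f (min (S w) (T_reg w)) w + I w * \<Phi> (\<theta> w) \<partial>path_law P X x)"
    using m1 m3 by (intro nn_integral_path_law_X[symmetric]) measurable
  also have "\<dots> = pot_to_jump f x + (\<integral>\<^sup>+w. I w * \<Phi> (\<theta> w) \<partial>path_law P X x)"
    unfolding pot_to_jump_eq[OF f] by (rule nn_integral_add) (simp_all only: measurable_path_law m1 m3)
  also have "(\<integral>\<^sup>+w. I w * \<Phi> (\<theta> w) \<partial>path_law P X x) = (\<integral>\<^sup>+\<omega>. I (X \<omega>) * pot f (X \<omega> (enn2real (S (X \<omega>)))) \<partial>P x)"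
    unfolding sm by (rule nn_integral_path_law_X[OF m2])
  also have "\<dots> = (\<integral>\<^sup>+\<omega>. survives (Y \<omega>, \<zeta> \<omega>, U 1 \<omega>) * pot f (- displacement (Y \<omega>, \<zeta> \<omega>, U 1 \<omega>)) \<partial>P x)"
  proof (rule nn_integral_cong_AE)
    show "AE \<omega> in P x. I (X \<omega>) * pot f (X \<omega> (enn2real (S (X \<omega>)))) =
        survives (Y \<omega>, \<zeta> \<omega>, U 1 \<omega>) * pot f (- displacement (Y \<omega>, \<zeta> \<omega>, U 1 \<omega>))"
      using AE_T_reg[of x] AE_first_big_jump[of x] AE_before_jump[of x] AE_killing_agrees[of x] AE_not_killed_at_jump[of x] AE_space
    proof eventually_elim
      case (elim \<omega>)
      then have S: "S (X \<omega>) = ennreal (\<zeta> \<omega>)" "0 < \<zeta> \<omega>" and T: "T (X \<omega>) = T_reg (X \<omega>)" "T (Y \<omega>) = T_reg (Y \<omega>)" and c: "cadlag (X \<omega>)"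
        and XU: "X \<omega> (\<zeta> \<omega>) = Y \<omega> (\<zeta> \<omega>) - U 1 \<omega>" and ne: "ennreal (\<zeta> \<omega>) \<noteq> T_reg (Y \<omega>)"
        and m: "min (ennreal (\<zeta> \<omega>)) (T (X \<omega>)) = min (ennreal (\<zeta> \<omega>)) (T (Y \<omega>))"
        by (auto simp: space_P X_cadlag)
      have "ennreal (\<zeta> \<omega>) \<le> T (X \<omega>) \<longleftrightarrow> ennreal (\<zeta> \<omega>) \<le> T (Y \<omega>)"
        using m by (metis min.absorb_iff1)
      then have "ennreal (\<zeta> \<omega>) \<le> T_reg (X \<omega>) \<longleftrightarrow> ennreal (\<zeta> \<omega>) < T_reg (Y \<omega>)"
        using ne T by (simp add: less_le)
      then have "I (X \<omega>) = survives (Y \<omega>, \<zeta> \<omega>, U 1 \<omega>)"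
        using c S by (simp add: I_def A'_def space_path_algebra survives_def indicator_def)
      moreover have "X \<omega> (enn2real (S (X \<omega>))) = - displacement (Y \<omega>, \<zeta> \<omega>, U 1 \<omega>)"
        using S XU by (simp add: displacement_def less_imp_le)
      ultimately show ?case by simp
    qed
  qed
  also have "\<dots> = (\<integral>\<^sup>+j. survives j * pot f (- displacement j) \<partial>joint x)"
  proof (rule nn_integral_joint)
    have "(\<lambda>j. pot f (- displacement j)) \<in> borel_measurable (path_space \<Otimes>\<^sub>M (borel \<Otimes>\<^sub>M borel))"
      by (rule measurable_compose[OF _ pot_measurable[OF f]]) (use displacement_measurable in measurable)
    then show "(\<lambda>j. survives j * pot f (- displacement j)) \<in> borel_measurable (path_space \<Otimes>\<^sub>M (borel \<Otimes>\<^sub>M borel))"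
      using survives_measurable by measurable
  qed
  finally show ?thesis .
qed

abbreviation "G \<equiv> renewal_kernel P Y T F \<zeta>"

lemma prob_joint: "prob_space (joint x)"
  using prob_space.prob_space_distr[OF P(1) triple_measurable] unfolding distr_triple .

text \<open>Integrating out \<open>v\<close> first: \<open>F (A + Y\<^sub>\<zeta> - x)\<close> is the
  conditional probability that \<open>x - Y\<^sub>\<zeta> + U\<^sub>1\<close> lies in \<open>A\<close>, given
  \<open>Y\<close> and \<open>\<zeta>\<close>.\<close>

lemma emeasure_joint_shifted:
  assumes A: "A \<in> sets borel"
  shows "(\<integral>\<^sup>+\<omega>. emeasure F ((\<lambda>a. a + Y \<omega> (\<zeta> \<omega>) - x) ` A) * indicator {\<omega>. ennreal (\<zeta> \<omega>) < T (Y \<omega>)} \<omega> \<partial>P x) =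
    (\<integral>\<^sup>+j. survives j * indicator A (x + displacement j) \<partial>joint x)"
proof -
  interpret F: prob_space F by (rule prob_F)
  define g where "g j = survives j * emeasure F {v. x - fst j (max 0 (fst (snd j))) + v \<in> A}" for j :: "(real \<Rightarrow> 'a) \<times> real \<times> 'a"
  have vim: "{v. y + v \<in> A} = (\<lambda>v. y + v) -` A" for y :: 'a by auto
  have img: "(\<lambda>a. a + y - x) ` A = {v. x - y + v \<in> A}" for y :: 'a
    by (force simp: image_iff algebra_simps)
  have hit: "(\<lambda>y. emeasure F {v. y + v \<in> A}) \<in> borel_measurable borel"
  proof -
    have "{p \<in> space (borel \<Otimes>\<^sub>M borel :: ('a \<times> 'a) measure). fst p + snd p \<in> A} \<in> sets (borel \<Otimes>\<^sub>M borel)"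
      using A by measurable
    then have "{p :: 'a \<times> 'a. fst p + snd p \<in> A} \<in> sets (borel \<Otimes>\<^sub>M F)"
      using sets_pair_measure_cong[OF refl sets_F, of "borel :: 'a measure"] by (simp add: space_pair_measure)
    from F.measurable_emeasure_Pair[OF this] show ?thesis by (simp add: vimage_def)
  qed
  have ev: "(\<lambda>j :: (real \<Rightarrow> 'a) \<times> real \<times> 'a. fst j (max 0 (fst (snd j)))) \<in> path_space \<Otimes>\<^sub>M (borel \<Otimes>\<^sub>M borel) \<rightarrow>\<^sub>M borel"
    by (rule measurable_eval_max) measurable
  have "(\<lambda>j. emeasure F {v. x - fst j (max 0 (fst (snd j))) + v \<in> A}) \<in> borel_measurable (path_space \<Otimes>\<^sub>M (borel \<Otimes>\<^sub>M (borel :: 'a measure)))"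
    by (rule measurable_compose[OF _ hit]) (use ev in measurable)
  then have g: "g \<in> borel_measurable (path_space \<Otimes>\<^sub>M (borel \<Otimes>\<^sub>M borel))"
    unfolding g_def[abs_def] using survives_measurable by measurable
  have k: "(\<lambda>j. survives j * indicator A (x + displacement j)) \<in> borel_measurable (path_space \<Otimes>\<^sub>M (borel \<Otimes>\<^sub>M borel))"
    using survives_measurable displacement_measurable A by measurable
  have "(\<integral>\<^sup>+\<omega>. emeasure F ((\<lambda>a. a + Y \<omega> (\<zeta> \<omega>) - x) ` A) * indicator {\<omega>. ennreal (\<zeta> \<omega>) < T (Y \<omega>)} \<omega> \<partial>P x) =
      (\<integral>\<^sup>+\<omega>. g (Y \<omega>, \<zeta> \<omega>, U 1 \<omega>) \<partial>P x)"
    by (rule nn_integral_cong_AE)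
      (use AE_T_reg[of x] AE_before_jump[of x] in eventually_elim, simp add: g_def img survives_def indicator_def less_imp_le)
  also have "\<dots> = (\<integral>\<^sup>+w. \<integral>\<^sup>+r. \<integral>\<^sup>+v. g (w, r, v) \<partial>F \<partial>clock \<partial>path_law P Y x)"
    unfolding nn_integral_joint[OF g] by (rule nn_integral_joint_iterated[OF g])
  also have "\<dots> = (\<integral>\<^sup>+w. \<integral>\<^sup>+r. \<integral>\<^sup>+v. survives (w, r, v) * indicator A (x + displacement (w, r, v)) \<partial>F \<partial>clock \<partial>path_law P Y x)"
  proof (rule nn_integral_cong, rule nn_integral_cong)
    fix w :: "real \<Rightarrow> 'a" and r :: real
    let ?c = "indicator {r. ennreal r < T_reg w} r :: ennreal" and ?y = "x - w (max 0 r)"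
    have vA: "{v. ?y + v \<in> A} \<in> sets F"
    proof -
      have "(\<lambda>v. ?y + v) -` A \<inter> space borel \<in> sets borel" by (rule measurable_sets[OF _ A]) simp
      then show ?thesis by (simp add: vim sets_F)
    qed
    have "(\<integral>\<^sup>+v. g (w, r, v) \<partial>F) = ?c * emeasure F {v. ?y + v \<in> A}"
      by (simp add: g_def survives_def indicator_def F.emeasure_space_1)
    also have "\<dots> = (\<integral>\<^sup>+v. ?c * indicator {v. ?y + v \<in> A} v \<partial>F)"
      using vA by (simp add: nn_integral_cmult)
    also have "\<dots> = (\<integral>\<^sup>+v. survives (w, r, v) * indicator A (x + displacement (w, r, v)) \<partial>F)"
      by (rule nn_integral_cong) (simp add: survives_def displacement_def indicator_def algebra_simps)
    finally show "(\<integral>\<^sup>+v. g (w, r, v) \<partial>F) = (\<integral>\<^sup>+v. survives (w, r, v) * indicator A (x + displacement (w, r, v)) \<partial>F)" .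
  qed
  also have "\<dots> = (\<integral>\<^sup>+j. survives j * indicator A (x + displacement j) \<partial>joint x)"
    by (rule nn_integral_joint_iterated[OF k, symmetric])
  finally show ?thesis .
qed

lemma G_eq: "G x = distr (density (joint x) survives) borel (\<lambda>j. x + displacement j)"
  unfolding renewal_kernel_def
proof (rule measure_of_eq_measure)
  fix A :: "'a set" assume A: "A \<in> sets borel"
  have d: "(\<lambda>j. x + displacement j) \<in> joint x \<rightarrow>\<^sub>M borel"
    unfolding measurable_joint using displacement_measurable by measurable
  have s: "survives \<in> borel_measurable (joint x)"
    unfolding measurable_joint by (rule survives_measurable)
  have "emeasure (distr (density (joint x) survives) borel (\<lambda>j. x + displacement j)) A =
      (\<integral>\<^sup>+y. indicator A y \<partial>distr (density (joint x) survives) borel (\<lambda>j. x + displacement j))"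
    using A by simp
  also have "\<dots> = (\<integral>\<^sup>+j. indicator A (x + displacement j) \<partial>density (joint x) survives)"
    using d A by (intro nn_integral_distr) simp_all
  also have "\<dots> = (\<integral>\<^sup>+j. survives j * indicator A (x + displacement j) \<partial>joint x)"
    using measurable_compose[OF d borel_measurable_indicator[OF A]] s by (intro nn_integral_density)
  finally show "(\<integral>\<^sup>+\<omega>. emeasure F ((\<lambda>a. a + Y \<omega> (\<zeta> \<omega>) - x) ` A) * indicator {\<omega>. ennreal (\<zeta> \<omega>) < T (Y \<omega>)} \<omega> \<partial>P x) =
      emeasure (distr (density (joint x) survives) borel (\<lambda>j. x + displacement j)) A"
    using emeasure_joint_shifted[OF A, of x] by simp
qed simp

lemma nn_integral_G:
  assumes f: "f \<in> borel_measurable borel"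
  shows "(\<integral>\<^sup>+z. f z \<partial>G x) = (\<integral>\<^sup>+j. survives j * f (x + displacement j) \<partial>joint x)"
proof -
  have d: "(\<lambda>j. x + displacement j) \<in> joint x \<rightarrow>\<^sub>M borel"
    unfolding measurable_joint using displacement_measurable by measurable
  have s: "survives \<in> borel_measurable (joint x)"
    unfolding measurable_joint by (rule survives_measurable)
  have "(\<integral>\<^sup>+z. f z \<partial>G x) = (\<integral>\<^sup>+j. f (x + displacement j) \<partial>density (joint x) survives)"
    unfolding G_eq using d f by (intro nn_integral_distr) simp_all
  also have "\<dots> = (\<integral>\<^sup>+j. survives j * f (x + displacement j) \<partial>joint x)"
    using measurable_compose[OF d f] s by (intro nn_integral_density)
  finally show ?thesis .
qed

lemma sets_G: "sets (G x) = sets borel"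
  unfolding G_eq by simp

lemma emeasure_G:
  assumes "A \<in> sets borel"
  shows "emeasure (G x) A = (\<integral>\<^sup>+j. survives j * indicator A (x + displacement j) \<partial>joint x)"
  using nn_integral_G[of "indicator A" x] assms by (simp add: sets_G)

lemma emeasure_G_UNIV: "emeasure (G x) UNIV = (\<integral>\<^sup>+j. survives j \<partial>joint x)"
  by (subst emeasure_G) simp_all

lemma joint_kernel: "joint \<in> borel \<rightarrow>\<^sub>M subprob_algebra (path_space \<Otimes>\<^sub>M (borel \<Otimes>\<^sub>M borel))"
proof -
  interpret F: prob_space F by (rule prob_F)
  interpret E: prob_space clock by (rule prob_clock)
  interpret EF: pair_prob_space clock F ..
  have "sets (clock \<Otimes>\<^sub>M F) = sets (borel \<Otimes>\<^sub>M borel)" by (intro sets_pair_measure_cong) (simp_all add: sets_F)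
  then have "clock \<Otimes>\<^sub>M F \<in> space (subprob_algebra (borel \<Otimes>\<^sub>M borel))"
    using EF.prob_space_axioms by (simp add: space_subprob_algebra prob_space_imp_subprob_space)
  then have "(\<lambda>_. clock \<Otimes>\<^sub>M F) \<in> borel \<rightarrow>\<^sub>M subprob_algebra (borel \<Otimes>\<^sub>M borel)" by simp
  from measurable_pair_measure[OF Y_kernel this] show ?thesis
    by (simp add: joint_def[abs_def])
qed

lemma G_kernel: "G \<in> borel \<rightarrow>\<^sub>M subprob_algebra borel"
proof (rule measurable_subprob_algebra)
  fix x
  have "emeasure (G x) UNIV \<le> (\<integral>\<^sup>+j. 1 \<partial>joint x)"
    unfolding emeasure_G_UNIV by (intro nn_integral_mono) (simp add: survives_def indicator_def)
  also have "\<dots> = 1" using prob_space.emeasure_space_1[OF prob_joint] by simp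
  finally show "subprob_space (G x)"
    using sets_eq_imp_space_eq[OF sets_G[of x]] by (intro subprob_spaceI) simp_all
  show "sets (G x) = sets borel" by (rule sets_G)
next
  fix A :: "'a set" assume A: "A \<in> sets borel"
  have "(\<lambda>(x, j). survives j * indicator A (x + displacement j)) \<in> borel_measurable (borel \<Otimes>\<^sub>M (path_space \<Otimes>\<^sub>M (borel \<Otimes>\<^sub>M borel)))"
    using survives_measurable displacement_measurable A by measurable
  from nn_integral_measurable_subprob_algebra2[OF this joint_kernel]
  show "(\<lambda>x. emeasure (G x) A) \<in> borel_measurable borel"
    unfolding emeasure_G[OF A] .
qed

lemma renewal_equation:
  assumes f: "f \<in> borel_measurable borel"
  shows "pot f x = pot_to_jump f x + (\<integral>\<^sup>+z. pot f (x - z) \<partial>G x)"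
proof -
  have "(\<lambda>z. pot f (x - z)) \<in> borel_measurable borel"
    by (rule measurable_compose[OF _ pot_measurable[OF f]]) simp
  from nn_integral_G[OF this] show ?thesis
    using pot_renewal[OF f, of x] by simp
qed

text \<open>Before \<open>\<zeta>\<close> the killing time of \<open>X\<close> may be replaced by that of
  \<open>Y\<close>, which is independent of the exponential time \<open>\<zeta>\<close>. So the mean of
  \<open>min \<zeta> T\<close> is \<open>1 / rate\<close> times the probability of \<open>\<zeta> <
  T\<close>.\<close>

lemma mean_time_to_jump: "pot_to_jump (\<lambda>_. 1) x = ennreal (1 / rate) * emeasure (G x) UNIV"
proof -
  note [measurable] = T_reg
  have m1: "(\<lambda>j :: (real \<Rightarrow> 'a) \<times> real \<times> 'a. min (ennreal (fst (snd j))) (T_reg (fst j))) \<in> borel_measurable (path_space \<Otimes>\<^sub>M (borel \<Otimes>\<^sub>M borel))"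
    by measurable
  interpret F: prob_space F by (rule prob_F)
  have "pot_to_jump (\<lambda>_. 1) x = (\<integral>\<^sup>+\<omega>. min (ennreal (\<zeta> \<omega>)) (T_reg (Y \<omega>)) \<partial>P x)"
    unfolding pot_to_jump_def occupation_one
    by (rule nn_integral_cong_AE) (use AE_T_reg[of x] AE_killing_agrees[of x] in eventually_elim, simp)
  also have "\<dots> = (\<integral>\<^sup>+w. \<integral>\<^sup>+r. min (ennreal r) (T_reg w) \<partial>clock \<partial>path_law P Y x)"
    using nn_integral_joint[OF m1, of x] nn_integral_joint_iterated[OF m1, of x] by (simp add: F.emeasure_space_1)
  also have "\<dots> = (\<integral>\<^sup>+w. ennreal (1 / rate) * emeasure clock {r. ennreal r < T_reg w} \<partial>path_law P Y x)"
    by (simp add: exponential_truncated_mean[OF pos(2)])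
  also have "\<dots> = ennreal (1 / rate) * (\<integral>\<^sup>+w. emeasure clock {r. ennreal r < T_reg w} \<partial>path_law P Y x)"
  proof (rule nn_integral_cmult)
    interpret E: prob_space clock by (rule prob_clock)
    have "{p \<in> space (path_space \<Otimes>\<^sub>M borel). ennreal (snd p) < T_reg (fst p)} \<in> sets (path_space \<Otimes>\<^sub>M borel)" by measurable
    also have "sets (path_space \<Otimes>\<^sub>M borel) = sets (path_space \<Otimes>\<^sub>M clock)" by (intro sets_pair_measure_cong) simp_all
    finally have "(\<lambda>w. emeasure clock (Pair w -` {p \<in> space (path_space \<Otimes>\<^sub>M borel). ennreal (snd p) < T_reg (fst p)})) \<in> borel_measurable path_space"
      by (rule E.measurable_emeasure_Pair)
    then have "(\<lambda>w. emeasure clock {r. ennreal r < T_reg w}) \<in> borel_measurable path_space"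
      by (rule measurable_cong[THEN iffD1, rotated]) (auto simp: space_pair_measure intro!: arg_cong[where f="emeasure clock"])
    then show "(\<lambda>w. emeasure clock {r. ennreal r < T_reg w}) \<in> borel_measurable (path_law P Y x)"
      by (simp only: measurable_path_law)
  qed
  also have "(\<integral>\<^sup>+w. emeasure clock {r. ennreal r < T_reg w} \<partial>path_law P Y x) =
      (\<integral>\<^sup>+w. \<integral>\<^sup>+r. \<integral>\<^sup>+v. survives (w, r, v) \<partial>F \<partial>clock \<partial>path_law P Y x)"
  proof (rule nn_integral_cong)
    fix w
    have "{r. ennreal r < T_reg w} \<in> sets borel" by measurable
    then have "emeasure clock {r. ennreal r < T_reg w} = (\<integral>\<^sup>+r. indicator {r. ennreal r < T_reg w} r \<partial>clock)"
      by simp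
    also have "\<dots> = (\<integral>\<^sup>+r. \<integral>\<^sup>+v. survives (w, r, v) \<partial>F \<partial>clock)"
      by (rule nn_integral_cong) (simp add: survives_def indicator_def F.emeasure_space_1)
    finally show "emeasure clock {r. ennreal r < T_reg w} = (\<integral>\<^sup>+r. \<integral>\<^sup>+v. survives (w, r, v) \<partial>F \<partial>clock)" .
  qed
  also have "\<dots> = emeasure (G x) UNIV"
    unfolding emeasure_G_UNIV
    by (simp add: nn_integral_joint_iterated[OF survives_measurable])
  finally show ?thesis .
qed

end


lemma extend_killed:
  "extend l (killed T w s) * indicator {0..} s = ennreal (l (w (max 0 s))) * indicator {s. 0 \<le> s \<and> ennreal s < T w} s"
  for l :: "'b \<Rightarrow> real" and T :: "(real \<Rightarrow> 'b) \<Rightarrow> ennreal"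
  by (simp add: extend_def killed_def indicator_def max_def)

context killed_jump_process
begin

lemma potential_eq_pot: "potential P X T l x = pot (\<lambda>y. ennreal (l y)) x"
  by (simp add: potential_def pot_def occupation_def extend_killed)

lemma potential_to_eq_pot_to_jump: "potential_to P X T l \<zeta> x = pot_to_jump (\<lambda>y. ennreal (l y)) x"
  unfolding potential_to_def pot_to_jump_def occupation_def
proof (rule nn_integral_cong, rule nn_integral_cong_AE)
  fix \<omega>
  have "{\<zeta> \<omega>} \<in> null_sets lborel" by (rule countable_imp_null_set_lborel) simp
  from AE_not_in[OF this]
  show "AE s in lborel. extend l (killed T (X \<omega>) s) * indicator {0..\<zeta> \<omega>} s =
      ennreal (l (X \<omega> (max 0 s))) * indicator {s. 0 \<le> s \<and> ennreal s < min (ennreal (\<zeta> \<omega>)) (T (X \<omega>))} s"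
  proof eventually_elim
    case (elim s)
    then have "s \<in> {0..\<zeta> \<omega>} \<longleftrightarrow> 0 \<le> s \<and> ennreal s < ennreal (\<zeta> \<omega>)" by (auto simp: ennreal_less_iff)
    then show ?case by (simp add: extend_def killed_def indicator_def max_def)
  qed
qed

lemma pot_Fubini:
  assumes f: "f \<in> borel_measurable borel"
  shows "pot f x = (\<integral>\<^sup>+s\<in>{0..}. (\<integral>\<^sup>+\<omega>. f (X \<omega> s) * indicator {\<omega>. ennreal s < T (X \<omega>)} \<omega> \<partial>P x) \<partial>lborel)"
proof -
  interpret prob_space "P x" by (rule P(1))
  interpret PL: pair_sigma_finite "P x" lborel ..
  have X': "X \<in> P x \<rightarrow>\<^sub>M path_space" using X(1) by (simp only: measurable_P)
  have c: "(\<lambda>\<omega>. T_reg (X \<omega>)) \<in> borel_measurable (P x)" by (rule measurable_compose[OF X' T_reg])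
  have "pot f x = (\<integral>\<^sup>+\<omega>. occupation f (T_reg (X \<omega>)) (X \<omega>) \<partial>P x)"
    unfolding pot_def by (rule nn_integral_cong_AE) (use AE_T_reg[of x] in eventually_elim, simp)
  also have "\<dots> = (\<integral>\<^sup>+s. \<integral>\<^sup>+\<omega>. f (X \<omega> (max 0 s)) * indicator {s. 0 \<le> s \<and> ennreal s < T_reg (X \<omega>)} s \<partial>P x \<partial>lborel)"
    unfolding occupation_def
    by (rule PL.Fubini'[symmetric]) (rule measurable_occupation_integrand[OF f X' c])
  also have "\<dots> = (\<integral>\<^sup>+s\<in>{0..}. (\<integral>\<^sup>+\<omega>. f (X \<omega> s) * indicator {\<omega>. ennreal s < T (X \<omega>)} \<omega> \<partial>P x) \<partial>lborel)"
  proof (rule nn_integral_cong)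
    fix s :: real
    show "(\<integral>\<^sup>+\<omega>. f (X \<omega> (max 0 s)) * indicator {s. 0 \<le> s \<and> ennreal s < T_reg (X \<omega>)} s \<partial>P x) =
      (\<integral>\<^sup>+\<omega>. f (X \<omega> s) * indicator {\<omega>. ennreal s < T (X \<omega>)} \<omega> \<partial>P x) * indicator {0..} s"
    proof (cases "0 \<le> s")
      case True
      have "(\<integral>\<^sup>+\<omega>. f (X \<omega> (max 0 s)) * indicator {s. 0 \<le> s \<and> ennreal s < T_reg (X \<omega>)} s \<partial>P x) =
        (\<integral>\<^sup>+\<omega>. f (X \<omega> s) * indicator {\<omega>. ennreal s < T (X \<omega>)} \<omega> \<partial>P x)"
        by (rule nn_integral_cong_AE) (use AE_T_reg[of x] in eventually_elim, simp add: True indicator_def)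
      then show ?thesis using True by simp
    qed simp
  qed
  finally show ?thesis .
qed

text \<open>The renewal equation for \<open>f = 1\<close> has the finite solution \<open>x \<mapsto> E\<^sup>x
  T\<close> and the inhomogeneity \<open>G x UNIV / rate\<close>, so that the masses of the powers of
  \<open>G\<close> vanish in the limit. This disposes of the remainder in the equation for \<open>f =
  l\<close>.\<close>

theorem renewal_and_representation:
  assumes l: "l \<in> borel_measurable borel" and bounded: "\<exists>C::real. \<forall>x. potential P X T l x \<le> ennreal C"
    and mean: "\<And>x. (\<integral>\<^sup>+\<omega>. T (X \<omega>) \<partial>P x) < \<infinity>"
  shows "potential P X T l x = potential_to P X T l \<zeta> x + (\<integral>\<^sup>+z. potential P X T l (x - z) \<partial>G x)"
    and "potential P X T l x = (\<integral>\<^sup>+y. potential_to P X T l \<zeta> (x - y) \<partial>kernel_power_sum G x)"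
proof -
  let ?f = "\<lambda>y. ennreal (l y)"
  have f: "?f \<in> borel_measurable borel" using l by measurable
  interpret K: translation_kernel G by standard (rule G_kernel)
  show "potential P X T l x = potential_to P X T l \<zeta> x + (\<integral>\<^sup>+z. potential P X T l (x - z) \<partial>G x)"
    unfolding potential_eq_pot potential_to_eq_pot_to_jump by (rule renewal_equation[OF f])
  have one: "pot (\<lambda>_. 1) x < \<infinity>" for x
    using mean[of x] by (simp add: pot_def occupation_one)
  have mass: "(\<lambda>n. emeasure (kernel_power G n x) UNIV) \<longlonglongrightarrow> 0" for x
  proof (rule K.kernel_power_mass_tendsto_0[OF pot_measurable one])
    show "pot (\<lambda>_. 1) x = ennreal (1 / rate) * emeasure (G x) UNIV + (\<integral>\<^sup>+z. pot (\<lambda>_. 1) (x - z) \<partial>G x)" for x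
      using renewal_equation[of "\<lambda>_. 1" x] by (simp only: mean_time_to_jump borel_measurable_const)
  qed (use pos in auto)
  obtain C :: real where C: "\<And>x. pot ?f x \<le> ennreal C"
    using bounded by (auto simp: potential_eq_pot)
  show "potential P X T l x = (\<integral>\<^sup>+y. potential_to P X T l \<zeta> (x - y) \<partial>kernel_power_sum G x)"
    unfolding potential_eq_pot potential_to_eq_pot_to_jump
    by (rule K.renewal_representation[OF pot_measurable[OF f] C _ pot_to_jump_measurable[OF f] renewal_equation[OF f] mass]) simp
qed

end

section \<open>The potential of the killed process\<close>

theorem theorem1:
  fixes M :: "'w measure"
    and P :: "real ^ 'd \<Rightarrow> 'w measure"
    and X Y Z :: "'w \<Rightarrow> real \<Rightarrow> real ^ 'd"
    and N :: "'w \<Rightarrow> real \<Rightarrow> nat"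
    and U :: "nat \<Rightarrow> 'w \<Rightarrow> real ^ 'd"
    and F :: "(real ^ 'd) measure"
    and T :: "(real \<Rightarrow> real ^ 'd) \<Rightarrow> ennreal"
    and l :: "real ^ 'd \<Rightarrow> real"
    and \<delta> rate :: real
  defines "\<FF> \<equiv> natural_filtration (range (path_law P X) \<union> range (path_law P Y))"
    and "u \<equiv> potential P X T l"
    and "h \<equiv> potential_to P X T l (first_jump N)"
    and "G \<equiv> renewal_kernel P Y T F (first_jump N)"
  assumes P: "\<And>x. prob_space (P x)" "\<And>x. sets (P x) = sets M"
    and X: "X \<in> measurable M path_space" "strong_markov \<FF> (path_law P X)"
    and Y: "Y \<in> measurable M path_space" "strong_markov \<FF> (path_law P Y)"
    and decomposition: "\<And>\<omega> t. \<omega> \<in> space M \<Longrightarrow> 0 \<le> t \<Longrightarrow> X \<omega> t = Y \<omega> t - Z \<omega> t"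
    and pos: "0 < \<delta>" "0 < rate"
    and small_jumps: "\<And>x. AE \<omega> in P x. \<forall>t>0. norm (Y \<omega> t - Lim (at_left t) (Y \<omega>)) < \<delta>"
    and Z: "\<And>x. compound_poisson_process (P x) rate F N U Z"
    and F: "AE v in F. \<delta> \<le> norm v"
    and indep: "\<And>x. prob_space.indep_var (P x) path_space Y path_space Z"
    and T: "terminal_time \<FF> (path_law P X) T"
    and T_jump: "\<And>x. AE \<omega> in P x. T (X \<omega>) = ennreal (first_jump N \<omega>) \<longrightarrow> T (path_shift (first_jump N \<omega>) (X \<omega>)) = 0"
    and l: "l \<in> borel_measurable borel" "bounded (range l)" "\<And>x. 0 \<le> l x"
      "\<And>x. (\<forall>i. 0 < x $ i) \<Longrightarrow> 0 < l x"
    and u_bounded: "\<exists>C::real. \<forall>x. u x \<le> ennreal C"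
    and T_finite_mean: "\<And>x. (\<integral>\<^sup>+\<omega>. T (X \<omega>) \<partial>P x) < \<infinity>"
  shows "(\<forall>x. u x = (\<integral>\<^sup>+s\<in>{0..}. (\<integral>\<^sup>+\<omega>. ennreal (l (X \<omega> s)) * indicator {\<omega>. ennreal s < T (X \<omega>)} \<omega> \<partial>P x) \<partial>lborel))
    \<and> (\<forall>x. u x = h x + (\<integral>\<^sup>+z. u (x - z) \<partial>G x))
    \<and> (\<forall>x. u x = kernel_conv h (kernel_power_sum G) x x
          \<and> kernel_conv h (kernel_power_sum G) x x = (\<integral>\<^sup>+y. h (x - y) \<partial>kernel_power_sum G x))"
proof -
  interpret killed_jump_process M P X Y Z N U F T \<delta> rate "range (path_law P X) \<union> range (path_law P Y)"
    by (rule killed_jump_process.intro; fact P X[unfolded \<FF>_def] Y[unfolded \<FF>_def] decomposition pos small_jumps Z F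
        indep T[unfolded \<FF>_def] T_jump)
      (rule reflexive)
  have f: "(\<lambda>x. ennreal (l x)) \<in> borel_measurable borel" using l(1) by measurable
  note renewal = renewal_and_representation[OF l(1) u_bounded[unfolded u_def] T_finite_mean]
  show ?thesis
  proof (intro conjI allI)
    fix x
    show "u x = (\<integral>\<^sup>+s\<in>{0..}. (\<integral>\<^sup>+\<omega>. ennreal (l (X \<omega> s)) * indicator {\<omega>. ennreal s < T (X \<omega>)} \<omega> \<partial>P x) \<partial>lborel)"
      unfolding u_def potential_eq_pot by (rule pot_Fubini[OF f])
    show "u x = h x + (\<integral>\<^sup>+z. u (x - z) \<partial>G x)"
      unfolding u_def h_def G_def by (rule renewal(1))
    show "u x = kernel_conv h (kernel_power_sum G) x x"
      unfolding u_def h_def G_def kernel_conv_def by (rule renewal(2))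
    show "kernel_conv h (kernel_power_sum G) x x = (\<integral>\<^sup>+y. h (x - y) \<partial>kernel_power_sum G x)"
      by (rule kernel_conv_def)
  qed
qed

end
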